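(* Let $n\ge 1$, $n<p<\infty$, and let $\rho$ be an admissible measure on $\mathbb{R}^n$. Suppose $v\in\mathcal{D}^{1,p}(\mathbb{R}^n)$ and $C$ is a constant for which $[w]_\rho\le C\|Dw\|_p$ holds for all $w\in\mathcal{D}^{1,p}(\mathbb{R}^n)$. Then there is an extremal $u\in\mathcal{D}^{1,p}(\mathbb{R}^n)$ such that $$\left(\frac{C}{2}\right)^p\|Du-Dv\|_p^p+[v]_\rho^p\le C^p\|Dv\|_p^p$$ if $2<p<\infty$, and $$\left(\frac{C}{2}\right)^{\frac{p}{p-1}}\|u'-v'\|_p^{\frac{p}{p-1}}+[v]_\rho^{\frac{p}{p-1}}\le C^{\frac{p}{p-1}}\|v'\|_p^{\frac{p}{p-1}}$$ if $1<p\le 2$ (in which case necessarily $n=1$).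
   Context: $\mathcal{D}^{1,p}(\mathbb{R}^n)$ is the space of $u\in L^1_{\rm loc}(\mathbb{R}^n)$ whose weak partial derivatives $u_{x_i}$, $i=1,\dots,n$, all belong to $L^p(\mathbb{R}^n)$. Since $p>n$, each $u$ is identified with its $(1-n/p)$-Hölder continuous representative. $\|Du\|_p:=\left(\int_{\mathbb{R}^n}|Du|^p\,dx\right)^{1/p}$; when $n=1$, $Du=u'$. An admissible measure is a signed Borel measure $\rho$ on $\mathbb{R}^n$ with compact support, $\rho(\mathbb{R}^n)=0$, and $\int_{\mathbb{R}^n}y\,d\rho(y)\ne 0$. $\mathcal{S}(n)$ is the set of similarity transformations $S(y)=\lambda Oy+z$ of $\mathbb{R}^n$ with $\lambda>0$, $O\in\mathrm{O}(n)$, $z\in\mathbb{R}^n$. The push forward is $(S_\#\rho)(A)=\rho(S^{-1}(A))$ for Borel $A\subset\mathbb{R}^n$. For $u\in\mathcal{D}^{1,p}(\mathbb{R}^n)$, $$[u]_\rho:=\sup\left\{\frac{\left|\int u\,d\mu\right|}{\left|\int x\,d\mu(x)\right|^{1-n/p}}:\ \mu=S_\#\rho,\ S\in\mathcal{S}(n)\right\}.$$ $C_*$ is the smallest constant $C$ such that the generalized Morrey inequality $[u]_\rho\le C\|Du\|_p$ holds for all $u\in\mathcal{D}^{1,p}(\mathbb{R}^n)$. An extremal is a $u\in\mathcal{D}^{1,p}(\mathbb{R}^n)$ with $[u]_\rho=C_*\|Du\|_p$. *)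

theory Defs
  imports "HOL-Analysis.Analysis"
begin

section \<open>Signed measures\<close>

text \<open>
  A signed Borel measure is a countably additive real-valued set function on the Borel sets; its
  values on other sets are irrelevant. Real values lose nothing here: a signed measure with values
  in the extended reals that is finite on the whole space is finite on every Borel set.
\<close>

definition signed_borel_measure :: "('a::topological_space set \<Rightarrow> real) \<Rightarrow> bool" where
  "signed_borel_measure \<rho> \<longleftrightarrow>
     \<rho> {} = 0 \<and>
     (\<forall>A :: nat \<Rightarrow> 'a set. range A \<subseteq> sets borel \<longrightarrow> disjoint_family A \<longrightarrow>
        (\<lambda>i. \<rho> (A i)) sums \<rho> (\<Union>i. A i))"

text \<open>
  The upper variation \<open>\<rho>\<^sup>+\<close> of the Jordan decomposition; the lower variation is the upper variation
  of \<open>-\<rho>\<close>. Negative values of \<open>\<rho>\<close> are truncated to \<open>0 = \<rho> {}\<close> by \<^const>\<open>ennreal\<close>, which does not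
  change the supremum.
\<close>

definition upper_variation :: "('a::topological_space set \<Rightarrow> real) \<Rightarrow> 'a measure" where
  "upper_variation \<rho> =
     measure_of UNIV (sets borel) (\<lambda>A. SUP B\<in>{B \<in> sets borel. B \<subseteq> A}. ennreal (\<rho> B))"

definition signed_integral ::
    "('a::topological_space set \<Rightarrow> real) \<Rightarrow> ('a \<Rightarrow> 'b::{banach, second_countable_topology}) \<Rightarrow> 'b" where
  "signed_integral \<rho> f =
     integral\<^sup>L (upper_variation \<rho>) f - integral\<^sup>L (upper_variation (\<lambda>A. - \<rho> A)) f"

text \<open>The complement of the largest open set all of whose Borel subsets are null.\<close>

definition signed_support :: "('a::topological_space set \<Rightarrow> real) \<Rightarrow> 'a set" where
  "signed_support \<rho> = - \<Union>{U. open U \<and> (\<forall>A \<in> sets borel. A \<subseteq> U \<longrightarrow> \<rho> A = 0)}"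

definition push_forward :: "('a \<Rightarrow> 'b) \<Rightarrow> ('a set \<Rightarrow> real) \<Rightarrow> 'b set \<Rightarrow> real" where
  "push_forward S \<rho> A = \<rho> (S -` A)"

definition admissible :: "((real^'n) set \<Rightarrow> real) \<Rightarrow> bool" where
  "admissible \<rho> \<longleftrightarrow>
     signed_borel_measure \<rho> \<and> compact (signed_support \<rho>) \<and> \<rho> UNIV = 0 \<and>
     signed_integral \<rho> (\<lambda>y. y) \<noteq> 0"

definition similarities :: "((real^'n) \<Rightarrow> (real^'n)) set" where
  "similarities = {(\<lambda>y. r *\<^sub>R T y + z) | r T z. r > 0 \<and> orthogonal_transformation T}"


section \<open>The homogeneous Sobolev space\<close>

definition partial_deriv :: "'n \<Rightarrow> (real^'n \<Rightarrow> real) \<Rightarrow> (real^'n \<Rightarrow> real)" where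
  "partial_deriv i f x = frechet_derivative f (at x) (axis i 1)"

text \<open>
  Smooth functions with compact support. Differentiability (in the sense of Frechet) of all iterated
  partial derivatives is the same as existence and continuity of the partial derivatives of all
  orders.
\<close>

definition test_function :: "(real^'n \<Rightarrow> real) \<Rightarrow> bool" where
  "test_function \<phi> \<longleftrightarrow>
     (\<forall>is x. foldr partial_deriv is \<phi> differentiable (at x)) \<and>
     compact (closure {x. \<phi> x \<noteq> 0})"

text \<open>
  Functions defined up to null sets are represented by Borel functions, so that \<^const>\<open>lborel\<close> can be
  used throughout; every Lebesgue measurable function has such a representative.
\<close>

definition locally_integrable :: "(real^'n \<Rightarrow> real) \<Rightarrow> bool" where
  "locally_integrable f \<longleftrightarrow>
     f \<in> borel_measurable lborel \<and> (\<forall>K. compact K \<longrightarrow> set_integrable lborel K f)"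

definition is_weak_partial :: "'n \<Rightarrow> (real^'n \<Rightarrow> real) \<Rightarrow> (real^'n \<Rightarrow> real) \<Rightarrow> bool" where
  "is_weak_partial i u g \<longleftrightarrow>
     locally_integrable g \<and>
     (\<forall>\<phi>. test_function \<phi> \<longrightarrow>
        (LINT x|lborel. u x * partial_deriv i \<phi> x) = - (LINT x|lborel. g x * \<phi> x))"

definition in_Lp :: "real \<Rightarrow> (real^'n \<Rightarrow> real) \<Rightarrow> bool" where
  "in_Lp p f \<longleftrightarrow> f \<in> borel_measurable lborel \<and> integrable lborel (\<lambda>x. \<bar>f x\<bar> powr p)"

definition holder_continuous :: "real \<Rightarrow> (real^'n \<Rightarrow> real) \<Rightarrow> bool" where
  "holder_continuous \<alpha> u \<longleftrightarrow> (\<exists>H. \<forall>x y. \<bar>u x - u y\<bar> \<le> H * dist x y powr \<alpha>)"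

text \<open>
  The space \<open>D\<^sup>1\<^sup>,\<^sup>p(\<real>\<^sup>n)\<close> for \<open>p > n\<close>: its elements are the Hoelder continuous representatives, so they
  are honest functions rather than classes modulo null sets.
\<close>

definition D1p :: "real \<Rightarrow> (real^'n \<Rightarrow> real) set" where
  "D1p p = {u. locally_integrable u \<and>
               (\<forall>i. \<exists>g. is_weak_partial i u g \<and> in_Lp p g) \<and>
               holder_continuous (1 - real CARD('n) / p) u}"

text \<open>A choice of the weak gradient, which is unique up to null sets.\<close>

definition weak_grad :: "(real^'n \<Rightarrow> real) \<Rightarrow> (real^'n \<Rightarrow> real^'n)" where
  "weak_grad u x = (\<chi> i. (SOME g. is_weak_partial i u g) x)"

definition Lp_norm :: "real \<Rightarrow> (real^'n \<Rightarrow> real^'n) \<Rightarrow> real" where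
  "Lp_norm p F = (LINT x|lborel. norm (F x) powr p) powr (1 / p)"


section \<open>The generalized Morrey inequality\<close>

text \<open>
  The supremum is taken in the extended reals, since its finiteness is part of the Morrey inequality.
\<close>

definition morrey_seminorm ::
    "real \<Rightarrow> ((real^'n) set \<Rightarrow> real) \<Rightarrow> (real^'n \<Rightarrow> real) \<Rightarrow> ereal" where
  "morrey_seminorm p \<rho> u =
     (SUP \<mu> \<in> {push_forward S \<rho> | S. S \<in> similarities}.
        ereal (\<bar>signed_integral \<mu> u\<bar> /
               norm (signed_integral \<mu> (\<lambda>x. x)) powr (1 - real CARD('n) / p)))"

definition morrey_inequality :: "real \<Rightarrow> ((real^'n) set \<Rightarrow> real) \<Rightarrow> real \<Rightarrow> bool" where
  "morrey_inequality p \<rho> C \<longleftrightarrow>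
     (\<forall>w \<in> D1p p. morrey_seminorm p \<rho> w \<le> ereal (C * Lp_norm p (weak_grad w)))"

definition morrey_constant :: "real \<Rightarrow> ((real^'n) set \<Rightarrow> real) \<Rightarrow> real" where
  "morrey_constant p \<rho> = (LEAST C. morrey_inequality p \<rho> C)"

definition extremal :: "real \<Rightarrow> ((real^'n) set \<Rightarrow> real) \<Rightarrow> (real^'n \<Rightarrow> real) \<Rightarrow> bool" where
  "extremal p \<rho> u \<longleftrightarrow>
     u \<in> D1p p \<and>
     morrey_seminorm p \<rho> u = ereal (morrey_constant p \<rho> * Lp_norm p (weak_grad u))"

end

theory Submission
  imports Defs
begin

text \<open>
  Let \<open>l(w) = \<integral> w d\<rho>\<close>. Under a similarity of ratio \<open>r\<close>, both \<open>\<parallel>Dw\<parallel>\<^sub>p\<close> and the denominator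
  of the Morrey quotient scale by \<open>r powr (1 - n / p)\<close>, so the optimal constant is governed by the
  minimization of \<open>\<parallel>Dw\<parallel>\<^sub>p\<close> over \<open>l(w) = 1\<close>. By Clarkson's inequalities minimizing sequences are
  Cauchy, and by Morrey's estimate the space is complete, so there is a minimizer; rescaled and
  moved by similarities it gives extremals \<open>u\<close> that take the same value as \<open>v\<close> under a given
  pushforward \<open>\<mu>\<close> of \<open>\<rho>\<close>. For such \<open>u\<close> the midpoint of \<open>u\<close> and \<open>v\<close> has the same value, hence a
  gradient norm at least that of \<open>u\<close>, and Clarkson's inequality bounds \<open>\<parallel>Du - Dv\<parallel>\<^sub>p\<close>. The
  continuity of \<open>l\<close> is part of the assumed inequality.
\<close>

section \<open>Smooth functions of one variable\<close>

text \<open>The test functions built from scratch are products of one-variable functions. They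
  suffice for two reasons: they approximate indicators of boxes, which makes weak gradients unique;
  and two products that differ in one factor, of the same integral, differ by a partial derivative
  of a test function. Hence Morrey's estimate can be read off the weak formulation itself, with no
  approximation of \<open>u\<close> by smooth functions. That estimate is needed because L^p
  convergence of gradients says nothing about values. Functions normalised at 0 converge locally
  uniformly; the functional does not see the constants, being bounded by the gradient norm.
  Exponents up to 2 force dimension one, so vector fields meet Clarkson's inequality only for
  \<open>p > 2\<close>, where the parallelogram law is enough. The factor 1/2 in that inequality is
  the source of \<open>C / 2\<close>. Whether the integral against \<open>\<rho>\<close> vanishes on
  the whole space is left open: if it does, \<open>v\<close> is its own extremal.\<close>

coinductive smooth1 :: "(real \<Rightarrow> real) \<Rightarrow> bool" where
  "(\<And>t. (f has_real_derivative f' t) (at t)) \<Longrightarrow> smooth1 f' \<Longrightarrow> smooth1 f"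

lemma smooth1_derivE:
  assumes "smooth1 f"
  obtains f' where "\<And>t. (f has_real_derivative f' t) (at t)" "smooth1 f'"
  using assms by (meson smooth1.cases)

text \<open>The derivative in \<open>smooth1\<close> is hidden behind an existential, so derivatives
  of higher order never have to be computed: it is enough to name a class of functions, containing
  the given one, that is closed under differentiation.\<close>

lemma smooth1_coinduct_deriv:
  assumes "X f" and "\<And>f. X f \<Longrightarrow> \<exists>f'. (\<forall>t. (f has_real_derivative f' t) (at t)) \<and> X f'"
  shows "smooth1 f"
  using assms(1) by (rule smooth1.coinduct) (use assms(2) in blast)

lemma smooth1_isCont: "smooth1 f \<Longrightarrow> isCont f t"
  by (meson smooth1_derivE DERIV_isCont)

lemma smooth1_continuous_on: "smooth1 f \<Longrightarrow> continuous_on A f"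
  by (simp add: continuous_at_imp_continuous_on smooth1_isCont)

lemma smooth1_measurable [measurable]: "smooth1 f \<Longrightarrow> f \<in> borel_measurable borel"
  by (simp add: borel_measurable_continuous_onI smooth1_continuous_on)

text \<open>Products are not closed under differentiation, finite sums of products are.\<close>

lemma smooth1_sum_list_mult:
  assumes "\<forall>(f, g)\<in>set L. smooth1 f \<and> smooth1 g"
  shows "smooth1 (\<lambda>t. \<Sum>(f, g)\<leftarrow>L. f t * g t)"
proof (rule smooth1_coinduct_deriv[where X="\<lambda>h. \<exists>L. h = (\<lambda>t. \<Sum>(f, g)\<leftarrow>L. f t * g t) \<and>
    (\<forall>(f, g)\<in>set L. smooth1 f \<and> smooth1 g)"])
  show "\<exists>M. (\<lambda>t. \<Sum>(f, g)\<leftarrow>L. f t * g t) = (\<lambda>t. \<Sum>(f, g)\<leftarrow>M. f t * g t) \<and>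
      (\<forall>(f, g)\<in>set M. smooth1 f \<and> smooth1 g)"
    using assms by blast
next
  define h where "h = (\<lambda>L. \<lambda>t::real. \<Sum>(f, g)\<leftarrow>L. f t * g t :: real)"
  fix H :: "real \<Rightarrow> real" assume "\<exists>L. H = (\<lambda>t. \<Sum>(f, g)\<leftarrow>L. f t * g t) \<and>
      (\<forall>(f, g)\<in>set L. smooth1 f \<and> smooth1 g)"
  then obtain M where M: "H = h M" "\<forall>(f, g)\<in>set M. smooth1 f \<and> smooth1 g"
    unfolding h_def by blast
    have "\<exists>L'. (\<forall>(f, g)\<in>set L'. smooth1 f \<and> smooth1 g) \<and> (\<forall>t. (h M has_real_derivative h L' t) (at t))"
      using M(2)
    proof (induction M)
      case Nil
      show ?case by (rule exI[of _ "[]"]) (simp add: h_def)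
    next
      case (Cons q L)
      then obtain L' where L': "\<forall>(f, g)\<in>set L'. smooth1 f \<and> smooth1 g"
          "\<And>t. (h L has_real_derivative h L' t) (at t)" by auto
      obtain f g where q: "q = (f, g)" by force
      from Cons have "smooth1 f" "smooth1 g" by (auto simp: q)
      then obtain f' g' where d: "\<And>t. (f has_real_derivative f' t) (at t)" "smooth1 f'"
          "\<And>t. (g has_real_derivative g' t) (at t)" "smooth1 g'"
        using smooth1_derivE[OF \<open>smooth1 f\<close>] smooth1_derivE[OF \<open>smooth1 g\<close>] by metis
      have hh: "h (q # L) = (\<lambda>t. f t * g t + h L t)"
           "h ((f', g) # (f, g') # L') = (\<lambda>t. f' t * g t + (f t * g' t + h L' t))"
        by (auto simp: h_def q)
      show ?case
        by (rule exI[of _ "(f', g) # (f, g') # L'"], unfold hh)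
           (use L' d \<open>smooth1 f\<close> \<open>smooth1 g\<close> in \<open>auto intro!: derivative_eq_intros\<close>)
    qed
    then obtain L' where L': "\<forall>(f, g)\<in>set L'. smooth1 f \<and> smooth1 g"
      "\<And>t. (h M has_real_derivative h L' t) (at t)" by blast
    then show "\<exists>H'. (\<forall>t. (H has_real_derivative H' t) (at t)) \<and>
      (\<exists>L. H' = (\<lambda>t. \<Sum>(f, g)\<leftarrow>L. f t * g t) \<and> (\<forall>(f, g)\<in>set L. smooth1 f \<and> smooth1 g))"
      unfolding M(1) by (intro exI[of _ "h L'"] conjI exI[of _ L'] allI) (auto simp: h_def)
qed

lemma smooth1_mult: "smooth1 f \<Longrightarrow> smooth1 g \<Longrightarrow> smooth1 (\<lambda>t. f t * g t)"
  using smooth1_sum_list_mult[of "[(f, g)]"] by simp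

lemma smooth1_const: "smooth1 (\<lambda>_. c)"
proof (rule smooth1_coinduct_deriv[where X="\<lambda>f. \<exists>c. f = (\<lambda>_. c)"])
  fix f :: "real \<Rightarrow> real" assume "\<exists>c. f = (\<lambda>_. c)"
  then have "(f has_real_derivative (\<lambda>_. 0) t) (at t)" for t by auto
  then show "\<exists>f'. (\<forall>t. (f has_real_derivative f' t) (at t)) \<and> (\<exists>c. f' = (\<lambda>_. c))"
    by (intro exI[of _ "\<lambda>_. 0"] conjI allI) auto
qed blast

lemma smooth1_diff:
  assumes "smooth1 f" "smooth1 g" shows "smooth1 (\<lambda>t. f t - g t)"
  using smooth1_sum_list_mult[of "[(f, \<lambda>_. 1), (g, \<lambda>_. -1)]"] assms by (simp add: smooth1_const)

text \<open>The factor \<open>k\<close> is there for the coinduction: each differentiation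
  multiplies by \<open>a\<close>.\<close>

lemma smooth1_affine:
  assumes "smooth1 f" shows "smooth1 (\<lambda>t. k * f (a * t + b))"
proof (rule smooth1_coinduct_deriv[where X="\<lambda>h. \<exists>k f. h = (\<lambda>t. k * f (a * t + b)) \<and> smooth1 f"])
  show "\<exists>k' f'. (\<lambda>t. k * f (a * t + b)) = (\<lambda>t. k' * f' (a * t + b)) \<and> smooth1 f'"
    using assms by blast
next
  fix h :: "real \<Rightarrow> real" assume "\<exists>k f. h = (\<lambda>t. k * f (a * t + b)) \<and> smooth1 f"
  then obtain l g where g: "h = (\<lambda>t. l * g (a * t + b))" "smooth1 g" by blast
  then obtain g' where g': "\<And>t. (g has_real_derivative g' t) (at t)" "smooth1 g'"
    using smooth1_derivE by blast
  have d: "((\<lambda>t. a * t + b) has_real_derivative a) (at t)" for t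
    by (auto intro!: derivative_eq_intros)
  have "(h has_real_derivative (\<lambda>t. (l * a) * g' (a * t + b)) t) (at t)" for t
    unfolding g(1) using DERIV_cmult[OF DERIV_chain2[OF g'(1) d], of l t] by (simp add: mult_ac)
  then show "\<exists>h'. (\<forall>t. (h has_real_derivative h' t) (at t)) \<and>
      (\<exists>k f. h' = (\<lambda>t. k * f (a * t + b)) \<and> smooth1 f)"
    using g'(2) by (intro exI[of _ "\<lambda>t. (l * a) * g' (a * t + b)"] conjI allI) blast+
qed

section \<open>Flat functions and bumps\<close>

definition poly_exp :: "real poly \<Rightarrow> real \<Rightarrow> real" where
  "poly_exp P t = (if t > 0 then poly P (1 / t) * exp (- 1 / t) else 0)"

lemma poly_exp_tendsto: "((\<lambda>s::real. poly P s * exp (- s)) \<longlongrightarrow> 0) at_top"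
proof -
  have "((\<lambda>s. \<Sum>i\<le>degree P. coeff P i * (s ^ i / exp s)) \<longlongrightarrow> (\<Sum>i\<le>degree P. coeff P i * 0)) at_top"
    by (intro tendsto_sum tendsto_mult tendsto_const tendsto_power_div_exp_0)
  moreover have "(\<lambda>s. \<Sum>i\<le>degree P. coeff P i * (s ^ i / exp s)) = (\<lambda>s. poly P s * exp (- s))"
    by (simp add: poly_altdef sum_distrib_right exp_minus field_simps sum_divide_distrib)
  ultimately show ?thesis by simp
qed

text \<open>With \<open>s = 1 / t\<close>, the derivative of \<open>P(s) * exp (- s)\<close> in
  \<open>t\<close> is \<open>s^2 * (P - P')(s) * exp (- s)\<close>, so the functions
  \<open>poly_exp P\<close> are closed under differentiation; \<open>P = 1\<close> is the classical
  flat function. Only \<open>t = 0\<close> needs a limit.\<close>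

lemma poly_exp_deriv:
  "(poly_exp P has_real_derivative poly_exp ([:0, 0, 1:] * (P - pderiv P)) t) (at t)"
proof (cases t "0 :: real" rule: linorder_cases)
  case less
  then have "eventually (\<lambda>x. x < 0) (nhds t)" using eventually_nhds_in_open[of "{..<0}" t] by simp
  then have "eventually (\<lambda>x. poly_exp P x = 0) (nhds t)"
    by eventually_elim (simp add: poly_exp_def)
  with less show ?thesis by (subst DERIV_cong_ev[where y=t]) (auto simp: poly_exp_def)
next
  case greater
  then have "eventually (\<lambda>x. x > 0) (nhds t)" using eventually_nhds_in_open[of "{0<..}" t] by simp
  then have "eventually (\<lambda>x. poly_exp P x = poly P (1 / x) * exp (- 1 / x)) (nhds t)"
    by eventually_elim (simp add: poly_exp_def)
  moreover have "((\<lambda>x. poly P (1 / x) * exp (- 1 / x)) has_real_derivative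
       poly_exp ([:0, 0, 1:] * (P - pderiv P)) t) (at t)"
    using greater
    by (auto intro!: derivative_eq_intros poly_DERIV[THEN DERIV_chain2]
        simp: poly_exp_def field_simps power2_eq_square)
  ultimately show ?thesis by (subst DERIV_cong_ev[where y=t]) auto
next
  case equal
  have "((\<lambda>h. (poly_exp P (0 + h) - poly_exp P 0) / h) \<longlongrightarrow> 0) (at 0)"
    unfolding filterlim_at_split
  proof
    have "eventually (\<lambda>h::real. h < 0) (at_left 0)"
      by (simp add: eventually_at_filter)
    then have "eventually (\<lambda>h. 0 = (poly_exp P (0 + h) - poly_exp P 0) / h) (at_left 0)"
      by eventually_elim (simp add: poly_exp_def)
    then show "((\<lambda>h. (poly_exp P (0 + h) - poly_exp P 0) / h) \<longlongrightarrow> 0) (at_left 0)"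
      by (rule Lim_transform_eventually[OF tendsto_const])
    \<comment> \<open>The difference quotient at 0 is \<open>s * P(s) * exp (- s)\<close> with
      \<open>s = 1 / h\<close>, that is, \<open>pCons 0 P\<close> takes the place of
      \<open>P\<close>.\<close>
    have "((\<lambda>h. poly (pCons 0 P) (inverse h) * exp (- inverse h)) \<longlongrightarrow> 0) (at_right 0)"
      by (rule filterlim_compose[OF poly_exp_tendsto filterlim_inverse_at_top_right])
    moreover have "eventually (\<lambda>h::real. h > 0) (at_right 0)"
      by (simp add: eventually_at_filter)
    then have "eventually (\<lambda>h. poly (pCons 0 P) (inverse h) * exp (- inverse h) =
         (poly_exp P (0 + h) - poly_exp P 0) / h) (at_right 0)"
      by eventually_elim (simp add: poly_exp_def field_simps)
    ultimately show "((\<lambda>h. (poly_exp P (0 + h) - poly_exp P 0) / h) \<longlongrightarrow> 0) (at_right 0)"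
      by (rule Lim_transform_eventually)
  qed
  with equal show ?thesis by (simp add: DERIV_def poly_exp_def)
qed

lemma smooth1_poly_exp: "smooth1 (poly_exp P)"
proof (rule smooth1_coinduct_deriv[where X="\<lambda>h. \<exists>P. h = poly_exp P"])
  fix h assume "\<exists>P. h = poly_exp P"
  then obtain P where "h = poly_exp P" ..
  then show "\<exists>h'. (\<forall>t. (h has_real_derivative h' t) (at t)) \<and> (\<exists>P. h' = poly_exp P)"
    using poly_exp_deriv by blast
qed blast

text \<open>\<open>k\<close> is a steepness: as it grows the bump tends to the indicator of the open
  interval, while \<open>k = 1\<close> serves as a mollifier.\<close>

definition bump :: "real \<Rightarrow> real \<Rightarrow> real \<Rightarrow> real \<Rightarrow> real" where
  "bump k a b t = poly_exp 1 (k * (t - a)) * poly_exp 1 (k * (b - t))"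

lemma smooth1_bump: "smooth1 (bump k a b)"
proof -
  have "smooth1 (\<lambda>t. (1 * poly_exp 1 (k * t + (- k * a))) * (1 * poly_exp 1 ((- k) * t + k * b)))"
    by (intro smooth1_mult smooth1_affine smooth1_poly_exp)
  then show ?thesis unfolding bump_def by (simp add: algebra_simps)
qed

lemma poly_exp_1_bounds: "0 \<le> poly_exp 1 t" "poly_exp 1 t \<le> 1"
  by (auto simp: poly_exp_def)

lemma bump_bounds: "0 \<le> bump k a b t" "bump k a b t \<le> 1"
  by (auto simp: bump_def poly_exp_1_bounds mult_le_one)

lemma bump_outside: "k > 0 \<Longrightarrow> t \<le> a \<or> t \<ge> b \<Longrightarrow> bump k a b t = 0"
  by (auto simp: bump_def poly_exp_def zero_less_mult_iff)

lemma bump_pos: "k > 0 \<Longrightarrow> a < t \<Longrightarrow> t < b \<Longrightarrow> bump k a b t > 0"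
  by (auto simp: bump_def poly_exp_def)

lemma bump_tendsto:
  "(\<lambda>m. bump (real (Suc m)) a b t) \<longlonglongrightarrow> (if a < t \<and> t < b then 1 else 0)"
proof (cases "a < t \<and> t < b")
  case True
  have 1: "(\<lambda>m. poly_exp 1 (real (Suc m) * s)) \<longlonglongrightarrow> 1" if "s > 0" for s
  proof -
    have "(\<lambda>m. exp (- (1 / s) * inverse (real (Suc m)))) \<longlonglongrightarrow> exp (- (1/s) * 0)"
      by (intro tendsto_intros LIMSEQ_inverse_real_of_nat)
    moreover have "exp (- (1 / s) * inverse (real (Suc m))) = poly_exp 1 (real (Suc m) * s)" for m
      using that by (simp add: poly_exp_def divide_inverse mult_pos_pos)
    ultimately show ?thesis by simp
  qed
  have "(\<lambda>m. bump (real (Suc m)) a b t) \<longlonglongrightarrow> 1 * 1"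
    unfolding bump_def using True by (intro tendsto_mult 1) auto
  with True show ?thesis by simp
next
  case False
  then have "bump (real (Suc m)) a b t = 0" for m by (intro bump_outside) auto
  then show ?thesis using False by (auto simp del: of_nat_Suc)
qed

text \<open>The primitive that vanishes left of \<open>a\<close> is constant right of
  \<open>b\<close>, and the vanishing integral makes this constant 0. So it can be a factor of a
  test function. The bound by the L^1 norm of \<open>f\<close> holds independently of the length of
  the interval.\<close>

lemma smooth1_antiderivative:
  assumes f: "smooth1 f" and ab: "a < b" "\<And>t. t \<le> a \<or> b \<le> t \<Longrightarrow> f t = 0"
    and int: "(LINT t|lborel. f t) = 0"
  obtains F where "\<And>t. (F has_real_derivative f t) (at t)" "smooth1 F"
    "\<And>t. t \<le> a \<or> b \<le> t \<Longrightarrow> F t = 0" "\<And>t. \<bar>F t\<bar> \<le> (LINT t|lborel. \<bar>f t\<bar>)"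
proof -
  have "\<exists>F. \<forall>x :: real. -\<infinity> < ereal x \<longrightarrow> ereal x < \<infinity> \<longrightarrow> (F has_vector_derivative f x) (at x)"
    by (rule einterval_antiderivative) (simp_all add: smooth1_isCont[OF f])
  then obtain G where G: "\<And>x. (G has_real_derivative f x) (at x)"
    by (auto simp: has_real_derivative_iff_has_vector_derivative)
  define F where "F t = G t - G a" for t
  have F: "(F has_real_derivative f t) (at t)" for t
    unfolding F_def using G[of t] by (auto intro!: derivative_eq_intros)
  have FTC: "has_bochner_integral lborel (\<lambda>x. indicator {c..d} x * f x) (F d - F c)" if "c \<le> d" for c d
    using has_bochner_integral_FTC_Icc_real[OF that, of F f] F smooth1_isCont[OF f]
    by (simp add: mult.commute)
  have Fa: "F a = 0" by (simp add: F_def)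
  have ind: "indicator {a..b} x * f x = f x" for x
    using ab(2)[of x] by (cases "x \<in> {a..b}") auto
  have "has_bochner_integral lborel f (F b - F a)"
    using FTC[of a b] ab(1) by (simp add: ind)
  then have fi: "integrable lborel f" and Fb: "F b = 0"
    using int Fa by (auto simp: has_bochner_integral_iff)
  have bound: "\<bar>F t\<bar> \<le> (LINT t|lborel. \<bar>f t\<bar>)" if "a \<le> t" for t
  proof -
    have "F t = (LINT x|lborel. indicator {a..t} x * f x)"
      using FTC[OF that] Fa by (simp add: has_bochner_integral_iff)
    also have "\<bar>\<dots>\<bar> \<le> (LINT x|lborel. \<bar>indicator {a..t} x * f x\<bar>)"
      by (rule integral_abs_bound)
    also have "\<dots> \<le> (LINT t|lborel. \<bar>f t\<bar>)"
      by (rule integral_mono')  (use fi in \<open>auto simp: indicator_def\<close>)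
    finally show ?thesis .
  qed
  have const: "F d = F c" if "c \<le> d" "d \<le> a \<or> b \<le> c" for c d
  proof -
    have "(\<lambda>x. indicator {c..d} x * f x) = (\<lambda>_. 0)"
      using ab(2) that by (force simp: indicator_def)
    then show ?thesis using FTC[OF that(1)] by (simp add: has_bochner_integral_iff)
  qed
  have out: "F t = 0" if "t \<le> a \<or> b \<le> t" for t
    using that const[of t a] const[of b t] Fa Fb by auto
  have "\<bar>F t\<bar> \<le> (LINT t|lborel. \<bar>f t\<bar>)" for t
    using bound[of t] out[of t] by (cases "a \<le> t") auto
  moreover have "smooth1 F" using smooth1.intros[OF F f] .
  ultimately show ?thesis using that F out by blast
qed

section \<open>Test functions\<close>

coinductive smoothn :: "(real^'n \<Rightarrow> real) \<Rightarrow> bool" where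
  "(\<And>x. f differentiable (at x)) \<Longrightarrow> (\<And>i. smoothn (partial_deriv i f)) \<Longrightarrow> smoothn f"

lemma smoothn_coinduct_deriv:
  assumes "X f" and "\<And>f. X f \<Longrightarrow> (\<forall>x. f differentiable (at x)) \<and> (\<forall>i. X (partial_deriv i f))"
  shows "smoothn f"
  using assms(1) by (rule smoothn.coinduct) (use assms(2) in blast)

lemma smoothn_differentiable: "smoothn f \<Longrightarrow> f differentiable (at x)"
  by (meson smoothn.cases)

lemma smoothn_partial_deriv: "smoothn f \<Longrightarrow> smoothn (partial_deriv i f)"
  by (meson smoothn.cases)

text \<open>Links the quantifier over index lists in \<open>test_function\<close> with the
  coinductive form, in which closure properties are proved.\<close>

lemma smoothn_iff_foldr: "smoothn f \<longleftrightarrow> (\<forall>is x. foldr partial_deriv is f differentiable (at x))"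
proof
  assume "smoothn f"
  have "smoothn (foldr partial_deriv is f)" for "is"
    by (induction "is") (use \<open>smoothn f\<close> smoothn_partial_deriv in auto)
  then show "\<forall>is x. foldr partial_deriv is f differentiable (at x)"
    by (simp add: smoothn_differentiable)
next
  assume "\<forall>is x. foldr partial_deriv is f differentiable (at x)"
  then show "smoothn f"
  proof (rule smoothn_coinduct_deriv)
    fix g :: "real^'a \<Rightarrow> real"
    assume g: "\<forall>is x. foldr partial_deriv is g differentiable (at x)"
    \<comment> \<open>Appending \<open>i\<close> at the end of the list makes it the first
      differentiation.\<close>
    have "foldr partial_deriv is (partial_deriv i g) differentiable (at x)" for "is" i x
      using g[rule_format, of "is @ [i]" x] by simp
    moreover have "g differentiable (at x)" for x
      using g[rule_format, of "[]" x] by simp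
    ultimately show "(\<forall>x. g differentiable (at x)) \<and>
       (\<forall>i is x. foldr partial_deriv is (partial_deriv i g) differentiable (at x))" by blast
  qed
qed

lemma partial_deriv_eqI: "(f has_derivative D) (at x) \<Longrightarrow> partial_deriv i f x = D (axis i 1)"
  unfolding partial_deriv_def using frechet_derivative_at by metis

lemma has_derivative_partial_deriv:
  assumes "f differentiable (at x)"
  shows "(f has_derivative (\<lambda>v. \<Sum>i\<in>UNIV. v $ i * partial_deriv i f x)) (at x)"
proof -
  let ?D = "frechet_derivative f (at x)"
  have D: "(f has_derivative ?D) (at x)" using assms frechet_derivative_works by blast
  then interpret D: bounded_linear ?D by (rule has_derivative_bounded_linear)
  have "?D v = (\<Sum>i\<in>UNIV. v $ i * partial_deriv i f x)" for v
  proof -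
    have "?D v = ?D (\<Sum>i\<in>UNIV. v $ i *\<^sub>R axis i 1)"
      using basis_expansion[of v] by (simp add: scalar_mult_eq_scaleR)
    also have "\<dots> = (\<Sum>i\<in>UNIV. v $ i * partial_deriv i f x)"
      by (simp add: D.sum D.scaleR partial_deriv_def)
    finally show ?thesis .
  qed
  then have "?D = (\<lambda>v. \<Sum>i\<in>UNIV. v $ i * partial_deriv i f x)" by (rule ext)
  with D show ?thesis by simp
qed

text \<open>The chain rule turns a partial derivative of \<open>f\<close> composed with
  \<open>A\<close> into a combination of such compositions, and the coefficients are constant when
  the derivative of \<open>A\<close> is. So the span is closed under partial derivatives, while the
  set of single compositions need not be.\<close>

inductive lin_span_comp :: "(real^'n \<Rightarrow> real^'m) \<Rightarrow> (real^'n \<Rightarrow> real) \<Rightarrow> bool" for A where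
  base: "smoothn f \<Longrightarrow> lin_span_comp A (\<lambda>x. f (A x))"
| add: "lin_span_comp A f \<Longrightarrow> lin_span_comp A g \<Longrightarrow> lin_span_comp A (\<lambda>x. f x + g x)"
| scale: "lin_span_comp A f \<Longrightarrow> lin_span_comp A (\<lambda>x. c * f x)"

lemma partial_deriv_comp_affine:
  assumes f: "f differentiable (at (A x))" and A: "\<And>x. (A has_derivative L) (at x)"
  shows "((\<lambda>x. f (A x)) has_derivative (\<lambda>v. \<Sum>i\<in>UNIV. L v $ i * partial_deriv i f (A x))) (at x)"
  using has_derivative_compose[OF A has_derivative_partial_deriv[OF f]] .

lemma lin_span_comp_sum:
  assumes "finite I" "lin_span_comp A f" "\<And>i. i \<in> I \<Longrightarrow> lin_span_comp A (g i)"
  shows "lin_span_comp A (\<lambda>x. \<Sum>i\<in>I. c i * g i x)"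
  using assms(1,3)
proof (induction I rule: finite_induct)
  case empty
  then show ?case using lin_span_comp.scale[OF assms(2), of 0] by simp
next
  case (insert i I)
  have "lin_span_comp A (\<lambda>x. c i * g i x + (\<Sum>i\<in>I. c i * g i x))"
    using insert by (intro lin_span_comp.add lin_span_comp.scale) auto
  with insert(1,2) show ?case by simp
qed

lemma lin_span_comp_smoothn:
  assumes A: "\<And>x. (A has_derivative L) (at x)" and f: "lin_span_comp A f"
  shows "smoothn f"
proof (rule smoothn_coinduct_deriv[where X="lin_span_comp A", OF f])
  fix f assume "lin_span_comp A f"
  then have "(\<forall>x. f differentiable (at x)) \<and> (\<forall>i. lin_span_comp A (partial_deriv i f))"
  proof induction
    case (base f)
    note d = partial_deriv_comp_affine[OF smoothn_differentiable[OF base] A]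
    have "partial_deriv i (\<lambda>x. f (A x)) = (\<lambda>x. \<Sum>k\<in>UNIV. L (axis i 1) $ k * partial_deriv k f (A x))" for i
      by (rule ext) (simp add: partial_deriv_eqI[OF d])
    moreover have "lin_span_comp A (\<lambda>x. \<Sum>k\<in>UNIV. L (axis i 1) $ k * partial_deriv k f (A x))" for i
      by (rule lin_span_comp_sum[OF finite lin_span_comp.base[OF base]])
        (intro lin_span_comp.base smoothn_partial_deriv base)
    ultimately show ?case using d by (auto simp: differentiable_def)
  next
    case (add f g)
    have "partial_deriv i (\<lambda>x. f x + g x) = (\<lambda>x. partial_deriv i f x + partial_deriv i g x)" for i
    proof
      fix x
      have "((\<lambda>x. f x + g x) has_derivative
          (\<lambda>v. frechet_derivative f (at x) v + frechet_derivative g (at x) v)) (at x)"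
        using add.IH by (intro has_derivative_add) (simp_all add: frechet_derivative_works)
      from partial_deriv_eqI[OF this, of i]
      show "partial_deriv i (\<lambda>x. f x + g x) x = partial_deriv i f x + partial_deriv i g x"
        by (simp add: partial_deriv_def)
    qed
    then show ?case using add.IH by (auto intro: lin_span_comp.add)
  next
    case (scale f c)
    have "partial_deriv i (\<lambda>x. c * f x) = (\<lambda>x. c * partial_deriv i f x)" for i
    proof
      fix x
      have "((\<lambda>x. c * f x) has_derivative (\<lambda>v. c * frechet_derivative f (at x) v)) (at x)"
        using scale.IH by (intro has_derivative_mult_right) (simp add: frechet_derivative_works)
      from partial_deriv_eqI[OF this, of i]
      show "partial_deriv i (\<lambda>x. c * f x) x = c * partial_deriv i f x"
        by (simp add: partial_deriv_def)
    qed
    then show ?case using scale.IH by (auto intro: lin_span_comp.scale)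
  qed
  then show "(\<forall>x. f differentiable (at x)) \<and> (\<forall>i. lin_span_comp A (partial_deriv i f))" .
qed

lemma smoothn_comp_affine:
  assumes "smoothn f" "\<And>x. (A has_derivative L) (at x)" shows "smoothn (\<lambda>x. f (A x))"
  by (rule lin_span_comp_smoothn[of A L]) (use assms in \<open>auto intro: lin_span_comp.base\<close>)

lemma has_derivative_prod_nth:
  fixes f :: "'n::finite \<Rightarrow> real \<Rightarrow> real"
  assumes "\<And>i t. (f i has_real_derivative f' i t) (at t)"
  shows "((\<lambda>x. \<Prod>i\<in>UNIV. f i (x $ i)) has_derivative
     (\<lambda>v. \<Sum>i\<in>UNIV. (v $ i * f' i (x $ i)) * (\<Prod>j\<in>UNIV - {i}. f j (x $ j)))) (at x)"
proof (rule has_derivative_prod)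
  fix i :: 'n
  have 1: "((\<lambda>x. x $ i) has_derivative (\<lambda>v. v $ i)) (at x)"
    using bounded_linear_vec_nth bounded_linear_imp_has_derivative by blast
  have 2: "(f i has_derivative (\<lambda>h. h * f' i (x $ i))) (at (x $ i))"
    using assms[of i "x $ i"] by (simp add: has_field_derivative_def mult_commute_abs)
  show "((\<lambda>x. f i (x $ i)) has_derivative (\<lambda>v. v $ i * f' i (x $ i))) (at x)"
    using has_derivative_compose[OF 1 2] .
qed

text \<open>A partial derivative changes one factor only, so products of one-variable functions are
  closed under partial derivatives and their smoothness reduces to that of the factors.\<close>

lemma partial_deriv_prod_nth:
  fixes f :: "'n::finite \<Rightarrow> real \<Rightarrow> real"
  assumes "\<And>i t. (f i has_real_derivative f' i t) (at t)"
  shows "partial_deriv j (\<lambda>x. \<Prod>i\<in>UNIV. f i (x $ i)) x = (\<Prod>i\<in>UNIV. (if i = j then f' i else f i) (x $ i))"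
proof -
  have "partial_deriv j (\<lambda>x. \<Prod>i\<in>UNIV. f i (x $ i)) x =
     (\<Sum>i\<in>UNIV. (axis j 1 $ i * f' i (x $ i)) * (\<Prod>k\<in>UNIV - {i}. f k (x $ k)))"
    by (rule partial_deriv_eqI[OF has_derivative_prod_nth[OF assms]])
  also have "\<dots> = (\<Sum>i\<in>UNIV. if i = j then f' i (x $ i) * (\<Prod>k\<in>UNIV - {i}. f k (x $ k)) else 0)"
    by (intro sum.cong) (auto simp: axis_def)
  also have "\<dots> = f' j (x $ j) * (\<Prod>k\<in>UNIV - {j}. f k (x $ k))" by simp
  also have "\<dots> = (\<Prod>i\<in>UNIV. (if i = j then f' i else f i) (x $ i))"
    by (simp add: prod.remove[of UNIV j])
  finally show ?thesis .
qed

lemma smoothn_prod_nth: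
  fixes f :: "'n::finite \<Rightarrow> real \<Rightarrow> real"
  assumes "\<And>i. smooth1 (f i)"
  shows "smoothn (\<lambda>x. \<Prod>i\<in>UNIV. f i (x $ i))"
proof (rule smoothn_coinduct_deriv[where X="\<lambda>h. \<exists>f. (\<forall>i. smooth1 (f i)) \<and> h = (\<lambda>x::real^'n. \<Prod>i\<in>UNIV. f i (x $ i))"])
  show "\<exists>f'. (\<forall>i. smooth1 (f' i)) \<and> (\<lambda>x::real^'n. \<Prod>i\<in>UNIV. f i (x $ i)) = (\<lambda>x. \<Prod>i\<in>UNIV. f' i (x $ i))"
    by (rule exI[of _ f]) (simp add: assms)
next
  fix h :: "real^'n \<Rightarrow> real" assume "\<exists>f. (\<forall>i. smooth1 (f i)) \<and> h = (\<lambda>x::real^'n. \<Prod>i\<in>UNIV. f i (x $ i))"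
  then obtain f where f: "\<And>i. smooth1 (f i)" "h = (\<lambda>x::real^'n. \<Prod>i\<in>UNIV. f i (x $ i))" by blast
  have "\<exists>f'. (\<forall>t. (f i has_real_derivative f' t) (at t)) \<and> smooth1 f'" for i
    by (rule smooth1_derivE[OF f(1)[of i]]) auto
  then have "\<forall>i. \<exists>f'. (\<forall>t. (f i has_real_derivative f' t) (at t)) \<and> smooth1 f'" by blast
  from choice[OF this] obtain f'
    where f': "\<And>i t. (f i has_real_derivative f' i t) (at t)" "\<And>i. smooth1 (f' i)" by blast
  have "partial_deriv j h = (\<lambda>x. \<Prod>i\<in>UNIV. (if i = j then f' i else f i) (x $ i))" for j
    unfolding f(2) by (rule ext, rule partial_deriv_prod_nth[OF f'(1)])
  then have "\<exists>g. (\<forall>i. smooth1 (g i)) \<and> partial_deriv j h = (\<lambda>x. \<Prod>i\<in>UNIV. g i (x $ i))" for j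
    by (intro exI[of _ "\<lambda>i. if i = j then f' i else f i"]) (simp add: f(1) f'(2))
  moreover have "h differentiable (at x)" for x
    unfolding f(2) by (rule differentiableI[OF has_derivative_prod_nth[OF f'(1)]])
  ultimately show "(\<forall>x. h differentiable (at x)) \<and>
     (\<forall>i. \<exists>f. (\<forall>i. smooth1 (f i)) \<and> partial_deriv i h = (\<lambda>x. \<Prod>i\<in>UNIV. f i (x $ i)))" by blast
qed

lemma test_function_iff:
  "test_function \<phi> \<longleftrightarrow> smoothn \<phi> \<and> (\<exists>R. \<forall>x. \<phi> x \<noteq> 0 \<longrightarrow> norm x \<le> R)"
  by (auto simp: test_function_def smoothn_iff_foldr compact_closure bounded_iff)

lemma test_function_smoothn: "test_function \<phi> \<Longrightarrow> smoothn \<phi>"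
  by (simp add: test_function_iff)

lemma smoothn_continuous: "smoothn f \<Longrightarrow> continuous_on A f"
  by (simp add: continuous_at_imp_continuous_on differentiable_imp_continuous_within smoothn_differentiable)

lemma smoothn_measurable [measurable]: "smoothn f \<Longrightarrow> f \<in> borel_measurable borel"
  by (simp add: borel_measurable_continuous_onI smoothn_continuous)

lemma test_function_partial_deriv:
  assumes "test_function \<phi>" shows "test_function (partial_deriv i \<phi>)"
proof -
  obtain R where R: "\<And>x. \<phi> x \<noteq> 0 \<Longrightarrow> norm x \<le> R" and s: "smoothn \<phi>"
    using assms by (auto simp: test_function_iff)
  have "partial_deriv i \<phi> x = 0" if "norm x > R" for x
  proof -
    have "eventually (\<lambda>y. norm y > R) (nhds x)"
      by (rule eventually_nhds_in_open[of "{y. norm y > R}", simplified])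
         (use that in \<open>auto intro!: open_Collect_less continuous_intros\<close>)
    then have "eventually (\<lambda>y. 0 = \<phi> y) (nhds x)"
      by eventually_elim (use R in force)
    then obtain S where S: "open S" "x \<in> S" "\<And>y. y \<in> S \<Longrightarrow> 0 = \<phi> y"
      by (auto simp: eventually_nhds)
    have "(\<phi> has_derivative (\<lambda>_. 0)) (at x)"
      by (rule has_derivative_transform_within_open[OF has_derivative_const S])
    then show ?thesis by (rule partial_deriv_eqI)
  qed
  then show ?thesis
    unfolding test_function_iff using smoothn_partial_deriv[OF s] by (metis not_le)
qed

lemma test_function_bounded:
  assumes "test_function \<phi>"
  obtains B R where "B > 0" "R > 0" "\<And>x. \<bar>\<phi> x\<bar> \<le> B" "\<And>x. norm x > R \<Longrightarrow> \<phi> x = 0"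
proof -
  obtain R where R: "\<And>x. \<phi> x \<noteq> 0 \<Longrightarrow> norm x \<le> R" and s: "smoothn \<phi>"
    using assms by (auto simp: test_function_iff)
  have "compact (\<phi> ` cball 0 (max R 1))"
    by (intro compact_continuous_image smoothn_continuous s compact_cball)
  then have "bounded (\<phi> ` cball 0 (max R 1))" by (rule compact_imp_bounded)
  then obtain B where B: "B > 0" "\<And>x. x \<in> cball 0 (max R 1) \<Longrightarrow> \<bar>\<phi> x\<bar> \<le> B"
    unfolding bounded_pos by auto
  have "\<bar>\<phi> x\<bar> \<le> B" for x
    using B R[of x] by (cases "\<phi> x = 0") force+
  moreover have "\<phi> x = 0" if "norm x > max R 1" for x using R[of x] that by force
  ultimately show ?thesis using that[of B "max R 1"] B by auto
qed

lemma test_function_prod_nth: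
  fixes f :: "'n::finite \<Rightarrow> real \<Rightarrow> real"
  assumes "\<And>i. smooth1 (f i)" "\<And>i t. f i t \<noteq> 0 \<Longrightarrow> \<bar>t\<bar> \<le> R"
  shows "test_function (\<lambda>x. \<Prod>i\<in>UNIV. f i (x $ i))"
proof -
  have "norm x \<le> real CARD('n) * R" if "(\<Prod>i\<in>UNIV. f i (x $ i)) \<noteq> 0" for x
  proof -
    have "\<bar>x $ i\<bar> \<le> R" for i using that assms(2) by auto
    then have "(\<Sum>i\<in>UNIV. \<bar>x $ i\<bar>) \<le> (\<Sum>i\<in>(UNIV::'n set). R)" by (intro sum_mono) auto
    with norm_le_l1_cart[of x] show ?thesis by simp
  qed
  with smoothn_prod_nth[of f] assms(1) show ?thesis unfolding test_function_iff by blast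
qed

lemma integrable_mult_test_function:
  assumes u: "locally_integrable u" and \<phi>: "test_function \<phi>"
  shows "integrable lborel (\<lambda>x. u x * \<phi> x)"
proof -
  obtain B R where B: "B > 0" "\<And>x. \<bar>\<phi> x\<bar> \<le> B" "\<And>x. norm x > R \<Longrightarrow> \<phi> x = 0"
    using test_function_bounded[OF \<phi>] by metis
  have [measurable]: "u \<in> borel_measurable borel" "\<phi> \<in> borel_measurable borel"
    using u \<phi> by (auto simp: locally_integrable_def test_function_smoothn)
  have "set_integrable lborel (cball 0 R) u"
    using u compact_cball unfolding locally_integrable_def by blast
  then have "integrable lborel (\<lambda>x. B * (indicator (cball 0 R) x *\<^sub>R u x))"
    unfolding set_integrable_def by (rule integrable_mult_right)
  then show ?thesis
  proof (rule Bochner_Integration.integrable_bound)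
    have "\<bar>u x * \<phi> x\<bar> \<le> \<bar>B * (indicator (cball 0 R) x *\<^sub>R u x)\<bar>" for x
      using B(1) B(2)[of x] B(3)[of x] mult_left_mono[of "\<bar>\<phi> x\<bar>" B "\<bar>u x\<bar>"]
      by (cases "norm x \<le> R") (auto simp: abs_mult mult.commute)
    then show "AE x in lborel. norm (u x * \<phi> x) \<le> norm (B * (indicator (cball 0 R) x *\<^sub>R u x))" by simp
  qed measurable
qed

lemma locally_integrable_continuous:
  assumes "continuous_on UNIV u" shows "locally_integrable u"
proof -
  have "set_integrable lborel K u" if "compact K" for K
    unfolding set_integrable_def
    by (rule borel_integrable_compact[OF that continuous_on_subset[OF assms subset_UNIV]])
  with assms show ?thesis by (simp add: locally_integrable_def borel_measurable_continuous_onI)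
qed

lemma test_function_integrable: "test_function \<phi> \<Longrightarrow> integrable lborel \<phi>"
  using integrable_mult_test_function[of "\<lambda>_. 1" \<phi>] locally_integrable_continuous[of "\<lambda>_. 1"]
  by (simp add: continuous_on_const)

lemma integral_translate:
  fixes f :: "'a::euclidean_space \<Rightarrow> real"
  assumes [measurable]: "f \<in> borel_measurable borel"
  shows "(LINT x|lborel. f (a + x)) = (LINT x|lborel. f x)"
proof -
  have "(LINT x|lborel. f x) = (LINT x|distr lborel borel ((+) a). f x)"
    by (simp add: lborel_distr_plus)
  also have "\<dots> = (LINT x|lborel. f (a + x))" by (subst integral_distr) auto
  finally show ?thesis by simp
qed

text \<open>Translation invariance makes the integral of every difference quotient of
  \<open>\<phi>\<close> zero; the limit is taken by dominated convergence, with a bound from the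
  mean value theorem. This is the fact that constants have weak gradient 0.\<close>

lemma integral_partial_deriv_test_function:
  assumes \<phi>: "test_function \<phi>" shows "(LINT x|lborel. partial_deriv i \<phi> x) = 0"
proof -
  obtain B R where B: "B > 0" "\<And>x. \<bar>partial_deriv i \<phi> x\<bar> \<le> B"
    using test_function_bounded[OF test_function_partial_deriv[OF \<phi>]] by metis
  obtain R where R: "R > 0" "\<And>x. norm x > R \<Longrightarrow> \<phi> x = 0"
    using test_function_bounded[OF \<phi>] by metis
  let ?e = "axis i (1::real)"
  have d: "((\<lambda>t. \<phi> (x + t *\<^sub>R ?e)) has_real_derivative partial_deriv i \<phi> (x + t *\<^sub>R ?e)) (at t)" for x t
  proof -
    have 1: "(\<phi> has_derivative (\<lambda>v. \<Sum>k\<in>UNIV. v $ k * partial_deriv k \<phi> (x + t *\<^sub>R ?e))) (at (x + t *\<^sub>R ?e))"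
      using has_derivative_partial_deriv smoothn_differentiable test_function_smoothn[OF \<phi>] by blast
    have 2: "((\<lambda>t. x + t *\<^sub>R ?e) has_derivative (\<lambda>t. t *\<^sub>R ?e)) (at t)"
      by (auto intro!: derivative_eq_intros)
    have "(\<Sum>k\<in>UNIV. (h *\<^sub>R ?e) $ k * partial_deriv k \<phi> y) = h * partial_deriv i \<phi> y" for h y
    proof -
      have "(\<Sum>k\<in>UNIV. (h *\<^sub>R ?e) $ k * partial_deriv k \<phi> y) = (\<Sum>k\<in>UNIV. if k = i then h * partial_deriv k \<phi> y else 0)"
        by (intro sum.cong) (auto simp: axis_def)
      then show ?thesis by simp
    qed
    with has_derivative_compose[OF 2 1] show ?thesis
      by (simp only: has_field_derivative_def mult_commute_abs)
  qed
  define h where "h m = inverse (real (Suc m))" for m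
  have h: "h m > 0" "h m \<le> 1" "h \<longlonglongrightarrow> 0" for m
    using LIMSEQ_inverse_real_of_nat unfolding h_def[abs_def] by (auto simp: inverse_le_1_iff)
  define D where "D m x = (\<phi> (x + h m *\<^sub>R ?e) - \<phi> x) / h m" for m x
  have [measurable]: "\<phi> \<in> borel_measurable borel" "partial_deriv i \<phi> \<in> borel_measurable borel"
    using \<phi> by (auto simp: test_function_smoothn smoothn_partial_deriv)
  have int: "integrable lborel (\<lambda>x. \<phi> (a + x))" for a
  proof -
    have "integrable (distr lborel borel ((+) a)) \<phi>"
      using test_function_integrable[OF \<phi>] by (simp add: lborel_distr_plus)
    then show ?thesis by (subst (asm) integrable_distr_eq) auto
  qed
  have D0: "(LINT x|lborel. D m x) = 0" for m
  proof -
    have "(LINT x|lborel. \<phi> (h m *\<^sub>R ?e + x)) = (LINT x|lborel. \<phi> x)"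
      by (rule integral_translate) measurable
    moreover have "integrable lborel (\<lambda>x. \<phi> (h m *\<^sub>R ?e + x))" by (rule int)
    ultimately show ?thesis
      using test_function_integrable[OF \<phi>] by (simp add: D_def add.commute)
  qed
  have bound: "\<bar>D m x\<bar> \<le> B * indicator (cball 0 (R + 1)) x" for m x
  proof (cases "norm x \<le> R + 1")
    case True
    obtain t where "\<phi> (x + h m *\<^sub>R ?e) - \<phi> (x + 0 *\<^sub>R ?e) = (h m - 0) * partial_deriv i \<phi> (x + t *\<^sub>R ?e)"
      using MVT2[of 0 "h m", where f="\<lambda>t. \<phi> (x + t *\<^sub>R ?e)" and f'="\<lambda>t. partial_deriv i \<phi> (x + t *\<^sub>R ?e)"] d h(1)[of m]
      by blast
    then have "D m x = partial_deriv i \<phi> (x + t *\<^sub>R ?e)" using h(1)[of m] by (simp add: D_def)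
    with B True show ?thesis by simp
  next
    case False
    \<comment> \<open>Steps have length at most 1, so outside the ball of radius
      \<open>R + 1\<close> both points of the quotient lie outside the support.\<close>
    have "norm x \<le> norm (x + h m *\<^sub>R ?e) + norm (h m *\<^sub>R ?e)"
      by (metis add_diff_cancel norm_triangle_ineq4)
    then have "norm (x + h m *\<^sub>R ?e) > R" using False h(1)[of m] h(2)[of m] by (simp)
    then show ?thesis using False R by (simp add: D_def)
  qed
  have "(\<lambda>m. LINT x|lborel. D m x) \<longlonglongrightarrow> (LINT x|lborel. partial_deriv i \<phi> x)"
  proof (rule integral_dominated_convergence)
    show "integrable lborel (\<lambda>x. B * indicator (cball 0 (R + 1)) x :: real)"
      by (intro integrable_mult_right integrable_real_indicator emeasure_lborel_cball_finite) simp
    show "AE x in lborel. (\<lambda>m. D m x) \<longlonglongrightarrow> partial_deriv i \<phi> x"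
    proof (rule AE_I2)
      fix x
      have "((\<lambda>t. (\<phi> (x + (0 + t) *\<^sub>R ?e) - \<phi> (x + 0 *\<^sub>R ?e)) / t) \<longlongrightarrow> partial_deriv i \<phi> (x + 0 *\<^sub>R ?e)) (at 0)"
        using d[of x 0] unfolding DERIV_def by simp
      moreover have "filterlim h (at 0) sequentially"
        using h by (auto simp: filterlim_at intro!: always_eventually less_imp_neq[symmetric])
      ultimately show "(\<lambda>m. D m x) \<longlonglongrightarrow> partial_deriv i \<phi> x"
        using filterlim_compose by (fastforce simp: D_def)
    qed
    show "AE x in lborel. norm (D m x) \<le> B * indicator (cball 0 (R + 1)) x" for m
      using bound by simp
  qed (auto simp: D_def)
  then show ?thesis unfolding D0 by (simp add: LIMSEQ_const_iff)
qed

text \<open>The positive and negative parts of \<open>g\<close> are densities of two measures that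
  agree on boxes, an intersection-stable generator. So the measures agree, and by uniqueness of
  densities the two parts coincide almost everywhere, which forces \<open>g = 0\<close>
  there.\<close>

lemma AE_zero_if_box_integrals_zero:
  fixes g :: "real^'n \<Rightarrow> real"
  assumes g: "locally_integrable g"
    and zero: "\<And>a b. (LINT x|lborel. indicator (box a b) x * g x) = 0"
  shows "AE x in lborel. g x = 0"
proof -
  have [measurable]: "g \<in> borel_measurable borel" using g by (simp add: locally_integrable_def)
  have int: "integrable lborel (\<lambda>x. indicator (box a b) x * g x)" for a b
  proof -
    have "set_integrable lborel (cbox a b) g"
      using g compact_cbox unfolding locally_integrable_def by blast
    then have "set_integrable lborel (box a b) g"
      by (rule set_integrable_subset) (auto simp: box_subset_cbox)
    then show ?thesis by (simp add: set_integrable_def)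
  qed
  define P where "P = density lborel (\<lambda>x. ennreal (g x))"
  define N where "N = density lborel (\<lambda>x. ennreal (- g x))"
  have PN: "emeasure P (box a b) = emeasure N (box a b)" "emeasure P (box a b) \<noteq> \<infinity>" for a b
  proof -
    let ?f = "\<lambda>x. indicator (box a b) x * g x"
    have 1: "emeasure P (box a b) = (\<integral>\<^sup>+x. ennreal (?f x) \<partial>lborel)"
      by (auto simp: P_def emeasure_density indicator_def intro!: nn_integral_cong)
    have 2: "emeasure N (box a b) = (\<integral>\<^sup>+x. ennreal (- ?f x) \<partial>lborel)"
      by (auto simp: N_def emeasure_density indicator_def intro!: nn_integral_cong)
    have fin: "(\<integral>\<^sup>+x. ennreal (?f x) \<partial>lborel) \<noteq> \<infinity>" "(\<integral>\<^sup>+x. ennreal (- ?f x) \<partial>lborel) \<noteq> \<infinity>"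
      using int[of a b] by (auto simp: real_integrable_def)
    have eq: "enn2real (\<integral>\<^sup>+x. ennreal (?f x) \<partial>lborel) = enn2real (\<integral>\<^sup>+x. ennreal (- ?f x) \<partial>lborel)"
      using real_lebesgue_integral_def[OF int[of a b]] zero[of a b] by simp
    have "A = B" if "enn2real A = enn2real B" "A \<noteq> \<infinity>" "B \<noteq> \<infinity>" for A B
      using that by (cases A; cases B) auto
    from this[OF eq fin] show "emeasure P (box a b) = emeasure N (box a b)" "emeasure P (box a b) \<noteq> \<infinity>"
      unfolding 1 2 using fin by auto
  qed
  have "P = N"
  proof (rule measure_eqI_generator_eq)
    let ?E = "range (\<lambda>(a, b). box a b::(real^'n) set)"
    show "Int_stable ?E"
      by (auto simp: Int_stable_def box_Int_box)
    show "?E \<subseteq> Pow UNIV" "sets P = sigma_sets UNIV ?E" "sets N = sigma_sets UNIV ?E"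
      by (simp_all add: borel_eq_box P_def N_def)
    let ?A = "\<lambda>n::nat. box (- (real n *\<^sub>R One)) (real n *\<^sub>R One) :: (real^'n) set"
    show "range ?A \<subseteq> ?E" "(\<Union>i. ?A i) = UNIV"
      unfolding UN_box_eq_UNIV by auto
    show "emeasure P (?A i) \<noteq> \<infinity>" for i by (rule PN)
    show "emeasure P X = emeasure N X" if "X \<in> ?E" for X
      using that PN(1) by auto
  qed
  then have "AE x in lborel. ennreal (g x) = ennreal (- g x)"
    unfolding P_def N_def by (intro sigma_finite_measure.density_unique[OF lborel.sigma_finite_measure_axioms]) auto
  then show ?thesis
  proof eventually_elim
    case (elim x)
    then show ?case by (cases "g x" "0::real" rule: linorder_cases) (auto simp: ennreal_neg)
  qed
qed

text \<open>Products of ever steeper bumps converge to the indicator of an open box and stay below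
  that of the closed one, so dominated convergence reduces the claim to integrals over
  boxes.\<close>

lemma AE_zero_if_test_integrals_zero:
  fixes g :: "real^'n \<Rightarrow> real"
  assumes g: "locally_integrable g"
    and zero: "\<And>\<phi>. test_function \<phi> \<Longrightarrow> (LINT x|lborel. g x * \<phi> x) = 0"
  shows "AE x in lborel. g x = 0"
proof (rule AE_zero_if_box_integrals_zero[OF g])
  fix a b :: "real^'n"
  define \<phi> where "\<phi> m x = (\<Prod>i\<in>UNIV. bump (real (Suc m)) (a $ i) (b $ i) (x $ i))" for m and x :: "real^'n"
  have [measurable]: "g \<in> borel_measurable borel" using g by (simp add: locally_integrable_def)
  have "test_function (\<phi> m)" for m
    unfolding \<phi>_def
  proof (rule test_function_prod_nth)
    fix i t assume nz: "bump (real (Suc m)) (a $ i) (b $ i) t \<noteq> 0"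
    have "a $ i < t \<and> t < b $ i"
      using nz bump_outside[of "real (Suc m)" t "a $ i" "b $ i"] by (auto simp: not_le[symmetric] simp del: of_nat_Suc)
    then have "\<bar>t\<bar> \<le> \<bar>a $ i\<bar> + \<bar>b $ i\<bar>" by linarith
    also have "\<dots> \<le> norm a + norm b" using component_le_norm_cart by (intro add_mono) auto
    finally show "\<bar>t\<bar> \<le> norm a + norm b" .
  qed (rule smooth1_bump)
  then have tf: "(LINT x|lborel. g x * \<phi> m x) = 0" and [measurable]: "\<phi> m \<in> borel_measurable borel" for m
    by (auto simp: zero test_function_smoothn)
  have lim: "(\<lambda>m. \<phi> m x) \<longlonglongrightarrow> indicator (box a b) x" for x
  proof -
    have "(\<lambda>m. \<phi> m x) \<longlonglongrightarrow> (\<Prod>i\<in>UNIV. if a $ i < x $ i \<and> x $ i < b $ i then 1 else 0)"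
      unfolding \<phi>_def by (intro tendsto_prod bump_tendsto)
    also have "(\<Prod>i\<in>UNIV. if a $ i < x $ i \<and> x $ i < b $ i then 1 else 0) = (indicator (box a b) x :: real)"
      by (auto simp: indicator_def mem_box_cart)
    finally show ?thesis .
  qed
  have b01: "0 \<le> \<phi> m x" "\<phi> m x \<le> 1" for m x
    unfolding \<phi>_def by (auto intro!: prod_nonneg prod_le_1 simp: bump_bounds)
  have out: "\<phi> m x = 0" if x: "x \<notin> cbox a b" for m x
  proof -
    obtain i where "\<not> (a $ i \<le> x $ i \<and> x $ i \<le> b $ i)" using x by (auto simp: mem_box_cart)
    then have "bump (real (Suc m)) (a $ i) (b $ i) (x $ i) = 0" by (intro bump_outside) auto
    then show ?thesis unfolding \<phi>_def by (intro prod_zero) auto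
  qed
  have "(\<lambda>m. LINT x|lborel. g x * \<phi> m x) \<longlonglongrightarrow> (LINT x|lborel. g x * indicator (box a b) x)"
  proof (rule integral_dominated_convergence)
    have "set_integrable lborel (cbox a b) g"
      using g compact_cbox unfolding locally_integrable_def by blast
    then have "set_integrable lborel (cbox a b) (\<lambda>x. \<bar>g x\<bar>)" by (rule set_integrable_abs)
    then show "integrable lborel (\<lambda>x. indicator (cbox a b) x * \<bar>g x\<bar>)"
      by (simp add: set_integrable_def)
    show "AE x in lborel. (\<lambda>m. g x * \<phi> m x) \<longlonglongrightarrow> g x * indicator (box a b) x"
      using lim by (intro AE_I2 tendsto_mult tendsto_const)
    have "\<bar>g x * \<phi> m x\<bar> \<le> indicator (cbox a b) x * \<bar>g x\<bar>" for m x
      using b01[of m x] out[of x m] mult_left_le[of "\<phi> m x" "\<bar>g x\<bar>"]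
      by (cases "x \<in> cbox a b") (auto simp: abs_mult)
    then show "AE x in lborel. norm (g x * \<phi> m x) \<le> indicator (cbox a b) x * \<bar>g x\<bar>" for m by simp
  qed auto
  then show "(LINT x|lborel. indicator (box a b) x * g x) = 0"
    unfolding tf by (simp add: LIMSEQ_const_iff mult.commute)
qed

section \<open>Clarkson's inequalities\<close>

lemma powr_superadditive:
  fixes u v t :: real
  assumes "u \<ge> 0" "v \<ge> 0" "t \<ge> 1"
  shows "u powr t + v powr t \<le> (u + v) powr t"
proof (cases "u + v = 0")
  case True
  with assms have "u = 0" "v = 0" by auto
  then show ?thesis by simp
next
  case False
  have split: "a powr t = a * a powr (t - 1)" if "a \<ge> 0" for a :: real
    using that powr_add[of a 1 "t - 1"] by (cases "a = 0") auto
  have "u * u powr (t - 1) \<le> u * (u + v) powr (t - 1)"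
    using assms by (intro mult_left_mono powr_mono2) auto
  moreover have "v * v powr (t - 1) \<le> v * (u + v) powr (t - 1)"
    using assms by (intro mult_left_mono powr_mono2) auto
  ultimately show ?thesis
    using split[of u] split[of v] split[of "u + v"] assms by (simp add: distrib_right)
qed

lemma powr_midpoint_le:
  fixes u v t :: real
  assumes "u \<ge> 0" "v \<ge> 0" "t \<ge> 1"
  shows "((u + v) / 2) powr t \<le> (u powr t + v powr t) / 2"
\<comment> \<open>Convexity is applied on the open half line; with a zero argument the claim comes
  down to \<open>(1/2) powr t \<le> 1/2\<close>.\<close>
proof (cases "u = 0 \<or> v = 0")
  case True
  have "(w / 2) powr t \<le> w powr t / 2" if "w \<ge> 0" for w :: real
  proof -
    have "(1/2::real) powr t \<le> (1/2) powr 1" using assms by (intro powr_mono') auto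
    then have "w powr t * (1/2) powr t \<le> w powr t * (1/2)" by (intro mult_left_mono) auto
    then show ?thesis using that powr_mult[of w "1/2" t] by simp
  qed
  with True assms show ?thesis by auto
next
  case False
  then have "u \<in> {0<..}" "v \<in> {0<..}" using assms by auto
  from convex_onD[OF powr_convex[OF assms(3)], of "1/2", OF _ _ this]
  show ?thesis by (simp add: field_simps)
qed

text \<open>The parallelogram law is exact for squares. Superadditivity of
  \<open>t powr (p / 2)\<close> on one side and its convexity on the other turn squares into p-th
  powers.\<close>

lemma clarkson_pointwise_ge2:
  fixes a b :: "'a::real_inner"
  assumes "p \<ge> 2"
  shows "norm ((1/2) *\<^sub>R (a - b)) powr p + norm ((1/2) *\<^sub>R (a + b)) powr p
    \<le> (norm a powr p + norm b powr p) / 2"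
proof -
  have sq: "x powr p = (x\<^sup>2) powr (p / 2)" if "x \<ge> 0" for x :: real
    using that by (simp add: powr_powr flip: powr_numeral)
  let ?x = "norm ((1/2) *\<^sub>R (a - b))" and ?y = "norm ((1/2) *\<^sub>R (a + b))"
  have par: "?x\<^sup>2 + ?y\<^sup>2 = ((norm a)\<^sup>2 + (norm b)\<^sup>2) / 2"
    by (simp add: power2_norm_eq_inner inner_diff inner_add inner_commute field_simps)
  have "?x powr p + ?y powr p \<le> (?x\<^sup>2 + ?y\<^sup>2) powr (p / 2)"
    using powr_superadditive[of "?x\<^sup>2" "?y\<^sup>2" "p/2"] assms by (simp only: sq norm_ge_zero) simp
  also have "\<dots> = (((norm a)\<^sup>2 + (norm b)\<^sup>2) / 2) powr (p / 2)" by (simp only: par)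
  also have "\<dots> \<le> (((norm a)\<^sup>2) powr (p/2) + ((norm b)\<^sup>2) powr (p/2)) / 2"
    using assms by (intro powr_midpoint_le) auto
  finally show ?thesis by (simp only: sq[symmetric] norm_ge_zero)
qed

text \<open>
  The function \<open>g\<close> interpolates: it takes the value of the left-hand side at \<open>1\<close> and that of the
  right-hand side at \<open>x powr (p - 1)\<close>, and it is decreasing on \<open>{0<..1}\<close>.
\<close>

lemma clarkson_aux_unit:
  fixes p q x :: real
  assumes p: "1 < p" "p \<le> 2" and q: "q = p / (p - 1)" and x: "0 \<le> x" "x \<le> 1"
  shows "(1 - x) powr q + (1 + x) powr q \<le> 2 * (1 + x powr p) powr (q - 1)"
proof -
  have q2: "q \<ge> 2" and pq: "(p - 1) * (q - 1) = 1"
    using p by (simp_all add: q field_simps)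
  consider "x = 0" | "x = 1" | "0 < x" "x < 1" using x by linarith
  then show ?thesis
  proof cases
    case 2
    have "2 powr q = 2 * 2 powr (q - 1)"
      using powr_add[of 2 1 "q - 1"] by simp
    with 2 q2 show ?thesis by simp
  next
    case 3
    define g where "g \<alpha> = (1 + \<alpha> powr (1 - q) * x) * (1 + \<alpha> * x) powr (q - 1)
        + (1 - \<alpha> powr (1 - q) * x) * (1 - \<alpha> * x) powr (q - 1)" for \<alpha>
    define g' where "g' \<alpha> = (q - 1) * x * (1 - \<alpha> powr (- q)) * ((1 + \<alpha> * x) powr (q - 2) - (1 - \<alpha> * x) powr (q - 2))" for \<alpha>
    have gd: "(g has_real_derivative g' \<alpha>) (at \<alpha>)" if \<alpha>: "0 < \<alpha>" "\<alpha> \<le> 1" for \<alpha>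
    proof -
      have "\<alpha> * x \<le> 1 * x" using \<alpha> 3 by (intro mult_right_mono) auto
      moreover have "\<alpha> * x > 0" using \<alpha> 3 by simp
      ultimately have pos: "1 - \<alpha> * x > 0" "1 + \<alpha> * x > 0" using 3 by linarith+
      have 1: "((\<lambda>\<alpha>. \<alpha> powr (1 - q)) has_real_derivative (1 - q) * \<alpha> powr (- q)) (at \<alpha>)"
        using \<alpha> by (auto intro!: derivative_eq_intros)
      have 2: "((\<lambda>\<alpha>. (1 + \<alpha> * x) powr (q - 1)) has_real_derivative (q - 1) * (1 + \<alpha> * x) powr (q - 2) * x) (at \<alpha>)"
        using pos by (auto intro!: derivative_eq_intros)
      have 3: "((\<lambda>\<alpha>. (1 - \<alpha> * x) powr (q - 1)) has_real_derivative - ((q - 1) * (1 - \<alpha> * x) powr (q - 2) * x)) (at \<alpha>)"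
        using pos by (auto intro!: derivative_eq_intros)
      \<comment> \<open>With one factor split off, only the powers that occur in \<open>g'\<close>
        remain, and the derivative is a polynomial identity in them.\<close>
      have s1: "(1 + \<alpha> * x) powr (q - 1) = (1 + \<alpha> * x) * (1 + \<alpha> * x) powr (q - 2)"
        using powr_add[of "1 + \<alpha> * x" 1 "q - 2"] pos by simp
      have s2: "(1 - \<alpha> * x) powr (q - 1) = (1 - \<alpha> * x) * (1 - \<alpha> * x) powr (q - 2)"
        using powr_add[of "1 - \<alpha> * x" 1 "q - 2"] pos by simp
      have s3: "\<alpha> powr (1 - q) = \<alpha> * \<alpha> powr (- q)"
        using powr_add[of \<alpha> 1 "- q"] \<alpha> by simp
      show ?thesis
        unfolding g_def g'_def
        by (rule DERIV_cong[OF DERIV_add[OF DERIV_mult'[OF DERIV_add[OF DERIV_const DERIV_cmult_right[OF 1]] 2]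
             DERIV_mult'[OF DERIV_diff[OF DERIV_const DERIV_cmult_right[OF 1]] 3]]])
          (simp only: s1 s2 s3, algebra)
    qed
    have g'neg: "g' \<alpha> \<le> 0" if \<alpha>: "0 < \<alpha>" "\<alpha> \<le> 1" for \<alpha>
    proof -
      have "\<alpha> powr (- q) \<ge> \<alpha> powr 0" using \<alpha> q2 by (intro powr_mono') auto
      then have "1 - \<alpha> powr (- q) \<le> 0" using \<alpha> by simp
      moreover have "(1 + \<alpha> * x) powr (q - 2) - (1 - \<alpha> * x) powr (q - 2) \<ge> 0"
        using \<alpha> 3 q2 mult_le_one[of \<alpha> x] by (auto intro!: powr_mono2)
      moreover have "(q - 1) * x \<ge> 0" using 3 q2 by simp
      ultimately show ?thesis unfolding g'_def
        by (intro mult_nonpos_nonneg mult_nonneg_nonpos) auto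
    qed
    define y where "y = x powr (p - 1)"
    have y: "0 < y" "y \<le> 1" using 3 p powr_mono2[of "p - 1" x 1] by (auto simp: y_def)
    have "g 1 \<le> g y"
      using y by (intro DERIV_nonpos_imp_nonincreasing[of y 1 g]) (auto intro!: exI[of _ "g' _"] gd g'neg)
    moreover have "g 1 = (1 - x) powr q + (1 + x) powr q"
      using powr_add[of "1 + x" 1 "q - 1"] powr_add[of "1 - x" 1 "q - 1"] 3 by (simp add: g_def)
    moreover have "g y = 2 * (1 + x powr p) powr (q - 1)"
    proof -
      \<comment> \<open>As \<open>(p - 1) * (q - 1) = 1\<close>, this \<open>y\<close> satisfies
        \<open>y powr (1 - q) * x = 1\<close>: the second summand of \<open>g\<close> drops
        out.\<close>
      have "(p - 1) * (1 - q) = - 1" using pq by (simp add: algebra_simps)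
      then have "y powr (1 - q) = x powr (- 1)"
        unfolding y_def powr_powr by simp
      then have "y powr (1 - q) * x = 1" using 3 by (simp add: powr_minus)
      moreover have "y * x = x powr p" using powr_add[of x "p - 1" 1] 3 by (simp add: y_def)
      ultimately show ?thesis by (simp add: g_def)
    qed
    ultimately show ?thesis by simp
  qed simp
qed

text \<open>Both sides are homogeneous of degree \<open>q\<close>, because
  \<open>p * (q - 1) = q\<close>, so only the ratio of the absolute values counts. Changing the sign
  of \<open>a\<close> or \<open>b\<close> merely swaps the two terms on the left.\<close>

lemma clarkson_pointwise_le2:
  fixes p q a b :: real
  assumes p: "1 < p" "p \<le> 2" and q: "q = p / (p - 1)"
  shows "\<bar>(a - b) / 2\<bar> powr q + \<bar>(a + b) / 2\<bar> powr q \<le> ((\<bar>a\<bar> powr p + \<bar>b\<bar> powr p) / 2) powr (q - 1)"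
proof -
  have q2: "q \<ge> 2" and pq: "p * (q - 1) = q"
    using p by (simp_all add: q field_simps)
  have main: "((X - Y) / 2) powr q + ((X + Y) / 2) powr q \<le> ((X powr p + Y powr p) / 2) powr (q - 1)"
    if "0 \<le> Y" "Y \<le> X" for X Y :: real
  proof (cases "X = 0")
    case False
    define x where "x = Y / X"
    have x: "0 \<le> x" "x \<le> 1" "Y = x * X" "X > 0" using that False by (auto simp: x_def)
    have "((X - Y) / 2) powr q = ((1 - x) * (X / 2)) powr q" by (simp add: x(3) algebra_simps)
    also have "\<dots> = (1 - x) powr q * (X / 2) powr q" by (simp only: powr_mult)
    finally have 1: "((X - Y) / 2) powr q = (1 - x) powr q * (X / 2) powr q" .
    have "((X + Y) / 2) powr q = ((1 + x) * (X / 2)) powr q" by (simp add: x(3) algebra_simps)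
    also have "\<dots> = (1 + x) powr q * (X / 2) powr q" by (simp only: powr_mult)
    finally have 2: "((X + Y) / 2) powr q = (1 + x) powr q * (X / 2) powr q" .
    have "(X powr p + Y powr p) / 2 = (1 + x powr p) * (X powr p / 2)"
      using x by (simp add: powr_mult field_simps)
    then have "((X powr p + Y powr p) / 2) powr (q - 1) = (1 + x powr p) powr (q - 1) * (X powr p / 2) powr (q - 1)"
      by (simp only: powr_mult)
    also have "(X powr p / 2) powr (q - 1) = 2 * (X / 2) powr q"
    proof -
      have "2 powr q = 2 * 2 powr (q - 1)" using powr_add[of 2 1 "q - 1"] by simp
      then show ?thesis using x by (simp add: powr_divide powr_powr pq)
    qed
    finally have 3: "((X powr p + Y powr p) / 2) powr (q - 1)
        = 2 * (1 + x powr p) powr (q - 1) * (X / 2) powr q" by simp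
    have "((1 - x) powr q + (1 + x) powr q) * (X / 2) powr q
        \<le> (2 * (1 + x powr p) powr (q - 1)) * (X / 2) powr q"
      by (intro mult_right_mono clarkson_aux_unit[OF p q x(1,2)]) auto
    then show ?thesis unfolding 1 2 3 by (simp add: distrib_right)
  qed (use that in auto)
  consider "\<bar>b\<bar> \<le> \<bar>a\<bar>" "a * b \<ge> 0" | "\<bar>b\<bar> \<le> \<bar>a\<bar>" "a * b < 0" | "\<bar>a\<bar> \<le> \<bar>b\<bar>" "a * b \<ge> 0" | "\<bar>a\<bar> \<le> \<bar>b\<bar>" "a * b < 0"
    by linarith
  then show ?thesis
  proof cases
    case 1
    then have "\<bar>(a - b) / 2\<bar> = (\<bar>a\<bar> - \<bar>b\<bar>) / 2" "\<bar>(a + b) / 2\<bar> = (\<bar>a\<bar> + \<bar>b\<bar>) / 2"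
      by (auto simp: zero_le_mult_iff)
    then show ?thesis using main[of "\<bar>b\<bar>" "\<bar>a\<bar>"] 1 by simp
  next
    case 2
    then have "\<bar>(a - b) / 2\<bar> = (\<bar>a\<bar> + \<bar>b\<bar>) / 2" "\<bar>(a + b) / 2\<bar> = (\<bar>a\<bar> - \<bar>b\<bar>) / 2"
      by (auto simp: mult_less_0_iff)
    then show ?thesis using main[of "\<bar>b\<bar>" "\<bar>a\<bar>"] 2 by simp
  next
    case 3
    then have "\<bar>(a - b) / 2\<bar> = (\<bar>b\<bar> - \<bar>a\<bar>) / 2" "\<bar>(a + b) / 2\<bar> = (\<bar>b\<bar> + \<bar>a\<bar>) / 2"
      by (auto simp: zero_le_mult_iff)
    then show ?thesis using main[of "\<bar>a\<bar>" "\<bar>b\<bar>"] 3 by (simp add: add.commute)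
  next
    case 4
    then have "\<bar>(a - b) / 2\<bar> = (\<bar>b\<bar> + \<bar>a\<bar>) / 2" "\<bar>(a + b) / 2\<bar> = (\<bar>b\<bar> - \<bar>a\<bar>) / 2"
      by (auto simp: mult_less_0_iff)
    then show ?thesis using main[of "\<bar>a\<bar>" "\<bar>b\<bar>"] 4 by (simp add: add.commute)
  qed
qed

section \<open>Vector fields in \<open>L\<^sup>p\<close>\<close>

definition Lp_field :: "real \<Rightarrow> (real^'n \<Rightarrow> real^'n) \<Rightarrow> bool" where
  "Lp_field p F \<longleftrightarrow> F \<in> borel_measurable borel \<and> integrable lborel (\<lambda>x. norm (F x) powr p)"

lemma Lp_field_measurable: "Lp_field p F \<Longrightarrow> F \<in> borel_measurable borel"
  by (simp add: Lp_field_def)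

lemma Lp_norm_powr:
  assumes "p > 0" shows "Lp_norm p F powr p = (LINT x|lborel. norm (F x) powr p)"
  using assms by (simp add: Lp_norm_def powr_powr integral_nonneg_AE)

lemma Lp_norm_nonneg: "Lp_norm p F \<ge> 0"
  by (simp add: Lp_norm_def)

lemma Lp_norm_cong_AE:
  assumes "F \<in> borel_measurable borel" "G \<in> borel_measurable borel" "AE x in lborel. F x = G x"
  shows "Lp_norm p F = Lp_norm p G"
proof -
  have "(LINT x|lborel. norm (F x) powr p) = (LINT x|lborel. norm (G x) powr p)"
  proof (rule integral_cong_AE)
    show "AE x in lborel. norm (F x) powr p = norm (G x) powr p"
      using assms(3) by eventually_elim simp
  qed (use assms(1,2) in measurable)
  then show ?thesis by (simp add: Lp_norm_def)
qed

lemma Lp_field_cong_AE: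
  assumes "Lp_field p F" "G \<in> borel_measurable borel" "AE x in lborel. F x = G x"
  shows "Lp_field p G"
proof -
  have "integrable lborel (\<lambda>x. norm (G x) powr p)"
  proof (rule integrable_cong_AE_imp)
    show "integrable lborel (\<lambda>x. norm (F x) powr p)" using assms(1) by (simp add: Lp_field_def)
    show "AE x in lborel. norm (F x) powr p = norm (G x) powr p"
      using assms(3) by eventually_elim simp
  qed (use assms(2) in measurable)
  with assms show ?thesis by (simp add: Lp_field_def)
qed

lemma Lp_norm_scaleR: "p > 0 \<Longrightarrow> Lp_norm p (\<lambda>x. c *\<^sub>R F x) = \<bar>c\<bar> * Lp_norm p F"
  by (simp add: Lp_norm_def powr_mult powr_powr integral_nonneg_AE)

lemma Lp_field_scaleR: "Lp_field p F \<Longrightarrow> Lp_field p (\<lambda>x. c *\<^sub>R F x)"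
  by (simp add: Lp_field_def powr_mult borel_measurable_scaleR)

lemma powr_add_le:
  fixes a b p :: real
  assumes "a \<ge> 0" "b \<ge> 0" "p > 0"
  shows "(a + b) powr p \<le> 2 powr p * (a powr p + b powr p)"
proof -
  have "(a + b) powr p \<le> (2 * max a b) powr p" using assms by (intro powr_mono2) auto
  also have "\<dots> = 2 powr p * max a b powr p" by (simp only: powr_mult)
  also have "\<dots> \<le> 2 powr p * (a powr p + b powr p)"
    by (intro mult_left_mono) (auto simp: max_def)
  finally show ?thesis .
qed

lemma Lp_field_add:
  assumes "Lp_field p F" "Lp_field p G" "p > 0"
  shows "Lp_field p (\<lambda>x. F x + G x)"
proof -
  have [measurable]: "F \<in> borel_measurable borel" "G \<in> borel_measurable borel"
    using assms by (auto simp: Lp_field_def)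
  have "integrable lborel (\<lambda>x. 2 powr p * (norm (F x) powr p + norm (G x) powr p))"
    using assms unfolding Lp_field_def by (intro integrable_mult_right Bochner_Integration.integrable_add) auto
  then have "integrable lborel (\<lambda>x. norm (F x + G x) powr p)"
  proof (rule Bochner_Integration.integrable_bound)
    have "norm (F x + G x) powr p \<le> 2 powr p * (norm (F x) powr p + norm (G x) powr p)" for x
      using powr_mono2[of p "norm (F x + G x)" "norm (F x) + norm (G x)"] assms(3)
        powr_add_le[of "norm (F x)" "norm (G x)" p] norm_triangle_ineq[of "F x" "G x"] by simp
    then show "AE x in lborel. norm (norm (F x + G x) powr p)
        \<le> norm (2 powr p * (norm (F x) powr p + norm (G x) powr p))"
      by (simp add: add_nonneg_nonneg)
  qed measurable
  then show ?thesis by (simp add: Lp_field_def)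
qed

lemma Lp_field_diff:
  assumes "Lp_field p F" "Lp_field p G" "p > 0"
  shows "Lp_field p (\<lambda>x. F x - G x)"
  using Lp_field_add[OF assms(1) Lp_field_scaleR[OF assms(2), of "-1"] assms(3)] by simp

text \<open>Splitting at the height \<open>t\<close> gives Hoelder's inequality up to the factor 2.\<close>

lemma Lp_field_set_integral:
  fixes F :: "real^'n \<Rightarrow> real^'n"
  assumes F: "Lp_field p F" and p: "p > 1"
    and A: "A \<in> sets borel" "emeasure lborel A < \<infinity>" "measure lborel A > 0"
  shows "integrable lborel (\<lambda>x. indicator A x * norm (F x))"
    and "(LINT x|lborel. indicator A x * norm (F x)) \<le> 2 * measure lborel A powr (1 - 1 / p) * Lp_norm p F"
proof -
  have [measurable]: "F \<in> borel_measurable borel" "A \<in> sets borel"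
    using F A by (auto simp: Lp_field_def)
  have Fp: "integrable lborel (\<lambda>x. norm (F x) powr p)" using F by (simp add: Lp_field_def)
  have iA: "integrable lborel (indicator A :: _ \<Rightarrow> real)" using A by (intro integrable_real_indicator) auto
  have pw: "s \<le> t + t powr (1 - p) * s powr p" if "t > 0" "s \<ge> 0" for s t :: real
  proof (cases "s \<le> t")
    case True
    then show ?thesis by (simp add: add_increasing2)
  next
    case False
    then have "s = s powr (1 - p) * s powr p" using that by (simp flip: powr_add)
    also have "\<dots> \<le> t powr (1 - p) * s powr p"
      using False that p by (intro mult_right_mono powr_mono2') auto
    finally show ?thesis using that by linarith
  qed
  have bd: "indicator A x * norm (F x) \<le> t * indicator A x + t powr (1 - p) * norm (F x) powr p"
    if "t > 0" for x t
    using pw[OF that, of "norm (F x)"] by (auto simp: indicator_def)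
  have int2: "integrable lborel (\<lambda>x. t * indicator A x + t powr (1 - p) * norm (F x) powr p)" for t
    using iA Fp by (intro Bochner_Integration.integrable_add integrable_mult_right) auto
  show int: "integrable lborel (\<lambda>x. indicator A x * norm (F x))"
    by (rule Bochner_Integration.integrable_bound[OF int2[of 1]])
       (use bd[of 1] in \<open>auto simp: add_nonneg_nonneg\<close>)
  let ?m = "measure lborel A" and ?N = "Lp_norm p F"
  have est: "(LINT x|lborel. indicator A x * norm (F x)) \<le> t * ?m + t powr (1 - p) * ?N powr p" if "t > 0" for t
  proof -
    have "(LINT x|lborel. indicator A x * norm (F x))
      \<le> (LINT x|lborel. t * indicator A x + t powr (1 - p) * norm (F x) powr p)"
      by (rule integral_mono[OF int int2 bd[OF that]])
    also have "\<dots> = t * ?m + t powr (1 - p) * (LINT x|lborel. norm (F x) powr p)"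
      using iA Fp by (subst Bochner_Integration.integral_add) auto
    finally show ?thesis using p by (simp add: Lp_norm_powr)
  qed
  show "(LINT x|lborel. indicator A x * norm (F x)) \<le> 2 * ?m powr (1 - 1 / p) * ?N"
  proof (cases "?N = 0")
    case True
    have "(LINT x|lborel. indicator A x * norm (F x)) \<le> 0 + e" if "e > 0" for e
      using est[of "e / ?m"] that A(3) True p by simp
    then have "(LINT x|lborel. indicator A x * norm (F x)) \<le> 0" by (rule field_le_epsilon)
    then show ?thesis using True by simp
  next
    case False
    then have N: "?N > 0" using Lp_norm_nonneg[of p F] by simp
    \<comment> \<open>The height at which the two terms of \<open>est\<close> are equal; each is
      then \<open>?m powr (1 - 1 / p) * ?N\<close>, whence the factor 2.\<close>
    let ?t = "?N * ?m powr (- 1 / p)"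
    have t: "?t > 0" using N A(3) by simp
    have e1: "?t * ?m = ?m powr (1 - 1 / p) * ?N"
      using powr_add[of ?m 1 "- 1 / p"] A(3) by simp
    have "?t powr (1 - p) = ?N powr (1 - p) * ?m powr (- 1 / p * (1 - p))"
      using N A(3) by (simp add: powr_mult powr_powr)
    also have "- 1 / p * (1 - p) = 1 - 1 / p" using p by (simp add: field_simps)
    finally have e2: "?t powr (1 - p) * ?N powr p = ?m powr (1 - 1 / p) * ?N"
      using N powr_add[of ?N "1 - p" p] by simp
    show ?thesis using est[OF t] unfolding e1 e2 by (simp add: mult_ac)
  qed
qed

text \<open>The bounds \<open>b k\<close> may vary with \<open>k\<close>, so that the lemma gives
  lower semicontinuity along a minimizing sequence as well as the preservation of a fixed
  bound.\<close>

lemma Lp_fatou: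
  fixes F :: "nat \<Rightarrow> real^'n \<Rightarrow> real^'n"
  assumes p: "p > 0" and F: "\<And>k. Lp_field p (F k)" and G: "G \<in> borel_measurable borel"
    and lim: "AE x in lborel. (\<lambda>k. F k x) \<longlonglongrightarrow> G x"
    and b: "\<And>k. Lp_norm p (F k) powr p \<le> b k" "b \<longlonglongrightarrow> B"
  shows "Lp_field p G" "Lp_norm p G powr p \<le> B"
proof -
  have [measurable]: "F k \<in> borel_measurable borel" "G \<in> borel_measurable borel" for k
    using F G by (auto simp: Lp_field_def)
  have Fk: "(\<integral>\<^sup>+x. ennreal (norm (F k x) powr p) \<partial>lborel) \<le> ennreal (b k)" for k
    using F[of k] b(1)[of k] p
    by (subst nn_integral_eq_integral) (auto simp: Lp_field_def Lp_norm_powr intro!: ennreal_leI)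
  have "AE x in lborel. ennreal (norm (G x) powr p) = liminf (\<lambda>k. ennreal (norm (F k x) powr p))"
    using lim
  proof eventually_elim
    case (elim x)
    then have "(\<lambda>k. ennreal (norm (F k x) powr p)) \<longlonglongrightarrow> ennreal (norm (G x) powr p)"
      using p by (intro tendsto_ennrealI tendsto_powr' tendsto_norm tendsto_const) auto
    then show ?case by (intro lim_imp_Liminf[symmetric]) simp_all
  qed
  then have "(\<integral>\<^sup>+x. ennreal (norm (G x) powr p) \<partial>lborel) = (\<integral>\<^sup>+x. liminf (\<lambda>k. ennreal (norm (F k x) powr p)) \<partial>lborel)"
    by (rule nn_integral_cong_AE)
  also have "\<dots> \<le> liminf (\<lambda>k. \<integral>\<^sup>+x. ennreal (norm (F k x) powr p) \<partial>lborel)"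
    by (rule nn_integral_liminf) measurable
  also have "\<dots> \<le> liminf (\<lambda>k. ennreal (b k))"
    by (rule Liminf_mono) (simp add: Fk)
  also have "\<dots> = ennreal B"
    using b(2) by (intro lim_imp_Liminf tendsto_ennrealI) auto
  finally have le: "(\<integral>\<^sup>+x. ennreal (norm (G x) powr p) \<partial>lborel) \<le> ennreal B" .
  have int: "integrable lborel (\<lambda>x. norm (G x) powr p)"
    by (rule integrableI_nonneg) (use le in \<open>auto intro: le_less_trans\<close>)
  then show "Lp_field p G" by (simp add: Lp_field_def)
  have "0 \<le> b k" for k using b(1)[of k] powr_ge_zero[of "Lp_norm p (F k)" p] by linarith
  then have "0 \<le> B" using b(2) by (intro LIMSEQ_le_const) auto
  with le show "Lp_norm p G powr p \<le> B"
    using int p by (subst (asm) nn_integral_eq_integral) (auto simp: Lp_norm_powr)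
qed

text \<open>The rate \<open>(1/4) ^ k\<close> is split in two: one factor \<open>(1/2) ^ k\<close>
  makes the integrals of \<open>a k\<close> summable, so that their sum is finite almost everywhere;
  the other survives as a pointwise geometric rate.\<close>

lemma Lp_complete:
  fixes F :: "nat \<Rightarrow> real^'n \<Rightarrow> real^'n"
  assumes p: "p \<ge> 1" and F: "\<And>k. Lp_field p (F k)"
    and cauchy: "\<And>k m. k \<le> m \<Longrightarrow> Lp_norm p (\<lambda>x. F k x - F m x) \<le> (1/4) ^ k"
  obtains G where "Lp_field p G" "\<And>k. Lp_norm p (\<lambda>x. F k x - G x) \<le> (1/4) ^ k"
    "AE x in lborel. (\<lambda>k. F k x) \<longlonglongrightarrow> G x"
proof -
  have [measurable]: "F k \<in> borel_measurable borel" for k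
    using F by (auto simp: Lp_field_def)
  define a where "a k x = (2 ^ k * norm (F k x - F (Suc k) x)) powr p" for k x
  have [measurable]: "a k \<in> borel_measurable borel" for k unfolding a_def by measurable
  have "(\<integral>\<^sup>+x. ennreal (a k x) \<partial>lborel) \<le> ennreal ((1/2) ^ k)" for k
  proof -
    have int: "integrable lborel (\<lambda>x. norm (F k x - F (Suc k) x) powr p)"
      using Lp_field_diff[OF F F, of k "Suc k"] p by (simp add: Lp_field_def)
    have a: "a k x = (2 ^ k) powr p * norm (F k x - F (Suc k) x) powr p" for x
      by (simp add: a_def powr_mult)
    have "(\<integral>\<^sup>+x. ennreal (a k x) \<partial>lborel) = ennreal (LINT x|lborel. a k x)"
      unfolding a using int by (intro nn_integral_eq_integral integrable_mult_right) auto
    also have "(LINT x|lborel. a k x) = (2 ^ k) powr p * Lp_norm p (\<lambda>x. F k x - F (Suc k) x) powr p"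
      unfolding a using p by (simp add: Lp_norm_powr)
    also have "\<dots> = (2 ^ k * Lp_norm p (\<lambda>x. F k x - F (Suc k) x)) powr p"
      by (simp add: powr_mult Lp_norm_nonneg)
    also have "\<dots> \<le> ((1/2) ^ k) powr p"
    proof -
      have "2 ^ k * Lp_norm p (\<lambda>x. F k x - F (Suc k) x) \<le> 2 ^ k * (1/4) ^ k"
        by (intro mult_left_mono cauchy) auto
      also have "\<dots> = (1/2::real) ^ k" by (simp flip: power_mult_distrib)
      finally show ?thesis using p by (intro powr_mono2) (auto simp: Lp_norm_nonneg)
    qed
    also have "((1/2::real) ^ k) powr p \<le> ((1/2) ^ k) powr 1"
      using p by (intro powr_mono') (auto simp: power_le_one)
    finally show ?thesis by (simp add: ennreal_leI)
  qed
  then have "(\<Sum>k. \<integral>\<^sup>+x. ennreal (a k x) \<partial>lborel) \<le> (\<Sum>k. ennreal ((1/2) ^ k))"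
    by (intro suminf_le) auto
  also have "\<dots> = ennreal (\<Sum>k. (1/2) ^ k)" by (intro suminf_ennreal2) (auto simp: summable_geometric)
  finally have "(\<integral>\<^sup>+x. (\<Sum>k. ennreal (a k x)) \<partial>lborel) \<noteq> \<infinity>"
    by (subst nn_integral_suminf) (auto simp: top_unique)
  then have "AE x in lborel. (\<Sum>k. ennreal (a k x)) \<noteq> \<infinity>"
    by (intro nn_integral_PInf_AE) auto
  then have conv: "AE x in lborel. convergent (\<lambda>k. F k x)"
  proof eventually_elim
    case (elim x)
    then obtain M where M: "M \<ge> 0" "(\<Sum>k. ennreal (a k x)) = ennreal M"
      by (cases "\<Sum>k. ennreal (a k x)") auto
    have nb: "norm (F (Suc k) x - F k x) \<le> M powr (1 / p) * (1/2) ^ k" for k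
    proof -
      have "ennreal (a k x) \<le> ennreal M"
        using sum_le_suminf[of "\<lambda>k. ennreal (a k x)" "{k}"] M(2) by auto
      then have "a k x \<le> M" using M(1) by simp
      then have "a k x powr (1 / p) \<le> M powr (1 / p)" using p by (intro powr_mono2) (auto simp: a_def)
      then have "2 ^ k * norm (F k x - F (Suc k) x) \<le> M powr (1 / p)"
        using p by (simp add: a_def powr_powr)
      then show ?thesis by (simp add: field_simps norm_minus_commute)
    qed
    have "summable (\<lambda>k. M powr (1 / p) * (1/2) ^ k)"
      by (intro summable_mult summable_geometric) simp
    then have "summable (\<lambda>k. F (Suc k) x - F k x)"
      by (rule summable_comparison_test'[where N=0]) (rule nb)
    then have "convergent (\<lambda>k. \<Sum>i<k. F (Suc i) x - F i x)"
      by (simp add: summable_iff_convergent)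
    then have "convergent (\<lambda>k. F k x - F 0 x)"
      using sum_lessThan_telescope[of "\<lambda>k. F k x"] by simp
    from convergent_add[OF this convergent_const[of "F 0 x"]] show ?case by simp
  qed
  define G where "G x = lim (\<lambda>k. F k x)" for x
  have [measurable]: "G \<in> borel_measurable borel"
    unfolding G_def[abs_def] by (rule borel_measurable_lim_metric) measurable
  have lim: "AE x in lborel. (\<lambda>k. F k x) \<longlonglongrightarrow> G x"
    using conv by eventually_elim (simp add: G_def convergent_LIMSEQ_iff)
  \<comment> \<open>Fatou's lemma in \<open>m\<close>, with \<open>k\<close> fixed, carries the
    Cauchy bound over to the limit.\<close>
  have d: "Lp_field p (\<lambda>x. F k x - G x)" "Lp_norm p (\<lambda>x. F k x - G x) powr p \<le> ((1/4) ^ k) powr p" for k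
  proof -
    have "AE x in lborel. (\<lambda>m. F k x - F (m + k) x) \<longlonglongrightarrow> F k x - G x"
      using lim by eventually_elim (intro tendsto_diff tendsto_const LIMSEQ_ignore_initial_segment)
    moreover have "Lp_norm p (\<lambda>x. F k x - F (m + k) x) powr p \<le> ((1/4) ^ k) powr p" for m
      using p by (intro powr_mono2 cauchy) (auto simp: Lp_norm_nonneg)
    moreover have "Lp_field p (\<lambda>x. F k x - F (m + k) x)" for m
      using p by (intro Lp_field_diff F) auto
    moreover have "p > 0" "(\<lambda>x. F k x - G x) \<in> borel_measurable borel" using p by simp_all
    ultimately show "Lp_field p (\<lambda>x. F k x - G x)" "Lp_norm p (\<lambda>x. F k x - G x) powr p \<le> ((1/4) ^ k) powr p"
      using Lp_fatou[where F="\<lambda>m x. F k x - F (m + k) x" and b="\<lambda>_. ((1/4) ^ k) powr p"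
        and G="\<lambda>x. F k x - G x" and B="((1/4) ^ k) powr p" and p=p, OF _ _ _ _ _ tendsto_const] by blast+
  qed
  have "Lp_field p G"
    using Lp_field_diff[OF F[of 0] d(1)[of 0]] p by simp
  moreover have "Lp_norm p (\<lambda>x. F k x - G x) \<le> (1/4) ^ k" for k
  proof (rule ccontr)
    assume "\<not> ?thesis"
    then have "((1/4) ^ k) powr p < Lp_norm p (\<lambda>x. F k x - G x) powr p"
      using p by (intro powr_less_mono2) auto
    with d(2)[of k] show False by simp
  qed
  ultimately show ?thesis using that lim by blast
qed

text \<open>The reverse Minkowski inequality in \<open>L\<^bsup>p-1\<^esup>\<close>, by concavity of \<open>t powr (p - 1)\<close>.\<close>

lemma reverse_minkowski:
  fixes X Y f1 f2 h p q :: real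
  assumes p: "1 < p" "p \<le> 2" and q: "q = p / (p - 1)"
    and XY: "X > 0" "Y > 0" and f: "f1 \<ge> 0" "f2 \<ge> 0" and h: "h \<ge> 0"
    and le: "f1 powr q + f2 powr q \<le> h powr (q - 1)"
  shows "(X powr q + Y powr q) powr (p - 1) *
     (X powr q / (X powr q + Y powr q) * (f1 / X) powr p + Y powr q / (X powr q + Y powr q) * (f2 / Y) powr p) \<le> h"
proof -
  have q2: "q \<ge> 2" and pq: "(q - 1) * (p - 1) = 1" "q * (p - 1) = p"
    using p by (simp_all add: q field_simps)
  let ?S = "X powr q + Y powr q"
  have S: "?S > 0" using XY by (simp add: add_pos_pos)
  define l where "l = X powr q / ?S"
  define m where "m = Y powr q / ?S"
  have lm: "l \<ge> 0" "m \<ge> 0" "l + m = 1"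
    using S by (auto simp: l_def m_def add_divide_distrib[symmetric])
  have conc: "l * A powr (p - 1) + m * B powr (p - 1) \<le> (l * A + m * B) powr (p - 1)"
    if "A \<ge> 0" "B \<ge> 0" for A B :: real
  proof (cases "l * A + m * B = 0")
    case True
    then have "l * A = 0" "m * B = 0" using lm that by (auto simp: add_nonneg_eq_0_iff)
    then show ?thesis using p by auto
  next
    case False
    let ?T = "l * A + m * B"
    have T: "?T > 0" using False lm that by (simp add: order_less_le add_nonneg_nonneg)
    \<comment> \<open>The tangent of \<open>t powr (p - 1)\<close> at \<open>?T\<close>, multiplied
      by \<open>?T powr (2 - p)\<close>. Averaging it with the weights \<open>l\<close> and
      \<open>m\<close> gives concavity.\<close>
    have young: "A powr (p - 1) * ?T powr (2 - p) \<le> (p - 1) * A + (2 - p) * ?T" if "A \<ge> 0" for A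
    proof (cases "A = 0")
      case True
      then show ?thesis using p T by simp
    next
      case False
      then show ?thesis using Youngs_inequality_0[of "p - 1" "2 - p" A ?T] p T that by simp
    qed
    have "(l * A powr (p - 1) + m * B powr (p - 1)) * ?T powr (2 - p)
        = l * (A powr (p - 1) * ?T powr (2 - p)) + m * (B powr (p - 1) * ?T powr (2 - p))"
      by (simp add: algebra_simps)
    also have "\<dots> \<le> l * ((p - 1) * A + (2 - p) * ?T) + m * ((p - 1) * B + (2 - p) * ?T)"
      using lm young that by (intro add_mono mult_left_mono) auto
    also have "\<dots> = (p - 1) * ?T + (l + m) * ((2 - p) * ?T)" by (simp add: algebra_simps)
    also have "\<dots> = ?T" unfolding lm(3) by (simp add: algebra_simps)
    also have "\<dots> = ?T powr (p - 1) * ?T powr (2 - p)" using T by (simp flip: powr_add)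
    finally show ?thesis using T by simp
  qed
  have "?S powr (p - 1) * (l * (f1 / X) powr p + m * (f2 / Y) powr p)
     = ?S powr (p - 1) * (l * ((f1 / X) powr q) powr (p - 1) + m * ((f2 / Y) powr q) powr (p - 1))"
    by (simp add: powr_powr pq)
  also have "\<dots> \<le> ?S powr (p - 1) * (l * (f1 / X) powr q + m * (f2 / Y) powr q) powr (p - 1)"
    by (intro mult_left_mono conc) auto
  also have "\<dots> = (?S * (l * (f1 / X) powr q + m * (f2 / Y) powr q)) powr (p - 1)"
    by (simp only: powr_mult)
  also have "?S * (l * (f1 / X) powr q + m * (f2 / Y) powr q) = f1 powr q + f2 powr q"
  proof -
    have "?S * l = X powr q" "?S * m = Y powr q" using S by (auto simp: l_def m_def)
    then have "?S * (l * (f1 / X) powr q + m * (f2 / Y) powr q) = X powr q * (f1 / X) powr q + Y powr q * (f2 / Y) powr q"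
      by (simp add: distrib_left flip: mult.assoc)
    then show ?thesis using XY f by (simp add: powr_divide)
  qed
  also have "(f1 powr q + f2 powr q) powr (p - 1) \<le> (h powr (q - 1)) powr (p - 1)"
    using p le by (intro powr_mono2) (auto intro: add_nonneg_nonneg)
  also have "\<dots> = h" using h by (simp add: powr_powr pq)
  finally show ?thesis by (simp add: l_def m_def)
qed

lemma norm_card_1:
  fixes v :: "real^'n"
  assumes "CARD('n) = 1" shows "norm v = \<bar>v $ i\<bar>"
proof -
  obtain j where j: "(UNIV :: 'n set) = {j}" using card_1_singletonE[OF assms] .
  then have ij: "i = j" by (metis UNIV_I singletonD)
  have "norm v = sqrt (\<Sum>k\<in>UNIV. (v $ k)\<^sup>2)" by (simp add: norm_vec_def L2_set_def)
  also have "(\<Sum>k\<in>UNIV. (v $ k)\<^sup>2) = (v $ i)\<^sup>2" by (subst j) (simp add: ij)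
  finally show ?thesis by simp
qed

text \<open>One exponent for both ranges of \<open>p\<close>, so that everything after Clarkson's
  inequality is proved once. For \<open>p \<le> 2\<close> it is the exponent conjugate to
  \<open>p\<close>.\<close>

definition clarkson_exponent :: "real \<Rightarrow> real" where
  "clarkson_exponent p = (if 2 < p then p else p / (p - 1))"

text \<open>For \<open>p > 2\<close> the pointwise inequality is integrated. Otherwise
  \<open>CARD('n) < p \<le> 2\<close> forces dimension one and the scalar inequality applies. It
  involves \<open>q\<close>-th powers where the norms are made of integrals of \<open>p\<close>-th
  powers, so the reverse Minkowski inequality has to come in between.\<close>

theorem clarkson:
  fixes F G :: "real^'n \<Rightarrow> real^'n"
  assumes p: "real CARD('n) < p" and F: "Lp_field p F" and G: "Lp_field p G"
  shows "Lp_norm p (\<lambda>x. (1/2) *\<^sub>R (F x - G x)) powr clarkson_exponent p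
       + Lp_norm p (\<lambda>x. (1/2) *\<^sub>R (F x + G x)) powr clarkson_exponent p
     \<le> ((Lp_norm p F powr p + Lp_norm p G powr p) / 2) powr (clarkson_exponent p / p)"
proof -
  have n1: "CARD('n) \<ge> 1" by (simp add: Suc_leI)
  have p1: "p > 1" using p n1 by linarith
  let ?D = "\<lambda>x. (1/2) *\<^sub>R (F x - G x)" and ?S = "\<lambda>x. (1/2) *\<^sub>R (F x + G x)"
  have iF: "integrable lborel (\<lambda>x. norm (F x) powr p)" and iG: "integrable lborel (\<lambda>x. norm (G x) powr p)"
    using F G by (auto simp: Lp_field_def)
  have "Lp_field p ?D" "Lp_field p ?S"
    using F G p1 by (auto intro!: Lp_field_scaleR Lp_field_diff Lp_field_add)
  then have iD: "integrable lborel (\<lambda>x. norm (?D x) powr p)" and iS: "integrable lborel (\<lambda>x. norm (?S x) powr p)"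
    by (auto simp: Lp_field_def)
  let ?H = "\<lambda>x. (norm (F x) powr p + norm (G x) powr p) / 2"
  have iH: "integrable lborel ?H" using iF iG by auto
  have H: "(LINT x|lborel. ?H x) = (Lp_norm p F powr p + Lp_norm p G powr p) / 2"
    using iF iG p1 by (simp add: Lp_norm_powr)
  show ?thesis
  proof (cases "2 < p")
    case True
    have "(LINT x|lborel. norm (?D x) powr p) + (LINT x|lborel. norm (?S x) powr p)
        = (LINT x|lborel. norm (?D x) powr p + norm (?S x) powr p)"
      using iD iS by (intro Bochner_Integration.integral_add[symmetric])
    also have "\<dots> \<le> (LINT x|lborel. ?H x)"
      using True by (intro integral_mono Bochner_Integration.integrable_add iD iS iH clarkson_pointwise_ge2) auto
    finally show ?thesis
      using True p1 unfolding H clarkson_exponent_def by (simp only: Lp_norm_powr if_True) (simp add: Lp_norm_powr add_nonneg_nonneg)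
  next
    case False
    define q where "q = p / (p - 1)"
    have ce: "clarkson_exponent p = q" using False by (simp add: clarkson_exponent_def q_def)
    have q1: "q > 1" "q / p = q - 1" "q / p * (p - 1) = 1" "q * (p - 1) = p"
      using p1 False by (auto simp: q_def field_simps)
    have c1: "CARD('n) = 1" using p n1 False by linarith
    let ?X = "Lp_norm p ?D" and ?Y = "Lp_norm p ?S"
    have pw: "norm (?D x) powr q + norm (?S x) powr q \<le> ?H x powr (q - 1)" for x
    proof -
      fix i :: 'n
      show ?thesis
        using clarkson_pointwise_le2[of p q "F x $ i" "G x $ i"] p1 False
        by (simp add: norm_card_1[OF c1, of _ i] q_def)
    qed
    show ?thesis
    proof (cases "?X = 0 \<or> ?Y = 0")
      case False
      then have XY: "?X > 0" "?Y > 0" using Lp_norm_nonneg[of p ?D] Lp_norm_nonneg[of p ?S] by auto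
      let ?T = "?X powr q + ?Y powr q"
      have T: "?T > 0" using XY by (simp add: add_pos_pos)
      \<comment> \<open>\<open>reverse_minkowski\<close> bounds this combination by
        \<open>?H\<close>. It is linear in the p-th powers of the two norms, and its weights are
        such that it integrates to exactly \<open>?T powr (p - 1)\<close>.\<close>
      let ?f = "\<lambda>x. ?T powr (p - 1) * (?X powr q / ?T * (norm (?D x) / ?X) powr p + ?Y powr q / ?T * (norm (?S x) / ?Y) powr p)"
      have d: "(norm (?D x) / ?X) powr p = norm (?D x) powr p / ?X powr p"
        "(norm (?S x) / ?Y) powr p = norm (?S x) powr p / ?Y powr p" for x
        using XY by (simp_all only: powr_divide norm_ge_zero less_imp_le)
      have if': "integrable lborel ?f"
        unfolding d using iD iS
        by (intro integrable_mult_right Bochner_Integration.integrable_add integrable_divide)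
      have "(LINT x|lborel. ?f x) = ?T powr (p - 1) * (?X powr q / ?T * ((LINT x|lborel. norm (?D x) powr p) / ?X powr p)
           + ?Y powr q / ?T * ((LINT x|lborel. norm (?S x) powr p) / ?Y powr p))"
        unfolding d integral_mult_right_zero
        by (subst Bochner_Integration.integral_add)
           (use iD iS in \<open>auto intro!: integrable_mult_right integrable_divide simp del: norm_scaleR\<close>)
      also have "\<dots> = ?T powr (p - 1) * (?X powr q / ?T + ?Y powr q / ?T)"
        using XY p1 by (simp only: Lp_norm_powr[symmetric]) simp
      also have "\<dots> = ?T powr (p - 1)" using T by (simp add: add_divide_distrib[symmetric])
      finally have "?T powr (p - 1) = (LINT x|lborel. ?f x)" by simp
      also have "\<dots> \<le> (LINT x|lborel. ?H x)"
        by (intro integral_mono if' iH reverse_minkowski pw XY) (use p1 \<open>\<not> 2 < p\<close> in \<open>auto simp: q_def\<close>)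
      finally have "(?T powr (p - 1)) powr (q / p) \<le> (LINT x|lborel. ?H x) powr (q / p)"
        using p1 q1 by (intro powr_mono2) auto
      then show ?thesis unfolding ce H using T q1 by (simp add: powr_powr mult.commute)
    next
      \<comment> \<open>The weights above divide by both norms. If one norm is 0, it is enough to
        bound the other one alone.\<close>
      case True
      have single: "Lp_norm p E powr q \<le> (LINT x|lborel. ?H x) powr (q / p)"
        if "\<And>x. norm (E x) powr q \<le> ?H x powr (q - 1)" "integrable lborel (\<lambda>x. norm (E x) powr p)"
        for E :: "real^'n \<Rightarrow> real^'n"
      proof -
        have "norm (E x) powr p \<le> ?H x" for x
        proof -
          have "(norm (E x) powr q) powr (p - 1) \<le> (?H x powr (q - 1)) powr (p - 1)"
            using p1 that(1)[of x] by (intro powr_mono2) auto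
          moreover have "(q - 1) * (p - 1) = 1" using q1 by simp
          ultimately show ?thesis using q1(4) by (simp add: powr_powr add_nonneg_nonneg)
        qed
        then have "Lp_norm p E powr p \<le> (LINT x|lborel. ?H x)"
          using p1 that(2) iH by (simp only: Lp_norm_powr) (intro integral_mono, auto)
        then have "(Lp_norm p E powr p) powr (q / p) \<le> (LINT x|lborel. ?H x) powr (q / p)"
          using p1 q1 by (intro powr_mono2) auto
        then show ?thesis using p1 by (simp add: powr_powr)
      qed
      have "norm (?D x) powr q \<le> ?H x powr (q - 1)" "norm (?S x) powr q \<le> ?H x powr (q - 1)" for x
        using pw[of x] powr_ge_zero[of "norm (?D x)" q] powr_ge_zero[of "norm (?S x)" q] by linarith+
      then show ?thesis
        using True single[of ?D, OF _ iD] single[of ?S, OF _ iS] unfolding ce H by auto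
    qed
  qed
qed

section \<open>Weak gradients\<close>

definition has_weak_grad :: "(real^'n \<Rightarrow> real) \<Rightarrow> (real^'n \<Rightarrow> real^'n) \<Rightarrow> bool" where
  "has_weak_grad u G \<longleftrightarrow> (\<forall>i. is_weak_partial i u (\<lambda>x. G x $ i))"

lemma locally_integrable_add:
  assumes "locally_integrable f" "locally_integrable g"
  shows "locally_integrable (\<lambda>x. a * f x + b * g x)"
proof -
  have [measurable]: "f \<in> borel_measurable borel" "g \<in> borel_measurable borel"
    using assms by (auto simp: locally_integrable_def)
  have "set_integrable lborel K (\<lambda>x. a * f x + b * g x)" if "compact K" for K
  proof -
    have "set_integrable lborel K f" "set_integrable lborel K g"
      using assms that by (auto simp: locally_integrable_def)
    then show ?thesis
      by (intro set_integral_add(1) set_integrable_mult_right) auto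
  qed
  then show ?thesis by (simp add: locally_integrable_def)
qed

lemma weak_partial_unique:
  assumes "is_weak_partial i u g" "is_weak_partial i u h"
  shows "AE x in lborel. g x = h x"
proof -
  have g: "locally_integrable g" and h: "locally_integrable h"
    using assms by (auto simp: is_weak_partial_def)
  have "AE x in lborel. 1 * g x + (-1) * h x = 0"
  proof (rule AE_zero_if_test_integrals_zero)
    show "locally_integrable (\<lambda>x. 1 * g x + (-1) * h x)"
      by (rule locally_integrable_add[OF g h])
    fix \<phi> :: "real^'a \<Rightarrow> real" assume \<phi>: "test_function \<phi>"
    have "(LINT x|lborel. g x * \<phi> x) = (LINT x|lborel. h x * \<phi> x)"
      using assms \<phi> by (simp add: is_weak_partial_def)
    then show "(LINT x|lborel. (1 * g x + (-1) * h x) * \<phi> x) = 0"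
      using integrable_mult_test_function[OF g \<phi>] integrable_mult_test_function[OF h \<phi>]
      by (simp add: left_diff_distrib)
  qed
  then show ?thesis by eventually_elim simp
qed

lemma has_weak_grad_measurable:
  assumes "has_weak_grad u G" shows "G \<in> borel_measurable borel"
proof -
  have "(\<lambda>x. G x $ i) \<in> borel_measurable borel" for i
    using assms by (auto simp: has_weak_grad_def is_weak_partial_def locally_integrable_def)
  then show ?thesis
    by (subst borel_measurable_euclidean_space) (auto simp: Basis_vec_def inner_axis)
qed

lemma has_weak_grad_weak_grad:
  assumes "has_weak_grad u G" shows "has_weak_grad u (weak_grad u)"
proof -
  have "is_weak_partial i u (SOME g. is_weak_partial i u g)" for i
    by (rule someI[of _ "\<lambda>x. G x $ i"]) (use assms in \<open>simp add: has_weak_grad_def\<close>)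
  then show ?thesis by (simp add: has_weak_grad_def weak_grad_def)
qed

lemma has_weak_grad_unique:
  assumes "has_weak_grad u G" "has_weak_grad u H"
  shows "AE x in lborel. G x = H x"
proof -
  have "AE x in lborel. G x $ i = H x $ i" for i
    by (rule weak_partial_unique[of i u]) (use assms in \<open>simp_all add: has_weak_grad_def\<close>)
  then have "AE x in lborel. \<forall>i\<in>UNIV. G x $ i = H x $ i"
    by (intro AE_finite_allI) auto
  then show ?thesis by eventually_elim (simp add: vec_eq_iff)
qed

text \<open>\<open>weak_grad\<close> is one choice among the representatives of the gradient; its
  norm does not depend on the choice.\<close>

lemma Lp_norm_weak_grad:
  assumes "has_weak_grad u G" shows "Lp_norm p (weak_grad u) = Lp_norm p G"
  using assms has_weak_grad_weak_grad[OF assms]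
  by (intro Lp_norm_cong_AE has_weak_grad_unique has_weak_grad_measurable)

lemma has_weak_grad_add:
  assumes u: "has_weak_grad u G" "locally_integrable u" and v: "has_weak_grad v H" "locally_integrable v"
  shows "has_weak_grad (\<lambda>x. a * u x + b * v x) (\<lambda>x. a *\<^sub>R G x + b *\<^sub>R H x)"
  unfolding has_weak_grad_def is_weak_partial_def
proof (intro allI conjI impI)
  fix i
  let ?g = "\<lambda>x. G x $ i" and ?h = "\<lambda>x. H x $ i"
  have g: "locally_integrable ?g" "\<And>\<phi>. test_function \<phi> \<Longrightarrow>
      (LINT x|lborel. u x * partial_deriv i \<phi> x) = - (LINT x|lborel. G x $ i * \<phi> x)"
    using u by (auto simp: has_weak_grad_def is_weak_partial_def)
  have h: "locally_integrable ?h" "\<And>\<phi>. test_function \<phi> \<Longrightarrow>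
      (LINT x|lborel. v x * partial_deriv i \<phi> x) = - (LINT x|lborel. H x $ i * \<phi> x)"
    using v by (auto simp: has_weak_grad_def is_weak_partial_def)
  show "locally_integrable (\<lambda>x. (a *\<^sub>R G x + b *\<^sub>R H x) $ i)"
    using locally_integrable_add[OF g(1) h(1), of a b] by simp
  fix \<phi> :: "real^'a \<Rightarrow> real" assume \<phi>: "test_function \<phi>"
  have lin: "(LINT x|lborel. (a * f x + b * k x) * \<psi> x)
     = a * (LINT x|lborel. f x * \<psi> x) + b * (LINT x|lborel. k x * \<psi> x)"
    if f: "locally_integrable f" and k: "locally_integrable k" and \<psi>: "test_function \<psi>"
    for f k \<psi> :: "real^'a \<Rightarrow> real"
  proof -
    have "(LINT x|lborel. (a * f x + b * k x) * \<psi> x) = (LINT x|lborel. a * (f x * \<psi> x) + b * (k x * \<psi> x))"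
      by (simp add: algebra_simps)
    also have "\<dots> = (LINT x|lborel. a * (f x * \<psi> x)) + (LINT x|lborel. b * (k x * \<psi> x))"
      by (intro Bochner_Integration.integral_add integrable_mult_right
          integrable_mult_test_function f k \<psi>)
    finally show ?thesis by simp
  qed
  show "(LINT x|lborel. (a * u x + b * v x) * partial_deriv i \<phi> x)
      = - (LINT x|lborel. (a *\<^sub>R G x + b *\<^sub>R H x) $ i * \<phi> x)"
    using lin[OF u(2) v(2) test_function_partial_deriv[OF \<phi>], of i] lin[OF g(1) h(1) \<phi>] g(2)[OF \<phi>] h(2)[OF \<phi>]
    by simp
qed

lemma has_weak_grad_const: "has_weak_grad (\<lambda>_. c) (\<lambda>_. 0)"
  unfolding has_weak_grad_def is_weak_partial_def
  using integral_partial_deriv_test_function locally_integrable_continuous[of "\<lambda>_. 0"]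
  by (auto simp: continuous_on_const)

lemma holder_continuous_continuous_on:
  assumes "holder_continuous \<alpha> u" "\<alpha> > 0"
  shows "continuous_on A u"
proof -
  obtain H where H: "\<And>x y. \<bar>u x - u y\<bar> \<le> H * dist x y powr \<alpha>"
    using assms by (auto simp: holder_continuous_def)
  have "(u \<longlongrightarrow> u x) (at x)" for x
  proof -
    have "((\<lambda>y. H * dist y x powr \<alpha>) \<longlongrightarrow> H * 0 powr \<alpha>) (at x)"
      using assms(2) by (intro tendsto_mult tendsto_const tendsto_powr' tendsto_eq_intros) auto
    then have "((\<lambda>y. H * dist y x powr \<alpha>) \<longlongrightarrow> 0) (at x)" by simp
    then have "((\<lambda>y. u y - u x) \<longlongrightarrow> 0) (at x)"
      by (rule Lim_null_comparison[rotated]) (use H in \<open>simp add: eventually_at_filter\<close>)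
    then show ?thesis by (simp add: LIM_zero_iff)
  qed
  then show ?thesis by (simp add: continuous_at_imp_continuous_on isCont_def)
qed

lemma Lp_field_iff_components:
  fixes G :: "real^'n \<Rightarrow> real^'n"
  assumes p: "p > 0"
  shows "Lp_field p G \<longleftrightarrow> (\<forall>i. in_Lp p (\<lambda>x. G x $ i))"
proof
  assume G: "Lp_field p G"
  then have [measurable]: "G \<in> borel_measurable borel" by (simp add: Lp_field_def)
  show "\<forall>i. in_Lp p (\<lambda>x. G x $ i)"
  proof
    fix i
    have [measurable]: "(\<lambda>x. G x $ i) \<in> borel_measurable borel"
      by (rule borel_measurable_continuous_on[of "\<lambda>v. v $ i" G]) (auto intro!: continuous_intros)
    have "integrable lborel (\<lambda>x. \<bar>G x $ i\<bar> powr p)"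
    proof (rule Bochner_Integration.integrable_bound)
      show "integrable lborel (\<lambda>x. norm (G x) powr p)" using G by (simp add: Lp_field_def)
      show "AE x in lborel. norm (\<bar>G x $ i\<bar> powr p) \<le> norm (norm (G x) powr p)"
        using p by (intro AE_I2) (simp add: powr_mono2 component_le_norm_cart)
    qed measurable
    then show "in_Lp p (\<lambda>x. G x $ i)" by (simp add: in_Lp_def)
  qed
next
  assume G: "\<forall>i. in_Lp p (\<lambda>x. G x $ i)"
  then have [measurable]: "(\<lambda>x. G x $ i) \<in> borel_measurable borel" for i by (simp add: in_Lp_def)
  have [measurable]: "G \<in> borel_measurable borel"
    by (subst borel_measurable_euclidean_space) (auto simp: Basis_vec_def inner_axis)
  have "integrable lborel (\<lambda>x. norm (G x) powr p)"
  proof (rule Bochner_Integration.integrable_bound)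
    show "integrable lborel (\<lambda>x. real CARD('n) powr p * (\<Sum>i\<in>UNIV. \<bar>G x $ i\<bar> powr p))"
      using G by (intro integrable_mult_right Bochner_Integration.integrable_sum) (auto simp: in_Lp_def)
    have "norm (G x) powr p \<le> real CARD('n) powr p * (\<Sum>i\<in>UNIV. \<bar>G x $ i\<bar> powr p)" for x
    proof -
      have "Max (range (\<lambda>i. \<bar>G x $ i\<bar>)) \<in> range (\<lambda>i. \<bar>G x $ i\<bar>)" by (rule Max_in) auto
      then obtain j where "Max (range (\<lambda>i. \<bar>G x $ i\<bar>)) = \<bar>G x $ j\<bar>" by (rule imageE)
      then have j: "\<bar>G x $ i\<bar> \<le> \<bar>G x $ j\<bar>" for i
        using Max_ge[of "range (\<lambda>i. \<bar>G x $ i\<bar>)" "\<bar>G x $ i\<bar>"] by simp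
      have "norm (G x) \<le> (\<Sum>i\<in>UNIV. \<bar>G x $ i\<bar>)" by (rule norm_le_l1_cart)
      also have "\<dots> \<le> real CARD('n) * \<bar>G x $ j\<bar>" using sum_bounded_above[of UNIV "\<lambda>i. \<bar>G x $ i\<bar>" "\<bar>G x $ j\<bar>"] j by simp
      finally have "norm (G x) powr p \<le> (real CARD('n) * \<bar>G x $ j\<bar>) powr p"
        using p by (intro powr_mono2) auto
      also have "\<dots> = real CARD('n) powr p * \<bar>G x $ j\<bar> powr p" by (simp only: powr_mult)
      also have "\<dots> \<le> real CARD('n) powr p * (\<Sum>i\<in>UNIV. \<bar>G x $ i\<bar> powr p)"
        by (intro mult_left_mono member_le_sum) auto
      finally show ?thesis .
    qed
    then show "AE x in lborel. norm (norm (G x) powr p) \<le> norm (real CARD('n) powr p * (\<Sum>i\<in>UNIV. \<bar>G x $ i\<bar> powr p))"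
      by (simp add: sum_nonneg)
  qed measurable
  then show "Lp_field p G" by (simp add: Lp_field_def)
qed

section \<open>The space \<open>D1p\<close> as a vector space\<close>

lemma D1p_iff:
  fixes u :: "real^'n \<Rightarrow> real"
  assumes p: "real CARD('n) < p"
  shows "u \<in> D1p p \<longleftrightarrow> holder_continuous (1 - real CARD('n) / p) u \<and>
     has_weak_grad u (weak_grad u) \<and> Lp_field p (weak_grad u)"
proof
  have p0: "p > 0" using p by linarith
  {
    assume u: "u \<in> D1p p"
    then have "\<forall>i. \<exists>g. is_weak_partial i u g \<and> in_Lp p g" by (simp add: D1p_def)
    then obtain g where g: "\<And>i. is_weak_partial i u (g i)" "\<And>i. in_Lp p (g i)"
      using choice[of "\<lambda>i g. is_weak_partial i u g \<and> in_Lp p g"] by blast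
    have wg: "has_weak_grad u (\<lambda>x. \<chi> i. g i x)" using g by (simp add: has_weak_grad_def)
    then have wg2: "has_weak_grad u (weak_grad u)" by (rule has_weak_grad_weak_grad)
    have "Lp_field p (\<lambda>x. \<chi> i. g i x)" using g p0 by (simp add: Lp_field_iff_components)
    then have "Lp_field p (weak_grad u)"
      using has_weak_grad_measurable[OF wg2] has_weak_grad_unique[OF wg wg2] by (rule Lp_field_cong_AE)
    with u wg2 show "holder_continuous (1 - real CARD('n) / p) u \<and>
     has_weak_grad u (weak_grad u) \<and> Lp_field p (weak_grad u)" by (simp add: D1p_def)
  next
    assume u: "holder_continuous (1 - real CARD('n) / p) u \<and>
       has_weak_grad u (weak_grad u) \<and> Lp_field p (weak_grad u)"
    have "1 - real CARD('n) / p > 0" using p p0 by simp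
    then have "locally_integrable u"
      using u by (intro locally_integrable_continuous holder_continuous_continuous_on) auto
    moreover have "is_weak_partial i u (\<lambda>x. weak_grad u x $ i) \<and> in_Lp p (\<lambda>x. weak_grad u x $ i)" for i
      using u p0 by (auto simp: has_weak_grad_def Lp_field_iff_components)
    ultimately show "u \<in> D1p p" using u unfolding D1p_def by blast
  }
qed

lemma D1pI:
  fixes u :: "real^'n \<Rightarrow> real"
  assumes p: "real CARD('n) < p" and u: "holder_continuous (1 - real CARD('n) / p) u"
    and G: "has_weak_grad u G" "Lp_field p G"
  shows "u \<in> D1p p"
  unfolding D1p_iff[OF p]
  using u has_weak_grad_weak_grad[OF G(1)]
    Lp_field_cong_AE[OF G(2) has_weak_grad_measurable has_weak_grad_unique[OF G(1)]] by blast

lemma D1p_continuous: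
  fixes u :: "real^'n \<Rightarrow> real"
  assumes p: "real CARD('n) < p" and u: "u \<in> D1p p"
  shows "continuous_on A u" "locally_integrable u"
proof -
  have "1 - real CARD('n) / p > 0" using p by simp
  then show "continuous_on A u" "locally_integrable u"
    using u by (auto simp: D1p_def intro: holder_continuous_continuous_on)
qed

text \<open>Being a choice, \<open>weak_grad\<close> is linear only up to null sets; the second
  claim therefore compares norms instead of gradients.\<close>

lemma D1p_lin:
  fixes u v :: "real^'n \<Rightarrow> real"
  assumes p: "real CARD('n) < p" and u: "u \<in> D1p p" and v: "v \<in> D1p p"
  shows "(\<lambda>x. a * u x + b * v x) \<in> D1p p"
    and "Lp_norm p (weak_grad (\<lambda>x. a * u x + b * v x)) =
      Lp_norm p (\<lambda>x. a *\<^sub>R weak_grad u x + b *\<^sub>R weak_grad v x)"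
proof -
  have p0: "p > 0" using p by linarith
  let ?\<alpha> = "1 - real CARD('n) / p"
  obtain H K where H: "\<And>x y. \<bar>u x - u y\<bar> \<le> H * dist x y powr ?\<alpha>"
    and K: "\<And>x y. \<bar>v x - v y\<bar> \<le> K * dist x y powr ?\<alpha>"
    using u v by (auto simp: D1p_def holder_continuous_def)
  have h: "holder_continuous ?\<alpha> (\<lambda>x. a * u x + b * v x)"
    unfolding holder_continuous_def
  proof (intro exI allI)
    fix x y
    have "\<bar>(a * u x + b * v x) - (a * u y + b * v y)\<bar> = \<bar>a * (u x - u y) + b * (v x - v y)\<bar>"
      by (simp add: algebra_simps)
    also have "\<dots> \<le> \<bar>a\<bar> * \<bar>u x - u y\<bar> + \<bar>b\<bar> * \<bar>v x - v y\<bar>"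
      by (metis abs_mult abs_triangle_ineq)
    also have "\<dots> \<le> \<bar>a\<bar> * (H * dist x y powr ?\<alpha>) + \<bar>b\<bar> * (K * dist x y powr ?\<alpha>)"
      by (intro add_mono mult_left_mono H K) auto
    finally show "\<bar>(a * u x + b * v x) - (a * u y + b * v y)\<bar> \<le> (\<bar>a\<bar> * H + \<bar>b\<bar> * K) * dist x y powr ?\<alpha>"
      by (simp add: algebra_simps)
  qed
  have wu: "has_weak_grad u (weak_grad u)" "Lp_field p (weak_grad u)"
    and wv: "has_weak_grad v (weak_grad v)" "Lp_field p (weak_grad v)"
    using u v by (simp_all add: D1p_iff[OF p])
  have w: "has_weak_grad (\<lambda>x. a * u x + b * v x) (\<lambda>x. a *\<^sub>R weak_grad u x + b *\<^sub>R weak_grad v x)"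
    by (intro has_weak_grad_add wu wv D1p_continuous(2)[OF p] u v)
  show "(\<lambda>x. a * u x + b * v x) \<in> D1p p"
    using p0 by (intro D1pI[OF p h w] Lp_field_add Lp_field_scaleR wu wv)
  show "Lp_norm p (weak_grad (\<lambda>x. a * u x + b * v x)) =
      Lp_norm p (\<lambda>x. a *\<^sub>R weak_grad u x + b *\<^sub>R weak_grad v x)"
    by (rule Lp_norm_weak_grad[OF w])
qed

lemma D1p_scale:
  fixes u :: "real^'n \<Rightarrow> real"
  assumes p: "real CARD('n) < p" and u: "u \<in> D1p p"
  shows "(\<lambda>x. c * u x) \<in> D1p p" "Lp_norm p (weak_grad (\<lambda>x. c * u x)) = \<bar>c\<bar> * Lp_norm p (weak_grad u)"
  using D1p_lin[OF p u u, of c 0] Lp_norm_scaleR[of p c "weak_grad u"] p by auto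

section \<open>Signed measures\<close>

lemma signed_borel_measureD:
  assumes "signed_borel_measure \<rho>"
  shows "\<rho> {} = 0"
    and "\<And>A :: nat \<Rightarrow> _. range A \<subseteq> sets borel \<Longrightarrow> disjoint_family A \<Longrightarrow> (\<lambda>i. \<rho> (A i)) sums \<rho> (\<Union>i. A i)"
  using assms by (auto simp: signed_borel_measure_def)

lemma signed_borel_measure_uminus:
  assumes "signed_borel_measure \<rho>" shows "signed_borel_measure (\<lambda>A. - \<rho> A)"
  using assms unfolding signed_borel_measure_def by (auto intro: sums_minus)

lemma signed_measure_Un:
  assumes \<rho>: "signed_borel_measure \<rho>" and "A \<in> sets borel" "B \<in> sets borel" "A \<inter> B = {}"
  shows "\<rho> (A \<union> B) = \<rho> A + \<rho> B"
proof -
  have "range (binaryset A B) \<subseteq> sets borel" "disjoint_family (binaryset A B)"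
    using assms by (auto simp: range_binaryset_eq disjoint_family_on_def binaryset_def)
  from signed_borel_measureD(2)[OF \<rho> this]
  have "(\<lambda>i. \<rho> (binaryset A B i)) sums \<rho> (A \<union> B)" by (simp add: UN_binaryset_eq)
  moreover have "(\<lambda>i. \<rho> (binaryset A B i)) sums (\<Sum>i\<in>{0, Suc 0}. \<rho> (binaryset A B i))"
    by (rule sums_finite) (auto simp: binaryset_def signed_borel_measureD(1)[OF \<rho>])
  ultimately show ?thesis using sums_unique2 by (fastforce simp: binaryset_def)
qed

lemma signed_measure_Diff:
  assumes \<rho>: "signed_borel_measure \<rho>" and "A \<in> sets borel" "B \<in> sets borel" "B \<subseteq> A"
  shows "\<rho> (A - B) = \<rho> A - \<rho> B"
proof -
  have "B \<union> (A - B) = A" using assms by auto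
  then show ?thesis using signed_measure_Un[OF \<rho>, of B "A - B"] assms by auto
qed

text \<open>
  If \<open>\<rho>\<close> were unbounded, one could split off infinitely many disjoint sets whose measure is at least
  1 in absolute value, always keeping a piece on which \<open>\<rho>\<close> is unbounded.
\<close>

lemma signed_measure_bounded:
  fixes \<rho> :: "'a::topological_space set \<Rightarrow> real"
  assumes \<rho>: "signed_borel_measure \<rho>"
  obtains M where "\<And>B. B \<in> sets borel \<Longrightarrow> \<bar>\<rho> B\<bar> \<le> M"
proof (rule ccontr)
  assume no: "\<not> thesis"
  define unb where "unb A \<longleftrightarrow> A \<in> sets borel \<and> (\<forall>M. \<exists>B\<in>sets borel. B \<subseteq> A \<and> \<bar>\<rho> B\<bar> > M)" for A
  have U: "unb UNIV"
    unfolding unb_def using no that by (auto simp: not_le[symmetric])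
  have step: "\<exists>B. unb B \<and> B \<subseteq> A \<and> \<bar>\<rho> (A - B)\<bar> \<ge> 1" if A: "unb A" for A
  proof -
    \<comment> \<open>The margin makes both \<open>C\<close> and \<open>A - C\<close> have measure
      at least 1 in absolute value, so either of them can be split off, depending on which one keeps
      the unboundedness.\<close>
    from A obtain C where C: "C \<in> sets borel" "C \<subseteq> A" "\<bar>\<rho> C\<bar> > \<bar>\<rho> A\<bar> + 1" and Ab: "A \<in> sets borel"
      unfolding unb_def by blast
    have D: "\<rho> (A - C) = \<rho> A - \<rho> C" by (rule signed_measure_Diff[OF \<rho> Ab C(1,2)])
    show ?thesis
    proof (cases "unb C")
      case True
      then show ?thesis using C D by (intro exI[of _ C]) auto
    next
      case False
      then obtain M1 where M1: "\<And>B. B \<in> sets borel \<Longrightarrow> B \<subseteq> C \<Longrightarrow> \<bar>\<rho> B\<bar> \<le> M1"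
        using C unfolding unb_def by (auto simp: not_less)
      have "unb (A - C)"
      proof (rule ccontr)
        assume "\<not> unb (A - C)"
        then obtain M2 where M2: "\<And>B. B \<in> sets borel \<Longrightarrow> B \<subseteq> A - C \<Longrightarrow> \<bar>\<rho> B\<bar> \<le> M2"
          using C Ab unfolding unb_def by (auto simp: not_less)
        obtain B where B: "B \<in> sets borel" "B \<subseteq> A" "\<bar>\<rho> B\<bar> > M1 + M2"
          using A unfolding unb_def by blast
        have "\<rho> B = \<rho> ((B \<inter> C) \<union> (B - C))" by (simp add: Int_Diff_Un)
        also have "\<dots> = \<rho> (B \<inter> C) + \<rho> (B - C)" using B C by (intro signed_measure_Un[OF \<rho>]) auto
        finally have "\<rho> B = \<rho> (B \<inter> C) + \<rho> (B - C)" .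
        moreover have "\<bar>\<rho> (B \<inter> C)\<bar> \<le> M1" "\<bar>\<rho> (B - C)\<bar> \<le> M2"
          using B C by (auto intro!: M1 M2)
        ultimately show False using B(3) by linarith
      qed
      moreover have "A - (A - C) = C" using C by auto
      ultimately show ?thesis using C by (intro exI[of _ "A - C"]) auto
    qed
  qed
  obtain A where A: "\<And>n. unb (A n)" "\<And>n. A (Suc n) \<subseteq> A n" "\<And>n. \<bar>\<rho> (A n - A (Suc n))\<bar> \<ge> 1"
    using dependent_nat_choice[of "\<lambda>_. unb" "\<lambda>_ A B. B \<subseteq> A \<and> \<bar>\<rho> (A - B)\<bar> \<ge> 1"] U step by metis
  define E where "E n = A n - A (Suc n)" for n
  have anti: "A n \<subseteq> A m" if "m \<le> n" for m n
    using lift_Suc_antimono_le[of A, OF A(2) that] .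
  have "disjoint_family E"
    unfolding disjoint_family_on_def
  proof (intro ballI impI)
    fix m n :: nat assume "m \<noteq> n"
    then consider "Suc m \<le> n" | "Suc n \<le> m" by linarith
    then show "E m \<inter> E n = {}"
      using anti[of "Suc m" n] anti[of "Suc n" m] by cases (auto simp: E_def)
  qed
  moreover have "range E \<subseteq> sets borel" using A(1) by (auto simp: E_def unb_def)
  ultimately have "(\<lambda>i. \<rho> (E i)) sums \<rho> (\<Union>i. E i)" using signed_borel_measureD(2)[OF \<rho>] by blast
  then have "(\<lambda>i. \<rho> (E i)) \<longlonglongrightarrow> 0" by (intro summable_LIMSEQ_zero) (rule sums_summable)
  then have "eventually (\<lambda>i. dist (\<rho> (E i)) 0 < 1) sequentially" by (rule tendstoD) simp
  then obtain i where "dist (\<rho> (E i)) 0 < 1" by (auto simp: eventually_sequentially)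
  with A(3)[of i] show False by (simp add: E_def)
qed

section \<open>The Jordan decomposition\<close>

definition upper_var :: "('a::topological_space set \<Rightarrow> real) \<Rightarrow> 'a set \<Rightarrow> ennreal" where
  "upper_var \<rho> A = (SUP B\<in>{B \<in> sets borel. B \<subseteq> A}. ennreal (\<rho> B))"

lemma upper_var_ge: "B \<in> sets borel \<Longrightarrow> B \<subseteq> A \<Longrightarrow> ennreal (\<rho> B) \<le> upper_var \<rho> A"
  unfolding upper_var_def by (rule SUP_upper) auto

lemma upper_var_le: "(\<And>B. B \<in> sets borel \<Longrightarrow> B \<subseteq> A \<Longrightarrow> ennreal (\<rho> B) \<le> c) \<Longrightarrow> upper_var \<rho> A \<le> c"
  unfolding upper_var_def by (rule SUP_least) auto

lemma upper_var_mono: "A \<subseteq> B \<Longrightarrow> upper_var \<rho> A \<le> upper_var \<rho> B"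
  by (rule upper_var_le) (auto intro: upper_var_ge)

lemma upper_var_superadditive:
  assumes \<rho>: "signed_borel_measure \<rho>" and AB: "A \<inter> B = {}"
  shows "upper_var \<rho> A + upper_var \<rho> B \<le> upper_var \<rho> (A \<union> B)"
proof -
  let ?I = "\<lambda>A. {B \<in> sets borel. B \<subseteq> A}"
  have ne: "?I X \<noteq> {}" for X :: "'a set" using sets.empty_sets by blast
  have le: "ennreal (\<rho> X) + ennreal (\<rho> Y) \<le> upper_var \<rho> (A \<union> B)" if "X \<in> ?I A" "Y \<in> ?I B" for X Y
  proof (cases "\<rho> X \<ge> 0 \<and> \<rho> Y \<ge> 0")
    case True
    have "\<rho> (X \<union> Y) = \<rho> X + \<rho> Y" using that AB by (intro signed_measure_Un[OF \<rho>]) auto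
    then have "ennreal (\<rho> X) + ennreal (\<rho> Y) = ennreal (\<rho> (X \<union> Y))" using True by simp
    also have "\<dots> \<le> upper_var \<rho> (A \<union> B)" using that by (intro upper_var_ge) auto
    finally show ?thesis .
  next
    \<comment> \<open>A negative value is truncated to 0 by \<open>ennreal\<close>; monotonicity
      takes care of the other one.\<close>
    case False
    have "ennreal (\<rho> X) \<le> upper_var \<rho> (A \<union> B)" "ennreal (\<rho> Y) \<le> upper_var \<rho> (A \<union> B)"
      using that by (auto intro!: upper_var_ge)
    with False show ?thesis by (auto simp: ennreal_neg not_le)
  qed
  have "upper_var \<rho> A + upper_var \<rho> B = (SUP X\<in>?I A. ennreal (\<rho> X) + upper_var \<rho> B)"
    unfolding upper_var_def[of \<rho> A] by (rule ennreal_SUP_add_left[symmetric, OF ne])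
  also have "\<dots> \<le> upper_var \<rho> (A \<union> B)"
  proof (rule SUP_least)
    fix X assume X: "X \<in> ?I A"
    have "ennreal (\<rho> X) + upper_var \<rho> B = (SUP Y\<in>?I B. ennreal (\<rho> X) + ennreal (\<rho> Y))"
      unfolding upper_var_def[of \<rho> B] by (rule ennreal_SUP_add_right[OF ne])
    also have "\<dots> \<le> upper_var \<rho> (A \<union> B)" using le[OF X] by (intro SUP_least) auto
    finally show "ennreal (\<rho> X) + upper_var \<rho> B \<le> upper_var \<rho> (A \<union> B)" .
  qed
  finally show ?thesis .
qed

lemma upper_var_empty:
  assumes "signed_borel_measure \<rho>" shows "upper_var \<rho> {} = 0"
proof -
  have "upper_var \<rho> {} \<le> 0"
    by (rule upper_var_le) (use signed_borel_measureD(1)[OF assms] in auto)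
  then show ?thesis by simp
qed

text \<open>Superadditivity bounds the finite sums by the value on the union. Conversely, a set
  \<open>B\<close> inside the union is cut along the sets \<open>A i\<close>, and negative pieces
  are replaced by 0 before each piece is compared with the variation of its
  \<open>A i\<close>.\<close>

lemma upper_var_countably_additive:
  assumes \<rho>: "signed_borel_measure \<rho>"
  shows "countably_additive (sets borel) (upper_var \<rho>)"
proof (rule countably_additiveI)
  fix A :: "nat \<Rightarrow> 'a set"
  assume A: "range A \<subseteq> sets borel" "disjoint_family A"
  show "(\<Sum>i. upper_var \<rho> (A i)) = upper_var \<rho> (\<Union>i. A i)"
  proof (rule antisym)
    have "(\<Sum>i<n. upper_var \<rho> (A i)) \<le> upper_var \<rho> (\<Union>i<n. A i)" for n
    proof (induction n)
      case 0
      then show ?case by simp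
    next
      case (Suc n)
      have "(\<Union>i<n. A i) \<inter> A n = {}" proof -
        have "A i \<inter> A n = {}" if "i < n" for i
          using disjoint_family_onD[OF A(2), of i n] that by simp
        then show ?thesis by blast
      qed
      then have sup: "upper_var \<rho> (\<Union>i<n. A i) + upper_var \<rho> (A n) \<le> upper_var \<rho> ((\<Union>i<n. A i) \<union> A n)"
        by (rule upper_var_superadditive[OF \<rho>])
      have "(\<Sum>i<Suc n. upper_var \<rho> (A i)) \<le> upper_var \<rho> (\<Union>i<n. A i) + upper_var \<rho> (A n)"
        using add_right_mono[OF Suc.IH] by simp
      also note sup
      also have "(\<Union>i<n. A i) \<union> A n = (\<Union>i<Suc n. A i)" by (auto simp: lessThan_Suc)
      finally show ?case .
    qed
    also have "upper_var \<rho> (\<Union>i<n. A i) \<le> upper_var \<rho> (\<Union>i. A i)" for n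
      by (intro upper_var_mono) auto
    finally have "(\<Sum>i<n. upper_var \<rho> (A i)) \<le> upper_var \<rho> (\<Union>i. A i)" for n .
    then show "(\<Sum>i. upper_var \<rho> (A i)) \<le> upper_var \<rho> (\<Union>i. A i)"
      by (simp add: suminf_eq_SUP SUP_least)
  next
    show "upper_var \<rho> (\<Union>i. A i) \<le> (\<Sum>i. upper_var \<rho> (A i))"
    proof (rule upper_var_le)
      fix B assume B: "B \<in> sets borel" "B \<subseteq> (\<Union>i. A i)"
      have "(\<lambda>i. \<rho> (B \<inter> A i)) sums \<rho> (\<Union>i. B \<inter> A i)"
        using A B by (intro signed_borel_measureD(2)[OF \<rho>]) (auto simp: disjoint_family_on_def)
      also have "(\<Union>i. B \<inter> A i) = B" using B by auto
      finally have "(\<lambda>n. ennreal (\<Sum>i<n. \<rho> (B \<inter> A i))) \<longlonglongrightarrow> ennreal (\<rho> B)"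
        unfolding sums_def by (rule tendsto_ennrealI)
      moreover have "ennreal (\<Sum>i<n. \<rho> (B \<inter> A i)) \<le> (\<Sum>i. upper_var \<rho> (A i))" for n
      proof -
        have "ennreal (\<Sum>i<n. \<rho> (B \<inter> A i)) \<le> ennreal (\<Sum>i<n. max 0 (\<rho> (B \<inter> A i)))"
          by (intro ennreal_leI sum_mono) auto
        also have "\<dots> = (\<Sum>i<n. ennreal (max 0 (\<rho> (B \<inter> A i))))" by (intro sum_ennreal[symmetric]) auto
        also have "\<dots> \<le> (\<Sum>i<n. upper_var \<rho> (A i))"
        proof (rule sum_mono)
          fix i
          have "ennreal (\<rho> (B \<inter> A i)) \<le> upper_var \<rho> (A i)"
            using A(1) B(1) by (intro upper_var_ge) auto
          then show "ennreal (max 0 (\<rho> (B \<inter> A i))) \<le> upper_var \<rho> (A i)"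
            by (auto simp: max_def)
        qed
        also have "\<dots> \<le> (\<Sum>i. upper_var \<rho> (A i))" by (intro sum_le_suminf) auto
        finally show ?thesis .
      qed
      ultimately show "ennreal (\<rho> B) \<le> (\<Sum>i. upper_var \<rho> (A i))"
        by (intro LIMSEQ_le_const2) auto
    qed
  qed
qed

lemma sets_upper_variation [simp]: "sets (upper_variation \<rho>) = sets borel"
  using sets.sigma_sets_eq[of "borel :: 'a measure"] by (simp add: upper_variation_def)

lemma space_upper_variation [simp]: "space (upper_variation \<rho>) = UNIV"
  by (simp add: upper_variation_def space_measure_of_conv)

lemma measurable_upper_variation [simp]: "measurable (upper_variation \<rho>) N = measurable borel N"
  by (rule measurable_cong_sets) simp_all

lemma emeasure_upper_variation:
  assumes "signed_borel_measure \<rho>" "A \<in> sets borel"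
  shows "emeasure (upper_variation \<rho>) A = upper_var \<rho> A"
proof (rule emeasure_measure_of[OF upper_variation_def[folded upper_var_def]])
  show "positive (sets (upper_variation \<rho>)) (upper_var \<rho>)"
    using upper_var_empty[OF assms(1)] by (simp add: positive_def)
  show "countably_additive (sets (upper_variation \<rho>)) (upper_var \<rho>)"
    using upper_var_countably_additive[OF assms(1)] by simp
qed (use assms in auto)

lemma finite_measure_upper_variation:
  assumes \<rho>: "signed_borel_measure \<rho>" shows "finite_measure (upper_variation \<rho>)"
proof
  obtain M where M: "\<And>B. B \<in> sets borel \<Longrightarrow> \<bar>\<rho> B\<bar> \<le> M" using signed_measure_bounded[OF \<rho>] by blast
  have "upper_var \<rho> UNIV \<le> ennreal M"
    by (rule upper_var_le) (use M in \<open>auto intro!: ennreal_leI simp: abs_le_iff\<close>)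
  then show "emeasure (upper_variation \<rho>) (space (upper_variation \<rho>)) \<noteq> \<infinity>"
    using emeasure_upper_variation[OF \<rho>, of UNIV] by (auto simp: top_unique)
qed

text \<open>For \<open>B \<subseteq> A\<close> one has
  \<open>\<rho> B = \<rho> A - \<rho> (A - B)\<close>, and \<open>- \<rho> (A - B)\<close> is at
  most the lower variation of \<open>A\<close>. The supremum over \<open>B\<close> gives one
  inequality; the other is the same one for the negative of \<open>\<rho>\<close>.\<close>

lemma measure_upper_minus_lower:
  assumes \<rho>: "signed_borel_measure \<rho>" and A: "A \<in> sets borel"
  shows "measure (upper_variation \<rho>) A - measure (upper_variation (\<lambda>A. - \<rho> A)) A = \<rho> A"
proof -
  have le: "measure (upper_variation \<rho>) A \<le> \<rho> A + measure (upper_variation (\<lambda>A. - \<rho> A)) A"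
    if \<rho>: "signed_borel_measure \<rho>" for \<rho> :: "'a set \<Rightarrow> real"
  proof -
    let ?b = "measure (upper_variation (\<lambda>A. - \<rho> A)) A"
    note \<rho>' = signed_borel_measure_uminus[OF \<rho>]
    interpret N: finite_measure "upper_variation (\<lambda>A. - \<rho> A)" by (rule finite_measure_upper_variation[OF \<rho>'])
    interpret P: finite_measure "upper_variation \<rho>" by (rule finite_measure_upper_variation[OF \<rho>])
    have b: "- \<rho> B \<le> ?b" if "B \<in> sets borel" "B \<subseteq> A" for B
    proof -
      have "ennreal (- \<rho> B) \<le> ennreal ?b"
        using upper_var_ge[OF that, of "\<lambda>A. - \<rho> A"] emeasure_upper_variation[OF \<rho>' A] N.emeasure_eq_measure by simp
      then show ?thesis by (simp add: ennreal_le_iff)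
    qed
    have "upper_var \<rho> A \<le> ennreal (\<rho> A + ?b)"
    proof (rule upper_var_le)
      fix B assume B: "B \<in> sets borel" "B \<subseteq> A"
      have "\<rho> B = \<rho> A - \<rho> (A - B)" using signed_measure_Diff[OF \<rho> A B] by simp
      also have "\<dots> \<le> \<rho> A + ?b" using b[of "A - B"] A B by auto
      finally show "ennreal (\<rho> B) \<le> ennreal (\<rho> A + ?b)" by (rule ennreal_leI)
    qed
    then have "ennreal (measure (upper_variation \<rho>) A) \<le> ennreal (\<rho> A + ?b)"
      using emeasure_upper_variation[OF \<rho> A] P.emeasure_eq_measure by simp
    moreover have "0 \<le> \<rho> A + ?b" using b[OF A order_refl] by simp
    ultimately show ?thesis by (simp only: ennreal_le_iff)
  qed
  show ?thesis
    using le[OF \<rho>] le[OF signed_borel_measure_uminus[OF \<rho>]] by simp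
qed

text \<open>The complement of the support is a union of possibly uncountably many null sets; by
  Lindelof's theorem countably many of them cover it.\<close>

lemma AE_upper_variation_signed_support:
  fixes \<rho> :: "'a::second_countable_topology set \<Rightarrow> real"
  assumes \<rho>: "signed_borel_measure \<rho>"
  shows "AE x in upper_variation \<rho>. x \<in> signed_support \<rho>"
proof -
  let ?F = "{U. open U \<and> (\<forall>A \<in> sets borel. A \<subseteq> U \<longrightarrow> \<rho> A = 0)}"
  obtain F' where F': "F' \<subseteq> ?F" "countable F'" "\<Union>F' = \<Union>?F"
    using Lindelof[of ?F] by auto
  have "U \<in> null_sets (upper_variation \<rho>)" if "U \<in> F'" for U
  proof -
    have "upper_var \<rho> U \<le> 0" using that F'(1) by (intro upper_var_le) auto
    moreover have "U \<in> sets borel" using that F'(1) by auto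
    ultimately show ?thesis using emeasure_upper_variation[OF \<rho>] by (auto simp: null_sets_def)
  qed
  then have "\<Union>F' \<in> null_sets (upper_variation \<rho>)"
    using null_sets_UN'[OF F'(2), of "\<lambda>x. x"] by simp
  then have "AE x in upper_variation \<rho>. x \<notin> \<Union>F'" by (rule AE_not_in)
  then show ?thesis by eventually_elim (simp add: signed_support_def F'(3))
qed

lemma signed_support_uminus: "signed_support (\<lambda>A. - \<rho> A) = signed_support \<rho>"
  by (simp add: signed_support_def)

text \<open>A continuous function is bounded on the compact support, and the support carries the
  whole, finite, measure.\<close>

lemma integrable_upper_variation:
  fixes \<rho> :: "'a::{second_countable_topology, t2_space} set \<Rightarrow> real"
    and f :: "'a \<Rightarrow> 'b::{banach, second_countable_topology}"
  assumes \<rho>: "signed_borel_measure \<rho>" "compact (signed_support \<rho>)" and f: "continuous_on UNIV f"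
  shows "integrable (upper_variation \<rho>) f"
proof -
  interpret finite_measure "upper_variation \<rho>" by (rule finite_measure_upper_variation[OF \<rho>(1)])
  have "bounded (f ` signed_support \<rho>)"
    using \<rho>(2) f continuous_on_subset by (intro compact_imp_bounded compact_continuous_image) auto
  then obtain B where B: "\<And>x. x \<in> signed_support \<rho> \<Longrightarrow> norm (f x) \<le> B"
    by (auto simp: bounded_iff)
  show ?thesis
  proof (rule integrable_const_bound)
    show "AE x in upper_variation \<rho>. norm (f x) \<le> B"
      using AE_upper_variation_signed_support[OF \<rho>(1)] by eventually_elim (rule B)
  qed (use f in \<open>simp add: borel_measurable_continuous_onI\<close>)
qed

lemma integrable_lower_variation:
  fixes \<rho> :: "'a::{second_countable_topology, t2_space} set \<Rightarrow> real"
    and f :: "'a \<Rightarrow> 'b::{banach, second_countable_topology}"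
  assumes "signed_borel_measure \<rho>" "compact (signed_support \<rho>)" "continuous_on UNIV f"
  shows "integrable (upper_variation (\<lambda>A. - \<rho> A)) f"
  using assms by (intro integrable_upper_variation signed_borel_measure_uminus) (simp_all add: signed_support_uminus)

lemma signed_integral_add:
  fixes \<rho> :: "'a::{second_countable_topology, t2_space} set \<Rightarrow> real"
    and f g :: "'a \<Rightarrow> 'b::{banach, second_countable_topology}"
  assumes "signed_borel_measure \<rho>" "compact (signed_support \<rho>)" "continuous_on UNIV f" "continuous_on UNIV g"
  shows "signed_integral \<rho> (\<lambda>x. f x + g x) = signed_integral \<rho> f + signed_integral \<rho> g"
  unfolding signed_integral_def
  by (simp add: Bochner_Integration.integral_add integrable_upper_variation integrable_lower_variation assms)

lemma signed_integral_bounded_linear: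
  fixes \<rho> :: "'a::{second_countable_topology, t2_space} set \<Rightarrow> real"
    and f :: "'a \<Rightarrow> 'b::{banach, second_countable_topology}"
    and T :: "'b \<Rightarrow> 'c::{banach, second_countable_topology}"
  assumes "signed_borel_measure \<rho>" "compact (signed_support \<rho>)" "continuous_on UNIV f" "bounded_linear T"
  shows "signed_integral \<rho> (\<lambda>x. T (f x)) = T (signed_integral \<rho> f)"
  unfolding signed_integral_def
  using assms integrable_upper_variation[of \<rho> f] integrable_lower_variation[of \<rho> f]
  by (simp add: integral_bounded_linear linear_simps)

lemma signed_integral_const:
  assumes \<rho>: "signed_borel_measure \<rho>"
  shows "signed_integral \<rho> (\<lambda>_. c) = \<rho> UNIV *\<^sub>R c"
  using measure_upper_minus_lower[OF \<rho>, of UNIV]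
  by (simp add: signed_integral_def flip: scaleR_left_diff_distrib)

lemma signed_borel_measure_push_forward:
  assumes "signed_borel_measure \<rho>" "S \<in> borel_measurable borel"
  shows "signed_borel_measure (push_forward S \<rho>)"
proof -
  have [measurable]: "S \<in> borel_measurable borel" by fact
  have "(\<lambda>i. \<rho> (S -` A i)) sums \<rho> (S -` (\<Union>i. A i))"
    if A: "range A \<subseteq> sets borel" "disjoint_family A" for A :: "nat \<Rightarrow> _"
  proof -
    have "S -` A i \<in> sets borel" for i using A(1) measurable_sets_borel[OF assms(2), of "A i"] by auto
    then show ?thesis
      unfolding vimage_UN using A(2)
      by (intro signed_borel_measureD(2)[OF assms(1)]) (auto simp: disjoint_family_on_def)
  qed
  then show ?thesis
    using signed_borel_measureD(1)[OF assms(1)] by (auto simp: signed_borel_measure_def push_forward_def)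
qed

text \<open>Every Borel subset of the preimage of \<open>A\<close> must itself be the preimage of a
  Borel subset of \<open>A\<close>; the measurable inverse \<open>R\<close> provides the
  latter.\<close>

lemma upper_variation_push_forward:
  assumes \<rho>: "signed_borel_measure \<rho>"
    and S: "S \<in> borel_measurable borel" and R: "R \<in> borel_measurable borel"
    and inv: "\<And>x. R (S x) = x" "\<And>y. S (R y) = y"
  shows "upper_variation (push_forward S \<rho>) = distr (upper_variation \<rho>) borel S"
proof (rule measure_eqI)
  fix A assume "A \<in> sets (upper_variation (push_forward S \<rho>))"
  then have A: "A \<in> sets borel" by simp
  have SA: "S -` A \<in> sets borel" using measurable_sets_borel[OF S A] .
  have "upper_var (push_forward S \<rho>) A = upper_var \<rho> (S -` A)"
  proof (rule antisym; rule upper_var_le)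
    fix B assume B: "B \<in> sets borel" "B \<subseteq> A"
    then show "ennreal (push_forward S \<rho> B) \<le> upper_var \<rho> (S -` A)"
      unfolding push_forward_def using measurable_sets_borel[OF S B(1)] by (intro upper_var_ge) auto
  next
    fix B assume B: "B \<in> sets borel" "B \<subseteq> S -` A"
    have RB: "R -` B \<in> sets borel" using measurable_sets_borel[OF R B(1)] .
    have eq: "S -` (R -` B) = B" using inv by auto
    have sub: "R -` B \<subseteq> A"
    proof
      fix y assume "y \<in> R -` B"
      then have "S (R y) \<in> A" using B(2) by auto
      then show "y \<in> A" by (simp add: inv)
    qed
    show "ennreal (\<rho> B) \<le> upper_var (push_forward S \<rho>) A"
      using upper_var_ge[OF RB sub, of "push_forward S \<rho>"] by (simp add: push_forward_def eq)
  qed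
  then show "emeasure (upper_variation (push_forward S \<rho>)) A = emeasure (distr (upper_variation \<rho>) borel S) A"
    using A S SA by (simp add: emeasure_upper_variation \<rho> signed_borel_measure_push_forward emeasure_distr)
qed simp

lemma signed_integral_push_forward:
  fixes f :: "_ \<Rightarrow> 'b::{banach, second_countable_topology}"
  assumes \<rho>: "signed_borel_measure \<rho>"
    and S: "S \<in> borel_measurable borel" and R: "R \<in> borel_measurable borel"
    and inv: "\<And>x. R (S x) = x" "\<And>y. S (R y) = y"
    and f: "f \<in> borel_measurable borel"
  shows "signed_integral (push_forward S \<rho>) f = signed_integral \<rho> (\<lambda>x. f (S x))"
proof -
  have "(\<lambda>A. - push_forward S \<rho> A) = push_forward S (\<lambda>A. - \<rho> A)" by (simp add: push_forward_def fun_eq_iff)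
  then show ?thesis
    using S f by (simp add: signed_integral_def upper_variation_push_forward[OF _ S R inv] \<rho>
        signed_borel_measure_uminus integral_distr)
qed

section \<open>Morrey's estimate\<close>

text \<open>A kernel whose mass is that of \<open>bump 1 (-1) 1\<close> for every centre
  \<open>c\<close> and scale \<open>s > 0\<close>. It is not normalised to mass 1: what counts is
  that the mass does not change.\<close>

definition bump_at :: "real \<Rightarrow> real \<Rightarrow> real \<Rightarrow> real" where
  "bump_at s c t = (1 / s) * bump 1 (-1) 1 ((1 / s) * t + (- c / s))"

lemma bump_at_props:
  assumes s: "s > 0"
  shows "smooth1 (bump_at s c)" "\<bar>bump_at s c t\<bar> \<le> 1 / s" "\<bar>t - c\<bar> \<ge> s \<Longrightarrow> bump_at s c t = 0"
    "integrable lborel (bump_at s c)" "(LINT t|lborel. bump_at s c t) = (LINT t|lborel. bump 1 (-1) 1 t)"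
    "(LINT t|lborel. \<bar>bump_at s c t\<bar>) \<le> 2"
proof -
  show sm: "smooth1 (bump_at s c)" unfolding bump_at_def[abs_def] by (rule smooth1_affine[OF smooth1_bump])
  show b: "\<bar>bump_at s c t\<bar> \<le> 1 / s" for t
    using s bump_bounds[of 1 "-1" 1 "(1 / s) * t + (- c / s)"] by (simp add: bump_at_def divide_right_mono)
  show z: "bump_at s c t = 0" if "\<bar>t - c\<bar> \<ge> s" for t
  proof -
    have e: "(1 / s) * t + (- c / s) = (t - c) / s" by (simp add: diff_divide_distrib)
    have "(t - c) / s \<le> -1 \<or> (t - c) / s \<ge> 1" using that s by (auto simp: field_simps abs_if split: if_splits)
    then have "bump 1 (-1) 1 ((t - c) / s) = 0" by (intro bump_outside) auto
    then show ?thesis by (simp only: bump_at_def e)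
  qed
  have [measurable]: "bump_at s c \<in> borel_measurable borel" using sm by measurable
  have ii: "integrable lborel (\<lambda>t. (1 / s) * indicator {c - s..c + s} t :: real)"
    by (intro integrable_mult_right integrable_real_indicator) (auto simp: emeasure_lborel_Icc_eq)
  have bi: "\<bar>bump_at s c t\<bar> \<le> (1 / s) * indicator {c - s..c + s} t" for t
    using b[of t] z[of t] by (cases "\<bar>t - c\<bar> \<ge> s") (auto simp: indicator_def)
  show int: "integrable lborel (bump_at s c)"
    by (rule Bochner_Integration.integrable_bound[OF ii]) (use bi s in auto)
  have "(LINT t|lborel. \<bar>bump_at s c t\<bar>) \<le> (LINT t|lborel. (1 / s) * indicator {c - s..c + s} t)"
    by (rule integral_mono[OF integrable_abs[OF int] ii bi])
  also have "\<dots> = 2" using s by simp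
  finally show "(LINT t|lborel. \<bar>bump_at s c t\<bar>) \<le> 2" .
  have "(LINT t|lborel. bump_at s c t) = \<bar>s\<bar> *\<^sub>R (LINT t|lborel. bump_at s c (c + s * t))"
    using s by (intro lborel_integral_real_affine) auto
  also have "(\<lambda>t. bump_at s c (c + s * t)) = (\<lambda>t. (1 / s) * bump 1 (-1) 1 t)"
    using s by (simp add: bump_at_def fun_eq_iff add_divide_distrib)
  finally show "(LINT t|lborel. bump_at s c t) = (LINT t|lborel. bump 1 (-1) 1 t)" using s by simp
qed

lemma lborel_affine_integral:
  fixes f :: "'a::euclidean_space \<Rightarrow> real"
  assumes [measurable]: "f \<in> borel_measurable borel" and s: "s \<noteq> 0"
  shows "(LINT y|lborel. f y) = \<bar>s\<bar> ^ DIM('a) * (LINT z|lborel. f (x + s *\<^sub>R z))"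
proof -
  have "(LINT y|lborel. f y) = (LINT y|density (distr lborel borel (\<lambda>z. x + s *\<^sub>R z)) (\<lambda>_. \<bar>s\<bar> ^ DIM('a)). f y)"
    using lborel_affine[OF s, of x] by simp
  also have "\<dots> = (LINT y|distr lborel borel (\<lambda>z. x + s *\<^sub>R z). \<bar>s\<bar> ^ DIM('a) * f y)"
    by (subst integral_density) auto
  also have "\<dots> = (LINT z|lborel. \<bar>s\<bar> ^ DIM('a) * f (x + s *\<^sub>R z))"
    by (subst integral_distr) auto
  finally show ?thesis by simp
qed

text \<open>Up to the constant mass of the kernel, a weighted mean of \<open>u\<close> near
  \<open>x\<close> at scale \<open>s\<close>.\<close>

definition bump_avg :: "(real^'n \<Rightarrow> real) \<Rightarrow> real^'n \<Rightarrow> real \<Rightarrow> real" where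
  "bump_avg u x s = (LINT y|lborel. u y * (\<Prod>i\<in>UNIV. bump_at s (x $ i) (y $ i)))"

text \<open>
  Replacing one factor of a product by another one of the same integral changes the product by a
  partial derivative of a test function.
\<close>

lemma avg_replace_factor:
  fixes u :: "real^'n \<Rightarrow> real" and f g :: "'n \<Rightarrow> real \<Rightarrow> real"
  assumes p: "real CARD('n) < p" and G: "has_weak_grad u G" "Lp_field p G" and u: "locally_integrable u"
    and s: "s > 0" and f: "\<And>i. smooth1 (f i)" "\<And>i t. \<bar>f i t\<bar> \<le> 2 / s" "\<And>i t. \<bar>t - x $ i\<bar> \<ge> 3 * s \<Longrightarrow> f i t = 0"
    and h: "smooth1 h" "\<And>t. \<bar>t - x $ j\<bar> \<ge> 3 * s \<Longrightarrow> h t = 0"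
    and int: "integrable lborel (f j)" "integrable lborel h" "(LINT t|lborel. f j t) = (LINT t|lborel. h t)"
      "(LINT t|lborel. \<bar>f j t\<bar>) \<le> 2" "(LINT t|lborel. \<bar>h t\<bar>) \<le> 2"
  shows "\<bar>(LINT y|lborel. u y * (\<Prod>i\<in>UNIV. f i (y $ i))) - (LINT y|lborel. u y * (\<Prod>i\<in>UNIV. (f(j := h)) i (y $ i)))\<bar>
    \<le> 8 * 2 ^ CARD('n) * 6 ^ CARD('n) * s powr (1 - real CARD('n) / p) * Lp_norm p G"
proof -
  let ?n = "CARD('n)"
  have n1: "?n \<ge> 1" by (simp add: Suc_leI)
  then have p1: "p > 1" using p by linarith
  have supp: "\<bar>t - c\<bar> \<ge> 3 * s" if "t \<le> c - 3 * s \<or> c + 3 * s \<le> t" for t c :: real using that s by linarith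
  have sd: "smooth1 (\<lambda>t. f j t - h t)" by (rule smooth1_diff[OF f(1) h(1)])
  have i0: "(LINT t|lborel. f j t - h t) = 0" using int by simp
  have "x $ j - 3 * s < x $ j + 3 * s" using s by simp
  moreover have "f j t - h t = 0" if "t \<le> x $ j - 3 * s \<or> x $ j + 3 * s \<le> t" for t
    using f(3)[of t j] h(2)[of t] supp[OF that] by simp
  ultimately obtain F where F: "\<And>t. (F has_real_derivative f j t - h t) (at t)" "smooth1 F"
     "\<And>t. t \<le> x $ j - 3 * s \<or> x $ j + 3 * s \<le> t \<Longrightarrow> F t = 0" "\<And>t. \<bar>F t\<bar> \<le> (LINT t|lborel. \<bar>f j t - h t\<bar>)"
    using smooth1_antiderivative[OF sd _ _ i0] by blast
  have "(LINT t|lborel. \<bar>f j t - h t\<bar>) \<le> (LINT t|lborel. \<bar>f j t\<bar> + \<bar>h t\<bar>)"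
    using int by (intro integral_mono Bochner_Integration.integrable_add integrable_abs Bochner_Integration.integrable_diff) auto
  also have "\<dots> \<le> 4" using int by simp
  finally have F4: "\<bar>F t\<bar> \<le> 4" for t using F(4)[of t] by linarith
  define k where "k i = (if i = j then F else f i)" for i
  define \<theta> where "\<theta> y = (\<Prod>i\<in>UNIV. k i (y $ i))" for y :: "real^'n"
  have kz: "k i t = 0" if "\<bar>t - x $ i\<bar> \<ge> 3 * s" for i t
    using that f(3)[of t i] F(3)[of t] by (auto simp: k_def abs_if split: if_splits)
  have ks: "smooth1 (k i)" for i using f F by (simp add: k_def)
  have tf: "test_function \<theta>"
    unfolding \<theta>_def[abs_def]
  proof (rule test_function_prod_nth[OF ks])
    fix i t assume "k i t \<noteq> 0"
    then have "\<bar>t - x $ i\<bar> < 3 * s" using kz[of t i] by force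
    then show "\<bar>t\<bar> \<le> norm x + 3 * s" using component_le_norm_cart[of x i] by linarith
  qed
  have "\<exists>k'. (\<forall>t. (k i has_real_derivative k' t) (at t)) \<and> (i = j \<longrightarrow> k' = (\<lambda>t. f j t - h t))" for i
  proof (cases "i = j")
    case True
    then show ?thesis using F(1) by (intro exI[of _ "\<lambda>t. f j t - h t"]) (simp add: k_def)
  next
    case False
    obtain f' where "\<And>t. (f i has_real_derivative f' t) (at t)"
      using smooth1_derivE[OF f(1)[of i]] by blast
    with False show ?thesis by (intro exI[of _ f']) (simp add: k_def)
  qed
  then have "\<forall>i. \<exists>k'. (\<forall>t. (k i has_real_derivative k' t) (at t)) \<and> (i = j \<longrightarrow> k' = (\<lambda>t. f j t - h t))" by blast
  from choice[OF this] obtain k' where k': "\<And>i t. (k i has_real_derivative k' i t) (at t)" "k' j = (\<lambda>t. f j t - h t)"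
    by blast
  have pd: "partial_deriv j \<theta> y = (\<Prod>i\<in>UNIV. f i (y $ i)) - (\<Prod>i\<in>UNIV. (f(j := h)) i (y $ i))" for y
  proof -
    have "partial_deriv j \<theta> y = (\<Prod>i\<in>UNIV. (if i = j then k' i else k i) (y $ i))"
      unfolding \<theta>_def[abs_def] by (rule partial_deriv_prod_nth[OF k'(1)])
    also have "\<dots> = (f j (y $ j) - h (y $ j)) * (\<Prod>i\<in>UNIV - {j}. f i (y $ i))"
      by (subst prod.remove[of UNIV j]) (auto simp: k'(2) k_def intro!: arg_cong2[where f="(*)"] prod.cong)
    also have "\<dots> = f j (y $ j) * (\<Prod>i\<in>UNIV - {j}. f i (y $ i)) - h (y $ j) * (\<Prod>i\<in>UNIV - {j}. f i (y $ i))"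
      by (rule left_diff_distrib)
    also have "f j (y $ j) * (\<Prod>i\<in>UNIV - {j}. f i (y $ i)) = (\<Prod>i\<in>UNIV. f i (y $ i))"
      by (rule prod.remove[symmetric]) auto
    also have "h (y $ j) * (\<Prod>i\<in>UNIV - {j}. f i (y $ i)) = (\<Prod>i\<in>UNIV. (f(j := h)) i (y $ i))"
      by (subst prod.remove[of UNIV j]) (auto intro!: arg_cong2[where f="(*)"] prod.cong)
    finally show ?thesis .
  qed
  have tprod: "test_function (\<lambda>y. \<Prod>i\<in>UNIV. q i (y $ i))"
    if q: "\<And>i. smooth1 (q i)" "\<And>i t. \<bar>t - x $ i\<bar> \<ge> 3 * s \<Longrightarrow> q i t = 0" for q :: "'n \<Rightarrow> real \<Rightarrow> real"
  proof (rule test_function_prod_nth[OF q(1)])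
    fix i t assume "q i t \<noteq> 0"
    then have "\<bar>t - x $ i\<bar> < 3 * s" using q(2)[of t i] by force
    then show "\<bar>t\<bar> \<le> norm x + 3 * s" using component_le_norm_cart[of x i] by linarith
  qed
  have t1: "test_function (\<lambda>y. \<Prod>i\<in>UNIV. f i (y $ i))" by (rule tprod) (use f in auto)
  have t2: "test_function (\<lambda>y. \<Prod>i\<in>UNIV. (f(j := h)) i (y $ i))" by (rule tprod) (use f h in auto)
  have "(LINT y|lborel. u y * (\<Prod>i\<in>UNIV. f i (y $ i))) - (LINT y|lborel. u y * (\<Prod>i\<in>UNIV. (f(j := h)) i (y $ i)))
     = (LINT y|lborel. u y * (\<Prod>i\<in>UNIV. f i (y $ i)) - u y * (\<Prod>i\<in>UNIV. (f(j := h)) i (y $ i)))"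
    by (rule Bochner_Integration.integral_diff[symmetric]) (intro integrable_mult_test_function u t1 t2)+
  also have "\<dots> = (LINT y|lborel. u y * partial_deriv j \<theta> y)"
    by (simp only: pd right_diff_distrib)
  also have "\<dots> = - (LINT y|lborel. G y $ j * \<theta> y)"
    using G(1) tf by (simp add: has_weak_grad_def is_weak_partial_def)
  also have "\<bar>\<dots>\<bar> \<le> (LINT y|lborel. \<bar>G y $ j * \<theta> y\<bar>)"
    using integral_abs_bound by simp
  finally have e1: "\<bar>(LINT y|lborel. u y * (\<Prod>i\<in>UNIV. f i (y $ i))) - (LINT y|lborel. u y * (\<Prod>i\<in>UNIV. (f(j := h)) i (y $ i)))\<bar>
     \<le> (LINT y|lborel. \<bar>G y $ j * \<theta> y\<bar>)" .
  define Q where "Q = cbox (\<chi> i. x $ i - 3 * s) (\<chi> i. x $ i + 3 * s)"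
  have mQ: "measure lborel Q = (6 * s) ^ ?n"
    unfolding Q_def using s
    by (subst content_cbox_cart) (auto simp: interval_ne_empty_cart)
  have Q: "Q \<in> sets borel" "emeasure lborel Q < \<infinity>" "measure lborel Q > 0"
    using s emeasure_bounded_finite[OF bounded_cbox] by (auto simp: Q_def mQ[unfolded Q_def])
  note hol = Lp_field_set_integral[OF G(2) p1 Q]
  \<comment> \<open>The factor \<open>F\<close> contributes 4, each of the remaining factors at most
    \<open>2 / s\<close>.\<close>
  let ?b = "4 * (2 / s) ^ (?n - 1)"
  have \<theta>b: "\<bar>\<theta> y\<bar> \<le> ?b * indicator Q y" for y
  proof (cases "y \<in> Q")
    case True
    have "\<bar>\<theta> y\<bar> = \<bar>F (y $ j)\<bar> * (\<Prod>i\<in>UNIV - {j}. \<bar>f i (y $ i)\<bar>)"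
      unfolding \<theta>_def abs_prod by (subst prod.remove[of UNIV j]) (auto simp: k_def intro!: arg_cong2[where f="(*)"] prod.cong)
    also have "\<dots> \<le> 4 * (\<Prod>i\<in>UNIV - {j}. 2 / s)"
      using F4 f(2) by (intro mult_mono prod_mono prod_nonneg) auto
    also have "\<dots> = ?b" by (simp add: card_Diff_singleton)
    finally show ?thesis using True by simp
  next
    case False
    then obtain i where "\<not> (x $ i - 3 * s \<le> y $ i \<and> y $ i \<le> x $ i + 3 * s)"
      by (auto simp: Q_def mem_box_cart)
    then have "k i (y $ i) = 0" by (intro kz) (auto simp: abs_if)
    then have "\<theta> y = 0" unfolding \<theta>_def by (intro prod_zero) auto
    then show ?thesis using False by simp
  qed
  have "(LINT y|lborel. \<bar>G y $ j * \<theta> y\<bar>) \<le> (LINT y|lborel. ?b * (indicator Q y * norm (G y)))"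
  proof (rule integral_mono')
    show "integrable lborel (\<lambda>y. ?b * (indicator Q y * norm (G y)))" by (intro integrable_mult_right hol)
    fix y
    have "\<bar>G y $ j * \<theta> y\<bar> \<le> norm (G y) * (?b * indicator Q y)"
      unfolding abs_mult by (intro mult_mono component_le_norm_cart \<theta>b) auto
    then show "\<bar>G y $ j * \<theta> y\<bar> \<le> ?b * (indicator Q y * norm (G y))" by (simp add: mult_ac)
    show "0 \<le> ?b * (indicator Q y * norm (G y))" using s by simp
  qed
  also have "\<dots> \<le> ?b * (2 * measure lborel Q powr (1 - 1 / p) * Lp_norm p G)"
    unfolding integral_mult_right_zero by (rule mult_left_mono[OF hol(2)]) (use s in simp)
  \<comment> \<open>The exponent of \<open>s\<close>: the bounded factors give \<open>1 - n\<close>,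
    Hoelder's inequality on a cube of side \<open>6 * s\<close> gives
    \<open>n * (1 - 1 / p)\<close>, together \<open>1 - n / p\<close>.\<close>
  also have "\<dots> = 8 * 2 ^ (?n - 1) * (6 ^ ?n) powr (1 - 1 / p) * s powr (1 - real ?n / p) * Lp_norm p G"
  proof -
    have "measure lborel Q powr (1 - 1 / p) = (6 ^ ?n) powr (1 - 1 / p) * (s ^ ?n) powr (1 - 1 / p)"
      unfolding mQ power_mult_distrib by (simp add: powr_mult)
    moreover have "(s ^ ?n) powr (1 - 1 / p) = s powr (real ?n * (1 - 1 / p))"
      using s by (simp add: powr_powr flip: powr_realpow)
    moreover have "(2 / s) ^ (?n - 1) = 2 ^ (?n - 1) * s powr (1 - real ?n)"
    proof -
      have "s ^ (?n - 1) = s powr (real ?n - 1)" using s n1 by (simp add: of_nat_diff flip: powr_realpow)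
      moreover have "s powr (1 - real ?n) = 1 / s powr (real ?n - 1)"
        using powr_minus_divide[of s "real ?n - 1"] by simp
      ultimately show ?thesis by (simp add: power_divide)
    qed
    moreover have "s powr (1 - real ?n) * s powr (real ?n * (1 - 1 / p)) = s powr (1 - real ?n / p)"
      unfolding powr_add[symmetric] by (simp add: algebra_simps)
    ultimately show ?thesis by (simp add: mult_ac)
  qed
  also have "\<dots> \<le> 8 * 2 ^ ?n * 6 ^ ?n * s powr (1 - real ?n / p) * Lp_norm p G"
  proof -
    have "(6 ^ ?n :: real) powr (1 - 1 / p) \<le> (6 ^ ?n) powr 1"
      using p1 by (intro powr_mono) auto
    moreover have "(2::real) ^ (?n - 1) \<le> 2 ^ ?n" by (intro power_increasing) auto
    ultimately show ?thesis by (intro mult_right_mono mult_mono) (auto simp: Lp_norm_nonneg)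
  qed
  finally show ?thesis using e1 by linarith
qed

text \<open>The kernel for \<open>x\<close> and \<open>s\<close> is turned into the one for
  \<open>y\<close> and \<open>r\<close> coordinate by coordinate, hence the factor
  \<open>CARD('n)\<close>. The bounds on \<open>r\<close> and on the distance of the centres keep
  the factors of all intermediate kernels supported within \<open>3 * s\<close> of the coordinates
  of \<open>x\<close> and bounded by \<open>2 / s\<close>.\<close>

lemma bump_avg_diff:
  fixes u :: "real^'n \<Rightarrow> real"
  assumes p: "real CARD('n) < p" and G: "has_weak_grad u G" "Lp_field p G" and u: "locally_integrable u"
    and s: "s > 0" "s / 2 \<le> r" "r \<le> s" and xy: "\<And>i. \<bar>x $ i - y $ i\<bar> \<le> s"
  shows "\<bar>bump_avg u x s - bump_avg u y r\<bar>
    \<le> real CARD('n) * (8 * 2 ^ CARD('n) * 6 ^ CARD('n)) * s powr (1 - real CARD('n) / p) * Lp_norm p G"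
proof -
  let ?D = "8 * 2 ^ CARD('n) * 6 ^ CARD('n) * s powr (1 - real CARD('n) / p) * Lp_norm p G"
  have r: "r > 0" using s by linarith
  note a = bump_at_props[OF s(1)] and b = bump_at_props[OF r]
  define f where "f S i = (if i \<in> S then bump_at r (y $ i) else bump_at s (x $ i))" for S i
  define I where "I S = (LINT z|lborel. u z * (\<Prod>i\<in>UNIV. f S i (z $ i)))" for S :: "'n set"
  have r2: "1 / r \<le> 2 / s" "1 / s \<le> 2 / s" using s r by (auto simp: field_simps)
  have b0: "bump_at r (y $ i) t = 0" if "\<bar>t - x $ i\<bar> \<ge> 3 * s" for i t
    using that xy[of i] s by (intro b(3)) linarith
  have step: "\<bar>I S - I (insert j S)\<bar> \<le> ?D" if "j \<notin> S" for S j
  proof -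
    have eq: "f (insert j S) = (f S)(j := bump_at r (y $ j))"
      by (auto simp: f_def fun_eq_iff)
    have fj: "f S j = bump_at s (x $ j)" using that by (simp add: f_def)
    show ?thesis
      unfolding I_def eq
    proof (rule avg_replace_factor[OF p G u s(1)])
      show "smooth1 (f S i)" for i using a(1) b(1) by (simp add: f_def)
      show "\<bar>f S i t\<bar> \<le> 2 / s" for i t
        using a(2)[of "x $ i" t] b(2)[of "y $ i" t] r2 by (auto simp: f_def)
      show "f S i t = 0" if "\<bar>t - x $ i\<bar> \<ge> 3 * s" for i t
        using that b0[OF that] a(3)[where c="x $ i" and t=t] s by (auto simp: f_def)
    qed (use a b b0 fj in auto)
  qed
  have "\<bar>I {} - I S\<bar> \<le> real (card S) * ?D" if "finite S" for S
    using that
  proof (induction S rule: finite_induct)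
    case (insert j S)
    have "\<bar>I {} - I (insert j S)\<bar> \<le> \<bar>I {} - I S\<bar> + \<bar>I S - I (insert j S)\<bar>" by linarith
    also have "\<dots> \<le> real (card S) * ?D + ?D" using insert.IH step[OF insert(2)] by linarith
    also have "\<dots> = real (card (insert j S)) * ?D" using insert by (simp add: distrib_right)
    finally show ?case .
  qed simp
  from this[of UNIV] show ?thesis by (simp add: I_def f_def bump_avg_def mult_ac)
qed

text \<open>Substituting \<open>x + s m *\<^sub>R z\<close> for the variable of integration frees
  the kernel of the scale. Continuity of \<open>u\<close> then gives the limit, \<open>u x\<close>
  times the mass of the kernel.\<close>

lemma bump_avg_tendsto:
  fixes u :: "real^'n \<Rightarrow> real"
  assumes u: "continuous_on UNIV u" and s: "\<And>m. s m > 0" "s \<longlonglongrightarrow> 0"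
  shows "(\<lambda>m. bump_avg u x (s m)) \<longlonglongrightarrow> u x * bump_avg (\<lambda>_. 1) (0 :: real^'n) 1"
proof -
  let ?\<Phi> = "\<lambda>z :: real^'n. \<Prod>i\<in>UNIV. bump_at 1 0 (z $ i)"
  have sm: "smoothn ?\<Phi>" by (rule smoothn_prod_nth[OF bump_at_props(1)]) simp
  have [measurable]: "?\<Phi> \<in> borel_measurable borel" "u \<in> borel_measurable borel"
    using sm u by (auto intro: borel_measurable_continuous_onI)
  have z0: "?\<Phi> z = 0" if "norm z > real CARD('n)" for z
  proof (rule ccontr)
    assume nz: "?\<Phi> z \<noteq> 0"
    have "\<bar>z $ i\<bar> \<le> 1" for i
    proof -
      have "bump_at 1 0 (z $ i) \<noteq> 0" using nz by auto
      then show ?thesis using bump_at_props(3)[of 1 "z $ i" 0] by force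
    qed
    then have "(\<Sum>i\<in>UNIV. \<bar>z $ i\<bar>) \<le> (\<Sum>i\<in>(UNIV::'n set). 1)" by (intro sum_mono) auto
    with norm_le_l1_cart[of z] that show False by simp
  qed
  have \<Phi>1: "\<bar>?\<Phi> z\<bar> \<le> 1" for z
    unfolding abs_prod using bump_at_props(2)[of 1] by (intro prod_le_1) auto
  have avg: "bump_avg u x (s m) = (LINT z|lborel. u (x + s m *\<^sub>R z) * ?\<Phi> z)" for m
  proof -
    have sms: "smoothn (\<lambda>y :: real^'n. \<Prod>i\<in>UNIV. bump_at (s m) (x $ i) (y $ i))"
      by (rule smoothn_prod_nth[OF bump_at_props(1)[OF s(1)]])
    have "bump_avg u x (s m) = \<bar>s m\<bar> ^ CARD('n) * (LINT z|lborel. u (x + s m *\<^sub>R z) *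
        (\<Prod>i\<in>UNIV. bump_at (s m) (x $ i) ((x + s m *\<^sub>R z) $ i)))"
      unfolding bump_avg_def using s(1)[of m] sms
      by (subst lborel_affine_integral[of _ "s m" x]) auto
    also have "\<dots> = (LINT z|lborel. u (x + s m *\<^sub>R z) * (\<bar>s m\<bar> ^ CARD('n) *
        (\<Prod>i\<in>UNIV. bump_at (s m) (x $ i) ((x + s m *\<^sub>R z) $ i))))"
      by (subst integral_mult_right_zero[symmetric]) (simp add: mult_ac)
    also have "(\<lambda>z. u (x + s m *\<^sub>R z) * (\<bar>s m\<bar> ^ CARD('n) *
        (\<Prod>i\<in>UNIV. bump_at (s m) (x $ i) ((x + s m *\<^sub>R z) $ i)))) = (\<lambda>z. u (x + s m *\<^sub>R z) * ?\<Phi> z)"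
    proof
      fix z :: "real^'n"
      have "s m * bump_at (s m) (x $ i) (x $ i + s m * z $ i) = bump_at 1 0 (z $ i)" for i
        using s(1)[of m] by (simp add: bump_at_def add_divide_distrib)
      then have "(\<Prod>i\<in>UNIV. s m * bump_at (s m) (x $ i) (x $ i + s m * z $ i)) = ?\<Phi> z" by simp
      then show "u (x + s m *\<^sub>R z) * (\<bar>s m\<bar> ^ CARD('n) *
        (\<Prod>i\<in>UNIV. bump_at (s m) (x $ i) ((x + s m *\<^sub>R z) $ i))) = u (x + s m *\<^sub>R z) * ?\<Phi> z"
        using s(1)[of m] by (simp add: prod.distrib)
    qed
    finally show ?thesis .
  qed
  obtain S where S: "\<And>m. \<bar>s m\<bar> \<le> S" "S > 0"
    using convergent_imp_Bseq[of s] s(2) by (auto simp: convergent_def Bseq_def)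
  have "compact (u ` cball x (S * real CARD('n)))"
    by (intro compact_continuous_image continuous_on_subset[OF u] compact_cball) auto
  then obtain B where B: "\<And>y. y \<in> cball x (S * real CARD('n)) \<Longrightarrow> \<bar>u y\<bar> \<le> B" "B > 0"
    using compact_imp_bounded bounded_pos by (metis (no_types, opaque_lifting) image_eqI real_norm_def)
  have "(\<lambda>m. LINT z|lborel. u (x + s m *\<^sub>R z) * ?\<Phi> z) \<longlonglongrightarrow> (LINT z|lborel. u x * ?\<Phi> z)"
  proof (rule integral_dominated_convergence)
    show "integrable lborel (\<lambda>z. B * indicator (cball 0 (real CARD('n))) z :: real)"
      by (intro integrable_mult_right integrable_real_indicator emeasure_lborel_cball_finite) simp
    show "AE z in lborel. (\<lambda>m. u (x + s m *\<^sub>R z) * ?\<Phi> z) \<longlonglongrightarrow> u x * ?\<Phi> z"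
    proof (rule AE_I2)
      fix z
      have "(\<lambda>m. x + s m *\<^sub>R z) \<longlonglongrightarrow> x + 0 *\<^sub>R z" by (intro tendsto_intros s)
      then have "(\<lambda>m. u (x + s m *\<^sub>R z)) \<longlonglongrightarrow> u (x + 0 *\<^sub>R z)"
        by (rule continuous_on_tendsto_compose[OF u]) auto
      then show "(\<lambda>m. u (x + s m *\<^sub>R z) * ?\<Phi> z) \<longlonglongrightarrow> u x * ?\<Phi> z" by (intro tendsto_mult) auto
    qed
    have "\<bar>u (x + s m *\<^sub>R z) * ?\<Phi> z\<bar> \<le> B * indicator (cball 0 (real CARD('n))) z" for m z
    proof (cases "norm z \<le> real CARD('n)")
      case True
      have "\<bar>s m\<bar> * norm z \<le> S * real CARD('n)" using True S by (intro mult_mono) auto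
      then have "\<bar>u (x + s m *\<^sub>R z)\<bar> \<le> B" by (intro B) (simp add: dist_norm)
      then have "\<bar>u (x + s m *\<^sub>R z)\<bar> * \<bar>?\<Phi> z\<bar> \<le> B * 1" using \<Phi>1 B(2) by (intro mult_mono) auto
      then show ?thesis using True by (simp add: abs_mult)
    next
      case False
      then show ?thesis using z0[of z] by simp
    qed
    then show "AE z in lborel. norm (u (x + s m *\<^sub>R z) * ?\<Phi> z) \<le> B * indicator (cball 0 (real CARD('n))) z" for m
      by simp
  qed auto
  then show ?thesis by (simp only: avg) (simp add: bump_avg_def)
qed

text \<open>Morrey's estimate divides by this mass. The kernel is positive on an open box, which is
  not a null set.\<close>

lemma bump_avg_1_pos: "bump_avg (\<lambda>_. 1) (0 :: real^'n) 1 > 0"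
proof -
  let ?\<Phi> = "\<lambda>z :: real^'n. \<Prod>i\<in>UNIV. bump_at 1 0 (z $ i)"
  have b: "bump_at 1 0 t = bump 1 (-1) 1 t" for t by (simp add: bump_at_def)
  have tf: "test_function ?\<Phi>"
  proof (rule test_function_prod_nth[of _ 1])
    show "smooth1 (bump_at 1 0)" by (rule bump_at_props) simp
    show "\<bar>t\<bar> \<le> 1" if "bump_at 1 0 t \<noteq> 0" for t
      using that bump_at_props(3)[of 1 t 0] by force
  qed
  have int: "integrable lborel ?\<Phi>" by (rule test_function_integrable[OF tf])
  have nn: "0 \<le> ?\<Phi> z" for z unfolding b by (intro prod_nonneg) (simp add: bump_bounds)
  have "bump_avg (\<lambda>_. 1) (0 :: real^'n) 1 = (LINT z|lborel. ?\<Phi> z)" by (simp add: bump_avg_def)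
  moreover have "(LINT z|lborel. ?\<Phi> z) \<ge> 0" using nn by (intro integral_nonneg_AE AE_I2) auto
  moreover have "(LINT z|lborel. ?\<Phi> z) \<noteq> 0"
  proof
    assume "(LINT z|lborel. ?\<Phi> z) = 0"
    then have "AE z in lborel. ?\<Phi> z = 0" using integral_nonneg_eq_0_iff_AE[OF int] nn by simp
    then have "AE z in lborel. z \<notin> (box (\<chi> i. -1) (\<chi> i. 1) :: (real^'n) set)"
    proof eventually_elim
      case (elim z)
      show ?case
      proof
        assume "z \<in> box (\<chi> i. -1) (\<chi> i. 1)"
        then have "bump_at 1 0 (z $ i) > 0" for i unfolding b by (intro bump_pos) (auto simp: mem_box_cart)
        then have "?\<Phi> z > 0" by (intro prod_pos) auto
        with elim show False by linarith
      qed
    qed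
    then have "emeasure lborel (box (\<chi> i. -1) (\<chi> i. 1) :: (real^'n) set) = 0"
      by (subst (asm) AE_iff_measurable[OF _ refl]) auto
    then have "negligible (box (\<chi> i. -1) (\<chi> i. 1) :: (real^'n) set)"
      unfolding negligible_iff_null_sets by (intro null_sets_completionI) auto
    moreover have "0 \<in> (box (\<chi> i. -1) (\<chi> i. 1) :: (real^'n) set)" by (simp add: mem_box_cart)
    ultimately show False using open_not_negligible[OF open_box] by blast
  qed
  ultimately show ?thesis by linarith
qed

text \<open>When the scale is halved, the average at a point changes by at most a multiple of the
  scale to the power \<open>1 - n / p\<close>. Along \<open>r / 2 ^ m\<close> these changes form a
  geometric series, so the average at scale \<open>r\<close> is close to a multiple of the value of
  \<open>u\<close>. With \<open>r = dist x y\<close>, one further step changes the centre. The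
  constant does not depend on \<open>u\<close>, which completeness requires.\<close>

lemma morrey_estimate:
  assumes p: "real CARD('n) < p"
  obtains K where "K \<ge> 0" "\<And>(u :: real^'n \<Rightarrow> real) x y. u \<in> D1p p \<Longrightarrow>
    \<bar>u x - u y\<bar> \<le> K * dist x y powr (1 - real CARD('n) / p) * Lp_norm p (weak_grad u)"
proof -
  let ?\<alpha> = "1 - real CARD('n) / p"
  have \<alpha>: "?\<alpha> > 0" using p by simp
  define D where "D = real CARD('n) * (8 * 2 ^ CARD('n) * 6 ^ CARD('n))"
  have D0: "D \<ge> 0" by (simp add: D_def)
  define q where "q = (1/2::real) powr ?\<alpha>"
  have q: "0 < q" "q < 1" using \<alpha> powr_less_mono'[of "1/2" 0 ?\<alpha>] by (auto simp: q_def)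
  define \<kappa> where "\<kappa> = bump_avg (\<lambda>_. 1) (0 :: real^'n) 1"
  have \<kappa>: "\<kappa> > 0" unfolding \<kappa>_def by (rule bump_avg_1_pos)
  show ?thesis
  \<comment> \<open>A geometric series of ratio \<open>q\<close> at each of the two points, and one
    change of centre; \<open>\<kappa>\<close> is the mass of the kernel.\<close>
  proof (rule that[of "(2 * (D / (1 - q)) + D) / \<kappa>"])
    show "(2 * (D / (1 - q)) + D) / \<kappa> \<ge> 0" using D0 q \<kappa> by simp
    fix u :: "real^'n \<Rightarrow> real" and x y :: "real^'n"
    assume u: "u \<in> D1p p"
    let ?N = "Lp_norm p (weak_grad u)"
    have N0: "?N \<ge> 0" by (rule Lp_norm_nonneg)
    have wg: "has_weak_grad u (weak_grad u)" "Lp_field p (weak_grad u)" using u D1p_iff[OF p] by auto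
    note cont = D1p_continuous[OF p u]
    have diff: "\<bar>bump_avg u x s - bump_avg u y r\<bar> \<le> D * s powr ?\<alpha> * ?N"
      if "s > 0" "s / 2 \<le> r" "r \<le> s" "\<And>i. \<bar>x $ i - y $ i\<bar> \<le> s" for s r x y
      unfolding D_def by (rule bump_avg_diff[OF p wg cont(2) that])
    show "\<bar>u x - u y\<bar> \<le> (2 * (D / (1 - q)) + D) / \<kappa> * dist x y powr ?\<alpha> * ?N"
    proof (cases "x = y")
      case False
      define r where "r = dist x y"
      have r: "r > 0" using False by (simp add: r_def)
      have near: "\<bar>u x * \<kappa> - bump_avg u x r\<bar> \<le> D / (1 - q) * r powr ?\<alpha> * ?N" for x
      proof -
        define s where "s m = r * (1/2) ^ m" for m :: nat
        have s: "s m > 0" for m using r by (simp add: s_def)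
        have "s \<longlonglongrightarrow> r * 0" unfolding s_def by (intro tendsto_mult tendsto_const LIMSEQ_power_zero) auto
        then have s0: "s \<longlonglongrightarrow> 0" by simp
        have bd: "\<bar>bump_avg u x (s m) - bump_avg u x r\<bar> \<le> D * r powr ?\<alpha> * ?N * (\<Sum>k<m. q ^ k)" for m
        proof (induction m)
          case 0
          then show ?case by (simp add: s_def)
        next
          case (Suc m)
          have "\<bar>bump_avg u x (s m) - bump_avg u x (s (Suc m))\<bar> \<le> D * s m powr ?\<alpha> * ?N"
            using s[of m] by (intro diff) (auto simp: s_def)
          also have "s m powr ?\<alpha> = r powr ?\<alpha> * q ^ m"
          proof -
            have "((1/2::real) ^ m) powr ?\<alpha> = q ^ m" by (induction m) (simp_all only: power_0 power_Suc powr_mult q_def powr_one_eq_one)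
            then show ?thesis by (simp add: s_def powr_mult)
          qed
          finally show ?case using Suc.IH by (simp add: algebra_simps)
        qed
        have geo: "(\<Sum>k<m. q ^ k) \<le> 1 / (1 - q)" for m
          using sum_le_suminf[of "\<lambda>k. q ^ k" "{..<m}"] q summable_geometric[of q] suminf_geometric[of q] by simp
        have "\<bar>bump_avg u x (s m) - bump_avg u x r\<bar> \<le> D / (1 - q) * r powr ?\<alpha> * ?N" for m
        proof -
          have "D * r powr ?\<alpha> * ?N * (\<Sum>k<m. q ^ k) \<le> D * r powr ?\<alpha> * ?N * (1 / (1 - q))"
            using D0 N0 by (intro mult_left_mono geo) auto
          then show ?thesis using bd[of m] by (simp add: mult_ac)
        qed
        moreover have "(\<lambda>m. \<bar>bump_avg u x (s m) - bump_avg u x r\<bar>) \<longlonglongrightarrow> \<bar>u x * \<kappa> - bump_avg u x r\<bar>"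
          unfolding \<kappa>_def by (intro tendsto_intros bump_avg_tendsto cont(1) s s0)
        ultimately show ?thesis by (intro LIMSEQ_le_const2) auto
      qed
      have "\<bar>bump_avg u x r - bump_avg u y r\<bar> \<le> D * r powr ?\<alpha> * ?N"
      proof (rule diff)
        show "\<bar>x $ i - y $ i\<bar> \<le> r" for i
          using component_le_norm_cart[of "x - y" i] by (simp add: r_def dist_norm)
      qed (use r in auto)
      then have "\<bar>u x * \<kappa> - u y * \<kappa>\<bar> \<le> 2 * (D / (1 - q) * r powr ?\<alpha> * ?N) + D * r powr ?\<alpha> * ?N"
        using near[of x] near[of y] by linarith
      also have "\<dots> = (2 * (D / (1 - q)) + D) * r powr ?\<alpha> * ?N" by (simp only: distrib_right mult.assoc)
      also have "u x * \<kappa> - u y * \<kappa> = \<kappa> * (u x - u y)" by (simp add: algebra_simps)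
      finally have "\<kappa> * \<bar>u x - u y\<bar> \<le> (2 * (D / (1 - q)) + D) * r powr ?\<alpha> * ?N"
        using \<kappa> by (simp only: abs_mult abs_of_pos)
      then show ?thesis using \<kappa> by (simp add: r_def field_simps)
    qed simp
  qed
qed

section \<open>Similarities\<close>

lemma nn_integral_translate:
  fixes f :: "'a::euclidean_space \<Rightarrow> ennreal"
  assumes [measurable]: "f \<in> borel_measurable borel"
  shows "(\<integral>\<^sup>+x. f (c + x) \<partial>lborel) = (\<integral>\<^sup>+x. f x \<partial>lborel)"
proof -
  have "(\<integral>\<^sup>+x. f x \<partial>lborel) = (\<integral>\<^sup>+x. f x \<partial>distr lborel borel ((+) c))"
    by (simp add: lborel_distr_plus)
  also have "\<dots> = (\<integral>\<^sup>+x. f (c + x) \<partial>lborel)" by (subst nn_integral_distr) auto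
  finally show ?thesis by simp
qed

text \<open>
  Uniqueness of translation-invariant measures: the double integral of
  \<open>indicator A (T x) * indicator B (y - T x)\<close>, for a ball \<open>B\<close>, is computed in both orders.
\<close>

lemma lborel_distr_orthogonal:
  fixes T :: "'a::euclidean_space \<Rightarrow> 'a"
  assumes T: "orthogonal_transformation T"
  shows "distr lborel borel T = lborel"
proof (rule measure_eqI)
  interpret T: linear T using T by (rule orthogonal_transformation_linear)
  have Tm [measurable]: "T \<in> borel_measurable borel"
    using T.linear_axioms by (intro borel_measurable_continuous_onI linear_continuous_on linear_conv_bounded_linear[THEN iffD1])
  fix A assume "A \<in> sets (distr lborel borel T)"
  then have A [measurable]: "A \<in> sets borel" by simp
  let ?B = "ball (0::'a) 1"
  let ?a = "\<lambda>x. indicator A x :: ennreal" and ?b = "\<lambda>x. indicator ?B x :: ennreal"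
  have [measurable]: "?B \<in> sets borel" by simp
  have Tn: "norm (T x) = norm x" for x using T by (rule orthogonal_transformation_norm)
  have bT: "?b (- T x) = ?b x" for x by (simp add: indicator_def Tn)
  have "emeasure (distr lborel borel T) A * emeasure lborel ?B = (\<integral>\<^sup>+x. ?a (T x) \<partial>lborel) * emeasure lborel ?B"
  proof -
    have "emeasure (distr lborel borel T) A = (\<integral>\<^sup>+x. ?a x \<partial>distr lborel borel T)" by simp
    also have "\<dots> = (\<integral>\<^sup>+x. ?a (T x) \<partial>lborel)" by (subst nn_integral_distr) auto
    finally show ?thesis by simp
  qed
  also have "\<dots> = (\<integral>\<^sup>+x. (\<integral>\<^sup>+y. ?a (T x) * ?b y \<partial>lborel) \<partial>lborel)"
  proof -
    have "(\<integral>\<^sup>+y. ?a (T x) * ?b y \<partial>lborel) = ?a (T x) * emeasure lborel ?B" for x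
      by (subst nn_integral_cmult) (auto intro!: borel_measurable_indicator)
    then show ?thesis by (simp only:) (subst nn_integral_multc, auto)
  qed
  also have "\<dots> = (\<integral>\<^sup>+x. (\<integral>\<^sup>+y. ?a (T x) * ?b (- T x + y) \<partial>lborel) \<partial>lborel)"
    by (rule nn_integral_cong, rule nn_integral_translate[symmetric]) measurable
  also have "\<dots> = (\<integral>\<^sup>+y. (\<integral>\<^sup>+x. ?a (T x) * ?b (- T x + y) \<partial>lborel) \<partial>lborel)"
    by (rule lborel_pair.Fubini') measurable
  also have "\<dots> = (\<integral>\<^sup>+y. (\<integral>\<^sup>+x. ?a (T x + y) * ?b (- T x) \<partial>lborel) \<partial>lborel)"
  proof (rule nn_integral_cong)
    fix y :: 'a
    \<comment> \<open>Translating by a preimage of \<open>y\<close> moves \<open>y\<close> from the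
      indicator of the ball to that of \<open>A\<close>, where integration over \<open>y\<close>
      absorbs \<open>T x\<close>.\<close>
    obtain w where w: "T w = y" using orthogonal_transformation_surj[OF T] by (metis surjD)
    have "(\<integral>\<^sup>+x. ?a (T x) * ?b (- T x + y) \<partial>lborel) = (\<integral>\<^sup>+x. ?a (T (w + x)) * ?b (- T (w + x) + y) \<partial>lborel)"
      by (rule nn_integral_translate[symmetric]) measurable
    then show "(\<integral>\<^sup>+x. ?a (T x) * ?b (- T x + y) \<partial>lborel) = (\<integral>\<^sup>+x. ?a (T x + y) * ?b (- T x) \<partial>lborel)"
      by (simp add: T.add w add.commute)
  qed
  also have "\<dots> = (\<integral>\<^sup>+x. (\<integral>\<^sup>+y. ?a (T x + y) * ?b (- T x) \<partial>lborel) \<partial>lborel)"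
    by (rule lborel_pair.Fubini') measurable
  also have "\<dots> = (\<integral>\<^sup>+x. (\<integral>\<^sup>+y. ?a y * ?b (- T x) \<partial>lborel) \<partial>lborel)"
    by (rule nn_integral_cong, rule nn_integral_translate) measurable
  also have "\<dots> = emeasure lborel A * emeasure lborel ?B"
    by (simp add: bT nn_integral_multc nn_integral_cmult)
  finally have eq: "emeasure (distr lborel borel T) A * emeasure lborel ?B = emeasure lborel A * emeasure lborel ?B" .
  have "emeasure lborel ?B \<noteq> 0"
  proof
    assume "emeasure lborel ?B = 0"
    then have "negligible ?B"
      unfolding negligible_iff_null_sets by (intro null_sets_completionI) auto
    then show False using open_not_negligible[OF open_ball[of "0::'a" 1]] by simp
  qed
  moreover have "emeasure lborel ?B \<noteq> \<infinity>" using emeasure_bounded_finite[OF bounded_ball, of "0::'a" 1] by auto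
  ultimately show "emeasure (distr lborel borel T) A = emeasure lborel A"
    using eq by (metis infinity_ennreal_def mult_divide_eq_ennreal)
qed simp

section \<open>Composition with a similarity\<close>

locale similarity =
  fixes r :: real and T :: "real^'n \<Rightarrow> real^'n" and z :: "real^'n"
  assumes r: "r > 0" and T: "orthogonal_transformation T"
begin

definition S :: "real^'n \<Rightarrow> real^'n" where "S y = r *\<^sub>R T y + z"

lemma bounded_linear_T: "bounded_linear T"
  using orthogonal_transformation_linear[OF T] by (simp add: linear_conv_bounded_linear)

lemma has_derivative_S: "(S has_derivative (\<lambda>v. r *\<^sub>R T v)) (at x)"
proof -
  have "(T has_derivative T) (at x)" by (rule bounded_linear_imp_has_derivative[OF bounded_linear_T])
  then have "((\<lambda>y. r *\<^sub>R T y + z) has_derivative (\<lambda>v. r *\<^sub>R T v + 0)) (at x)"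
    by (intro has_derivative_add has_derivative_scaleR_right has_derivative_const)
  then show ?thesis by (simp add: S_def[abs_def])
qed

lemma continuous_S: "continuous_on A S"
  by (rule continuous_at_imp_continuous_on) (use has_derivative_S has_derivative_continuous in blast)

lemma measurable_S [measurable]: "S \<in> borel_measurable borel"
  by (rule borel_measurable_continuous_onI[OF continuous_S])

lemma dist_S: "dist (S x) (S y) = r * dist x y"
proof -
  have "S x - S y = r *\<^sub>R T (x - y)"
    using orthogonal_transformation_linear[OF T] by (simp add: S_def linear_diff scaleR_diff_right)
  then show ?thesis using r by (simp add: dist_norm orthogonal_transformation_norm[OF T])
qed

lemma lborel_S: "lborel = density (distr lborel borel S) (\<lambda>_. r ^ CARD('n))"
proof -
  have [measurable]: "T \<in> borel_measurable borel"
    using bounded_linear_T by (intro borel_measurable_continuous_onI linear_continuous_on)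
  have "distr lborel borel S = distr (distr lborel borel T) borel (\<lambda>y. z + r *\<^sub>R y)"
    by (subst distr_distr) (auto simp: S_def[abs_def] comp_def add.commute)
  also have "\<dots> = distr lborel borel (\<lambda>y. z + r *\<^sub>R y)" by (simp only: lborel_distr_orthogonal[OF T])
  finally show ?thesis using lborel_affine[of r z] r by simp
qed

lemma integrable_S:
  fixes f :: "real^'n \<Rightarrow> real"
  assumes f: "integrable lborel f"
  shows "integrable lborel (\<lambda>x. f (S x))"
proof -
  have [measurable]: "f \<in> borel_measurable borel" using borel_measurable_integrable[OF f] by simp
  have "integrable (density (distr lborel borel S) (\<lambda>_. r ^ CARD('n))) f" using f lborel_S by simp
  then have "integrable (distr lborel borel S) (\<lambda>x. r ^ CARD('n) *\<^sub>R f x)"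
    using r by (subst (asm) integrable_density) auto
  then have "integrable lborel (\<lambda>x. r ^ CARD('n) *\<^sub>R f (S x))" by (subst (asm) integrable_distr_eq) auto
  then show ?thesis using r by simp
qed

lemma integral_S:
  fixes f :: "real^'n \<Rightarrow> real"
  assumes [measurable]: "f \<in> borel_measurable borel"
  shows "(LINT y|lborel. f y) = r ^ CARD('n) * (LINT x|lborel. f (S x))"
proof -
  have "(LINT y|lborel. f y) = (LINT y|density (distr lborel borel S) (\<lambda>_. r ^ CARD('n)). f y)"
    using lborel_S by simp
  also have "\<dots> = (LINT y|distr lborel borel S. r ^ CARD('n) *\<^sub>R f y)"
    using r by (intro integral_density) auto
  also have "\<dots> = (LINT x|lborel. r ^ CARD('n) *\<^sub>R f (S x))" by (intro integral_distr) auto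
  finally show ?thesis by simp
qed

text \<open>The inverse of \<open>S\<close>, written as a similarity of ratio \<open>1 / r\<close>
  so that the facts about \<open>S\<close> apply to it as well.\<close>

definition R :: "real^'n \<Rightarrow> real^'n" where "R y = (1 / r) *\<^sub>R inv T y + (- (1 / r) *\<^sub>R inv T z)"

lemma orthogonal_inv_T: "orthogonal_transformation (inv T)"
  using T by (rule orthogonal_transformation_inv)

lemma R_S: "R (S x) = x" and S_R: "S (R y) = y"
proof -
  interpret I: linear "inv T" using orthogonal_inv_T by (rule orthogonal_transformation_linear)
  interpret T: linear T using T by (rule orthogonal_transformation_linear)
  have i: "inv T (T x) = x" "T (inv T x) = x" for x
    using orthogonal_transformation_bij[OF T] by (auto simp: bij_def surj_f_inv_f)
  show "R (S x) = x" using r by (simp add: R_def S_def I.add I.scale i scaleR_add_right)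
  show "S (R y) = y" using r by (simp add: R_def S_def T.add T.diff T.scale i scaleR_add_right scaleR_diff_right)
qed

lemma similarity_inverse: "similarity (1 / r) (inv T)"
  using r orthogonal_inv_T by (simp add: similarity_def)

lemma R_eq: "R = similarity.S (1 / r) (inv T) (- (1 / r) *\<^sub>R inv T z)"
  by (simp add: fun_eq_iff R_def similarity.S_def[OF similarity_inverse])

lemma measurable_R [measurable]: "R \<in> borel_measurable borel"
  unfolding R_eq by (rule similarity.measurable_S[OF similarity_inverse])

lemma test_function_R:
  assumes \<phi>: "test_function \<phi>" shows "test_function (\<lambda>y. \<phi> (R y))"
proof -
  obtain B where B: "\<And>x. \<phi> x \<noteq> 0 \<Longrightarrow> norm x \<le> B" and s: "smoothn \<phi>"
    using \<phi> by (auto simp: test_function_iff)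
  have "smoothn (\<lambda>y. \<phi> (R y))"
    unfolding R_eq by (rule smoothn_comp_affine[OF s similarity.has_derivative_S[OF similarity_inverse]])
  moreover have "norm y \<le> r * B + norm (S 0)" if "\<phi> (R y) \<noteq> 0" for y
  proof -
    have "norm y = norm (S (R y))" by (simp add: S_R)
    also have "\<dots> \<le> dist (S (R y)) (S 0) + norm (S 0)" by (metis add.commute dist_norm norm_triangle_sub)
    also have "dist (S (R y)) (S 0) \<le> r * B" using B[OF that] r by (simp add: dist_S)
    finally show ?thesis by simp
  qed
  ultimately show ?thesis unfolding test_function_iff by blast
qed

text \<open>The chain rule multiplies the gradient by the transpose of the derivative
  \<open>r *\<^sub>R T\<close>; for orthogonal \<open>T\<close> the transpose is the
  inverse.\<close>

definition grad_S :: "(real^'n \<Rightarrow> real^'n) \<Rightarrow> real^'n \<Rightarrow> real^'n" where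
  "grad_S G x = r *\<^sub>R inv T (G (S x))"

lemma grad_S_nth: "grad_S G x $ i = (\<Sum>j\<in>UNIV. (r *\<^sub>R T (axis i 1)) $ j * G (S x) $ j)"
proof -
  have "T (inv T v) = v" for v using orthogonal_transformation_surj[OF T] by (simp add: surj_f_inv_f)
  then have "T (axis i 1) \<bullet> G (S x) = T (axis i 1) \<bullet> T (inv T (G (S x)))" by simp
  also have "\<dots> = axis i 1 \<bullet> inv T (G (S x))" using T by (simp add: orthogonal_transformation_def)
  also have "\<dots> = inv T (G (S x)) $ i" by (simp add: inner_axis')
  finally have "inv T (G (S x)) $ i = (\<Sum>j\<in>UNIV. T (axis i 1) $ j * G (S x) $ j)" by (simp add: inner_vec_def)
  then show ?thesis by (simp add: grad_S_def sum_distrib_left mult.assoc)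
qed

text \<open>The chain rule contributes a factor \<open>r\<close> to the norm, the change of
  variables a factor \<open>r powr (- n / p)\<close>.\<close>

lemma Lp_grad_S:
  assumes G: "Lp_field p G" and p: "p > 0"
  shows "Lp_field p (grad_S G)" "Lp_norm p (grad_S G) = r powr (1 - real CARD('n) / p) * Lp_norm p G"
proof -
  have [measurable]: "G \<in> borel_measurable borel" using G by (simp add: Lp_field_def)
  have n: "norm (grad_S G x) = r * norm (G (S x))" for x
    using r by (simp add: grad_S_def orthogonal_transformation_norm[OF orthogonal_inv_T])
  have [measurable]: "inv T \<in> borel_measurable borel"
    using orthogonal_transformation_linear[OF orthogonal_inv_T]
    by (intro borel_measurable_continuous_onI linear_continuous_on) (simp add: linear_conv_bounded_linear)
  have "integrable lborel (\<lambda>x. norm (G x) powr p)" using G by (simp add: Lp_field_def)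
  from integrable_S[OF this] show "Lp_field p (grad_S G)"
    unfolding Lp_field_def n by (simp add: powr_mult grad_S_def[abs_def])
  have "(LINT x|lborel. norm (G (S x)) powr p) = r powr (- real CARD('n)) * (LINT x|lborel. norm (G x) powr p)"
    using r by (simp add: integral_S[of "\<lambda>x. norm (G x) powr p"] powr_minus powr_realpow)
  then have "(LINT x|lborel. norm (grad_S G x) powr p) = r powr p * r powr (- real CARD('n)) * (LINT x|lborel. norm (G x) powr p)"
    by (simp add: n powr_mult)
  also have "r powr p * r powr (- real CARD('n)) = r powr (p - real CARD('n))"
    by (simp flip: powr_add)
  finally show "Lp_norm p (grad_S G) = r powr (1 - real CARD('n) / p) * Lp_norm p G"
    using p by (simp add: Lp_norm_def powr_mult powr_powr diff_divide_distrib)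
qed

text \<open>A test function \<open>\<phi>\<close> is written as \<open>\<psi>\<close> composed with
  \<open>S\<close>. The chain rule for \<open>\<phi>\<close> and a change of variables then reduce
  the claim to the weak formulation for \<open>u\<close> and \<open>\<psi>\<close>; the Jacobian
  factor cancels.\<close>

lemma has_weak_grad_S:
  assumes G: "has_weak_grad u G" and u: "locally_integrable u" and li: "\<And>i. locally_integrable (\<lambda>x. grad_S G x $ i)"
  shows "has_weak_grad (\<lambda>x. u (S x)) (grad_S G)"
  unfolding has_weak_grad_def is_weak_partial_def
proof (intro allI conjI impI li)
  fix i and \<phi> :: "real^'n \<Rightarrow> real" assume \<phi>: "test_function \<phi>"
  define \<psi> where "\<psi> y = \<phi> (R y)" for y
  have \<psi>: "test_function \<psi>" unfolding \<psi>_def[abs_def] by (rule test_function_R[OF \<phi>])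
  have \<phi>\<psi>: "\<phi> = (\<lambda>x. \<psi> (S x))" by (simp add: \<psi>_def R_S)
  let ?c = "\<lambda>j. (r *\<^sub>R T (axis i 1)) $ j"
  have pd: "partial_deriv i \<phi> x = (\<Sum>j\<in>UNIV. ?c j * partial_deriv j \<psi> (S x))" for x
    unfolding \<phi>\<psi>
    by (rule partial_deriv_eqI[OF partial_deriv_comp_affine[OF smoothn_differentiable[OF test_function_smoothn[OF \<psi>]] has_derivative_S]])
  have gl: "locally_integrable (\<lambda>x. G x $ j)" for j using G by (auto simp: has_weak_grad_def is_weak_partial_def)
  have i1: "integrable lborel (\<lambda>x. u x * partial_deriv j \<psi> x)" for j
    by (intro integrable_mult_test_function u test_function_partial_deriv \<psi>)
  have i2: "integrable lborel (\<lambda>x. G x $ j * \<psi> x)" for j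
    by (intro integrable_mult_test_function gl \<psi>)
  have j: "(LINT x|lborel. u (S x) * partial_deriv j \<psi> (S x)) = - (LINT x|lborel. G (S x) $ j * \<psi> (S x))" for j
  proof -
    have "r ^ CARD('n) * (LINT x|lborel. u (S x) * partial_deriv j \<psi> (S x)) = (LINT x|lborel. u x * partial_deriv j \<psi> x)"
      using borel_measurable_integrable[OF i1[of j]] by (subst integral_S[of "\<lambda>x. u x * partial_deriv j \<psi> x"]) auto
    also have "\<dots> = - (LINT x|lborel. G x $ j * \<psi> x)"
      using G \<psi> by (simp add: has_weak_grad_def is_weak_partial_def)
    also have "(LINT x|lborel. G x $ j * \<psi> x) = r ^ CARD('n) * (LINT x|lborel. G (S x) $ j * \<psi> (S x))"
      using borel_measurable_integrable[OF i2[of j]] by (subst integral_S[of "\<lambda>x. G x $ j * \<psi> x"]) auto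
    finally have "r ^ CARD('n) * (LINT x|lborel. u (S x) * partial_deriv j \<psi> (S x))
        = r ^ CARD('n) * (- (LINT x|lborel. G (S x) $ j * \<psi> (S x)))" by simp
    then show ?thesis using r by (subst (asm) mult_cancel_left) auto
  qed
  have "(LINT x|lborel. u (S x) * partial_deriv i \<phi> x) = (LINT x|lborel. (\<Sum>j\<in>UNIV. ?c j * (u (S x) * partial_deriv j \<psi> (S x))))"
    by (simp only: pd sum_distrib_left mult.left_commute)
  also have "\<dots> = (\<Sum>j\<in>UNIV. (LINT x|lborel. ?c j * (u (S x) * partial_deriv j \<psi> (S x))))"
    by (intro Bochner_Integration.integral_sum integrable_mult_right integrable_S[OF i1])
  also have "\<dots> = (\<Sum>j\<in>UNIV. - (LINT x|lborel. ?c j * (G (S x) $ j * \<psi> (S x))))"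
    by (simp only: integral_mult_right_zero j mult_minus_right)
  also have "\<dots> = - (LINT x|lborel. (\<Sum>j\<in>UNIV. ?c j * (G (S x) $ j * \<psi> (S x))))"
    unfolding sum_negf
    by (subst Bochner_Integration.integral_sum) (intro integrable_mult_right integrable_S[OF i2], rule refl)
  also have "\<dots> = - (LINT x|lborel. grad_S G x $ i * \<phi> x)"
    by (simp only: grad_S_nth \<phi>\<psi> sum_distrib_right mult.assoc)
  finally show "(LINT x|lborel. u (S x) * partial_deriv i \<phi> x) = - (LINT x|lborel. grad_S G x $ i * \<phi> x)" .
qed

end

lemma Lp_field_locally_integrable:
  fixes G :: "real^'n \<Rightarrow> real^'n"
  assumes p: "p > 1" and G: "Lp_field p G"
  shows "locally_integrable (\<lambda>x. G x $ i)"
proof -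
  have [measurable]: "G \<in> borel_measurable borel" using G by (simp add: Lp_field_def)
  have [measurable]: "(\<lambda>x. G x $ i) \<in> borel_measurable borel"
    by (rule borel_measurable_continuous_on[of "\<lambda>v. v $ i" G]) (auto intro!: continuous_intros)
  have "set_integrable lborel K (\<lambda>x. G x $ i)" if K: "compact K" for K
  proof -
    obtain B where B: "B > 0" "K \<subseteq> cball 0 B"
      using compact_imp_bounded[OF K] by (auto simp: bounded_pos subset_eq)
    let ?B = "cball (0 :: real^'n) B"
    have "measure lborel ?B > 0" using content_cball_pos[OF B(1)] by simp
    then have int: "integrable lborel (\<lambda>x. indicator ?B x * norm (G x))"
      by (intro Lp_field_set_integral(1)[OF G p]) (use emeasure_bounded_finite[OF bounded_cball, of "0 :: real^'n" B] in auto)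
    have "integrable lborel (\<lambda>x. indicator ?B x *\<^sub>R (G x $ i))"
      by (rule Bochner_Integration.integrable_bound[OF int])
         (use component_le_norm_cart in \<open>auto simp: indicator_def\<close>)
    then have "set_integrable lborel ?B (\<lambda>x. G x $ i)" by (simp add: set_integrable_def)
    then show ?thesis
      by (rule set_integrable_subset) (use B K in \<open>auto intro: borel_compact\<close>)
  qed
  then show ?thesis by (simp add: locally_integrable_def)
qed

context similarity
begin

lemma D1p_S:
  fixes u :: "real^'n \<Rightarrow> real"
  assumes p: "real CARD('n) < p" and u: "u \<in> D1p p"
  shows "(\<lambda>x. u (S x)) \<in> D1p p"
    and "Lp_norm p (weak_grad (\<lambda>x. u (S x))) = r powr (1 - real CARD('n) / p) * Lp_norm p (weak_grad u)"
proof -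
  have "CARD('n) \<ge> 1" by (simp add: Suc_leI)
  then have p1: "p > 1" "p > 0" using p by linarith+
  have wg: "has_weak_grad u (weak_grad u)" "Lp_field p (weak_grad u)" using u D1p_iff[OF p] by auto
  note L = Lp_grad_S[OF wg(2) p1(2)]
  have G: "has_weak_grad (\<lambda>x. u (S x)) (grad_S (weak_grad u))"
    by (intro has_weak_grad_S wg D1p_continuous(2)[OF p u] Lp_field_locally_integrable[OF p1(1) L(1)])
  obtain H where H: "\<And>x y. \<bar>u x - u y\<bar> \<le> H * dist x y powr (1 - real CARD('n) / p)"
    using u by (auto simp: D1p_def holder_continuous_def)
  have "holder_continuous (1 - real CARD('n) / p) (\<lambda>x. u (S x))"
    unfolding holder_continuous_def
  proof (intro exI allI)
    fix x y
    show "\<bar>u (S x) - u (S y)\<bar> \<le> (H * r powr (1 - real CARD('n) / p)) * dist x y powr (1 - real CARD('n) / p)"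
      using H[of "S x" "S y"] by (simp add: dist_S powr_mult mult.assoc)
  qed
  from D1pI[OF p this G L(1)] show "(\<lambda>x. u (S x)) \<in> D1p p" .
  show "Lp_norm p (weak_grad (\<lambda>x. u (S x))) = r powr (1 - real CARD('n) / p) * Lp_norm p (weak_grad u)"
    using Lp_norm_weak_grad[OF G] L(2) by simp
qed

end

section \<open>Completeness and the minimization problem\<close>

text \<open>Integration against a test function is continuous in the L^p norm, so the weak
  formulation survives L^p limits of gradients.\<close>

lemma Lp_field_test_integral_le:
  fixes \<phi> :: "real^'n \<Rightarrow> real"
  assumes p: "p > 1" and \<phi>: "test_function \<phi>"
  obtains c where "\<And>F i. Lp_field p F \<Longrightarrow> \<bar>LINT x|lborel. F x $ i * \<phi> x\<bar> \<le> c * Lp_norm p F"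
proof -
  obtain B R where B: "B > 0" "R > 0" "\<And>x. \<bar>\<phi> x\<bar> \<le> B" "\<And>x. norm x > R \<Longrightarrow> \<phi> x = 0"
    using test_function_bounded[OF \<phi>] by metis
  let ?Q = "cball (0 :: real^'n) R"
  have Q: "?Q \<in> sets borel" "emeasure lborel ?Q < \<infinity>" "measure lborel ?Q > 0"
    using emeasure_bounded_finite[OF bounded_cball, of "0 :: real^'n" R] content_cball_pos[OF B(2)] by auto
  show ?thesis
  proof (rule that[of "B * (2 * measure lborel ?Q powr (1 - 1 / p))"])
    fix F :: "real^'n \<Rightarrow> real^'n" and i assume F: "Lp_field p F"
    note hol = Lp_field_set_integral[OF F p Q]
    have "\<bar>LINT x|lborel. F x $ i * \<phi> x\<bar> \<le> (LINT x|lborel. \<bar>F x $ i * \<phi> x\<bar>)"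
      by (rule integral_abs_bound)
    also have "\<dots> \<le> (LINT x|lborel. B * (indicator ?Q x * norm (F x)))"
    proof (rule integral_mono')
      show "integrable lborel (\<lambda>x. B * (indicator ?Q x * norm (F x)))" by (intro integrable_mult_right hol)
      fix x
      have "\<bar>F x $ i\<bar> * \<bar>\<phi> x\<bar> \<le> norm (F x) * B" using B by (intro mult_mono component_le_norm_cart) auto
      then show "\<bar>F x $ i * \<phi> x\<bar> \<le> B * (indicator ?Q x * norm (F x))"
        using B(4)[of x] by (cases "norm x \<le> R") (simp_all add: abs_mult mult.commute)
      show "0 \<le> B * (indicator ?Q x * norm (F x))" using B by simp
    qed
    also have "\<dots> \<le> B * (2 * measure lborel ?Q powr (1 - 1 / p) * Lp_norm p F)"
      unfolding integral_mult_right_zero by (rule mult_left_mono[OF hol(2)]) (use B in simp)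
    finally show "\<bar>LINT x|lborel. F x $ i * \<phi> x\<bar> \<le> B * (2 * measure lborel ?Q powr (1 - 1 / p)) * Lp_norm p F"
      by (simp add: mult.assoc)
  qed
qed

lemma D1p_diff_norm:
  fixes u v :: "real^'n \<Rightarrow> real"
  assumes p: "real CARD('n) < p" and u: "u \<in> D1p p" and v: "v \<in> D1p p"
  shows "(\<lambda>x. u x - v x) \<in> D1p p"
    "Lp_norm p (weak_grad (\<lambda>x. u x - v x)) = Lp_norm p (\<lambda>x. weak_grad u x - weak_grad v x)"
  using D1p_lin[OF p u v, of 1 "-1"] by simp_all

text \<open>Closeness of gradients leaves additive constants free, so each \<open>w k\<close> is
  first normalised to vanish at 0. Morrey's estimate then gives uniform convergence on bounded sets,
  which is enough to pass to the limit against a test function. The last conclusion is lower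
  semicontinuity of the gradient norm.\<close>

lemma D1p_complete:
  fixes w :: "nat \<Rightarrow> real^'n \<Rightarrow> real"
  assumes p: "real CARD('n) < p" and w: "\<And>k. w k \<in> D1p p"
    and cauchy: "\<And>k m. k \<le> m \<Longrightarrow> Lp_norm p (weak_grad (\<lambda>x. w k x - w m x)) \<le> (1/4) ^ k"
  obtains u where "u \<in> D1p p" "\<And>k. Lp_norm p (weak_grad (\<lambda>x. w k x - u x)) \<le> (1/4) ^ k"
    "\<And>b B. (\<And>k. Lp_norm p (weak_grad (w k)) powr p \<le> b k) \<Longrightarrow> b \<longlonglongrightarrow> B \<Longrightarrow> Lp_norm p (weak_grad u) powr p \<le> B"
proof -
  have n1: "CARD('n) \<ge> 1" by (simp add: Suc_leI)
  then have p1: "p > 1" "p \<ge> 1" "p > 0" using p by linarith+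
  let ?\<alpha> = "1 - real CARD('n) / p"
  have \<alpha>: "?\<alpha> > 0" using p by simp
  let ?F = "\<lambda>k. weak_grad (w k)"
  have F: "has_weak_grad (w k) (?F k)" "Lp_field p (?F k)" for k
    using w[of k] D1p_iff[OF p] by auto
  have cF: "Lp_norm p (\<lambda>x. ?F k x - ?F m x) \<le> (1/4) ^ k" if "k \<le> m" for k m
    using cauchy[OF that] D1p_diff_norm(2)[OF p w w] by simp
  obtain G where G: "Lp_field p G" "\<And>k. Lp_norm p (\<lambda>x. ?F k x - G x) \<le> (1/4) ^ k"
    "AE x in lborel. (\<lambda>k. ?F k x) \<longlonglongrightarrow> G x"
    using Lp_complete[OF p1(2) F(2) cF] by blast
  have G0: "(\<lambda>k. Lp_norm p (\<lambda>x. ?F k x - G x)) \<longlonglongrightarrow> 0"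
  proof (rule tendsto_sandwich[of "\<lambda>_. 0"])
    show "(\<lambda>k. (1/4::real) ^ k) \<longlonglongrightarrow> 0" by (rule LIMSEQ_power_zero) simp
  qed (use G(2) in \<open>simp_all add: Lp_norm_nonneg\<close>)
  obtain K where K: "K \<ge> 0" "\<And>(u :: real^'n \<Rightarrow> real) x y. u \<in> D1p p \<Longrightarrow>
    \<bar>u x - u y\<bar> \<le> K * dist x y powr ?\<alpha> * Lp_norm p (weak_grad u)"
    using morrey_estimate[OF p] by blast
  define U where "U k x = w k x - w k 0" for k x
  have dU: "\<bar>U k x - U m x\<bar> \<le> K * norm x powr ?\<alpha> * (1/4) ^ k" if "k \<le> m" for k m x
  proof -
    have "\<bar>U k x - U m x\<bar> = \<bar>(w k x - w m x) - (w k 0 - w m 0)\<bar>" by (simp add: U_def)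
    also have "\<dots> \<le> K * dist x 0 powr ?\<alpha> * Lp_norm p (weak_grad (\<lambda>x. w k x - w m x))"
      using K(2)[OF D1p_diff_norm(1)[OF p w[of k] w[of m]], of x 0] by simp
    also have "\<dots> \<le> K * dist x 0 powr ?\<alpha> * (1/4) ^ k"
      using K(1) by (intro mult_left_mono cauchy that) auto
    finally show ?thesis by simp
  qed
  have pow0: "(\<lambda>k. c * (1/4::real) ^ k) \<longlonglongrightarrow> 0" for c
    using tendsto_mult[OF tendsto_const[of c] LIMSEQ_power_zero[of "1/4::real"]] by simp
  have "convergent (\<lambda>k. U k x)" for x
  proof (rule Cauchy_convergent, rule CauchyI')
    fix e :: real assume "e > 0"
    then have "eventually (\<lambda>k. K * norm x powr ?\<alpha> * (1/4) ^ k < e) sequentially"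
      using order_tendstoD(2)[OF pow0] by blast
    then obtain M where M: "\<And>k. k \<ge> M \<Longrightarrow> K * norm x powr ?\<alpha> * (1/4) ^ k < e"
      by (auto simp: eventually_sequentially)
    show "\<exists>M. \<forall>m\<ge>M. \<forall>n>m. dist (U m x) (U n x) < e"
    proof (intro exI allI impI)
      fix m n assume "M \<le> m" "m < n"
      then show "dist (U m x) (U n x) < e"
        using dU[of m n x] M[of m] by (simp add: dist_real_def)
    qed
  qed
  then have "\<forall>x. \<exists>L. (\<lambda>k. U k x) \<longlonglongrightarrow> L" by (simp add: convergent_def)
  from choice[OF this] obtain u where u: "\<And>x. (\<lambda>k. U k x) \<longlonglongrightarrow> u x" by blast
  have Uu: "\<bar>U k x - u x\<bar> \<le> K * norm x powr ?\<alpha> * (1/4) ^ k" for k x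
  proof (rule LIMSEQ_le_const2)
    show "(\<lambda>m. \<bar>U k x - U m x\<bar>) \<longlonglongrightarrow> \<bar>U k x - u x\<bar>" by (intro tendsto_intros u)
    show "\<exists>N. \<forall>m\<ge>N. \<bar>U k x - U m x\<bar> \<le> K * norm x powr ?\<alpha> * (1/4) ^ k" using dU by blast
  qed
  obtain H where H: "\<And>x y. \<bar>w 0 x - w 0 y\<bar> \<le> H * dist x y powr ?\<alpha>"
    using w[of 0] by (auto simp: D1p_def holder_continuous_def)
  have hol: "holder_continuous ?\<alpha> u"
    unfolding holder_continuous_def
  proof (intro exI allI)
    fix x y
    \<comment> \<open>\<open>H\<close> is a Hoelder constant of \<open>w 0\<close>. The differences
      of \<open>w 0\<close> and \<open>w m\<close> have gradient norm at most 1, hence Hoelder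
      constant \<open>K\<close>.\<close>
    show "\<bar>u x - u y\<bar> \<le> (H + K) * dist x y powr ?\<alpha>"
    proof (rule LIMSEQ_le_const2)
      show "(\<lambda>m. \<bar>U m x - U m y\<bar>) \<longlonglongrightarrow> \<bar>u x - u y\<bar>" by (intro tendsto_intros u)
      have "\<bar>U m x - U m y\<bar> \<le> (H + K) * dist x y powr ?\<alpha>" for m
      proof -
        have "\<bar>(w 0 x - w m x) - (w 0 y - w m y)\<bar> \<le> K * dist x y powr ?\<alpha> * Lp_norm p (weak_grad (\<lambda>x. w 0 x - w m x))"
          using K(2)[OF D1p_diff_norm(1)[OF p w[of 0] w[of m]], of x y] .
        also have "\<dots> \<le> K * dist x y powr ?\<alpha> * (1/4) ^ 0"
          using K(1) by (intro mult_left_mono cauchy) auto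
        finally show ?thesis using H[of x y] by (simp add: U_def distrib_right)
      qed
      then show "\<exists>N. \<forall>m\<ge>N. \<bar>U m x - U m y\<bar> \<le> (H + K) * dist x y powr ?\<alpha>" by blast
    qed
  qed
  have cu: "continuous_on UNIV u" by (rule holder_continuous_continuous_on[OF hol \<alpha>])
  have cU: "continuous_on UNIV (U k)" for k
    unfolding U_def[abs_def] by (intro continuous_intros D1p_continuous[OF p w])
  have gU: "has_weak_grad (U k) (?F k)" for k
    using has_weak_grad_add[OF F(1)[of k] D1p_continuous(2)[OF p w] has_weak_grad_const[of "w k 0"]
        locally_integrable_continuous[OF continuous_on_const], of 1 "-1"]
    by (simp add: U_def[abs_def])
  have gu: "has_weak_grad u G"
    unfolding has_weak_grad_def is_weak_partial_def
  proof (intro allI conjI impI)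
    fix i
    show "locally_integrable (\<lambda>x. G x $ i)" by (rule Lp_field_locally_integrable[OF p1(1) G(1)])
    fix \<phi> :: "real^'n \<Rightarrow> real" assume \<phi>: "test_function \<phi>"
    note d\<phi> = test_function_partial_deriv[OF \<phi>, of i]
    obtain R where R: "R > 0" "\<And>x. norm x > R \<Longrightarrow> partial_deriv i \<phi> x = 0"
      using test_function_bounded[OF d\<phi>] by metis
    have iU: "integrable lborel (\<lambda>x. U k x * partial_deriv i \<phi> x)" for k
      by (intro integrable_mult_test_function locally_integrable_continuous cU d\<phi>)
    have iu: "integrable lborel (\<lambda>x. u x * partial_deriv i \<phi> x)"
      by (intro integrable_mult_test_function locally_integrable_continuous cu d\<phi>)
    have "(\<lambda>k. (LINT x|lborel. U k x * partial_deriv i \<phi> x) - (LINT x|lborel. u x * partial_deriv i \<phi> x)) \<longlonglongrightarrow> 0"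
    proof (rule Lim_null_comparison)
      show "(\<lambda>k. (K * R powr ?\<alpha> * (LINT x|lborel. \<bar>partial_deriv i \<phi> x\<bar>)) * (1/4) ^ k) \<longlonglongrightarrow> 0" by (rule pow0)
      have "\<bar>(LINT x|lborel. U k x * partial_deriv i \<phi> x) - (LINT x|lborel. u x * partial_deriv i \<phi> x)\<bar>
        \<le> (K * R powr ?\<alpha> * (LINT x|lborel. \<bar>partial_deriv i \<phi> x\<bar>)) * (1/4) ^ k" for k
      proof -
        have "\<bar>(LINT x|lborel. U k x * partial_deriv i \<phi> x) - (LINT x|lborel. u x * partial_deriv i \<phi> x)\<bar>
          = \<bar>LINT x|lborel. U k x * partial_deriv i \<phi> x - u x * partial_deriv i \<phi> x\<bar>"
          by (simp add: Bochner_Integration.integral_diff[OF iU iu])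
        also have "\<dots> \<le> (LINT x|lborel. \<bar>U k x * partial_deriv i \<phi> x - u x * partial_deriv i \<phi> x\<bar>)"
          by (rule integral_abs_bound)
        also have "\<dots> \<le> (LINT x|lborel. (K * R powr ?\<alpha> * (1/4) ^ k) * \<bar>partial_deriv i \<phi> x\<bar>)"
        proof (rule integral_mono)
          show "integrable lborel (\<lambda>x. \<bar>U k x * partial_deriv i \<phi> x - u x * partial_deriv i \<phi> x\<bar>)"
            by (intro integrable_abs Bochner_Integration.integrable_diff iU iu)
          show "integrable lborel (\<lambda>x. (K * R powr ?\<alpha> * (1/4) ^ k) * \<bar>partial_deriv i \<phi> x\<bar>)"
            by (intro integrable_mult_right integrable_abs test_function_integrable d\<phi>)
          fix x
          show "\<bar>U k x * partial_deriv i \<phi> x - u x * partial_deriv i \<phi> x\<bar> \<le> (K * R powr ?\<alpha> * (1/4) ^ k) * \<bar>partial_deriv i \<phi> x\<bar>"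
          proof (cases "norm x \<le> R")
            case True
            have "norm x powr ?\<alpha> \<le> R powr ?\<alpha>" using True \<alpha> by (intro powr_mono2) auto
            then have "K * norm x powr ?\<alpha> * (1/4) ^ k \<le> K * R powr ?\<alpha> * (1/4) ^ k"
              using K(1) by (intro mult_right_mono mult_left_mono) auto
            then have "\<bar>U k x - u x\<bar> \<le> K * R powr ?\<alpha> * (1/4) ^ k" using Uu[of k x] by linarith
            then have "\<bar>U k x - u x\<bar> * \<bar>partial_deriv i \<phi> x\<bar> \<le> K * R powr ?\<alpha> * (1/4) ^ k * \<bar>partial_deriv i \<phi> x\<bar>"
              by (rule mult_right_mono) simp
            then show ?thesis by (simp only: left_diff_distrib[symmetric] abs_mult)
          next
            case False
            then show ?thesis using R(2)[of x] by simp
          qed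
        qed
        finally show ?thesis by (simp add: mult_ac)
      qed
      then show "eventually (\<lambda>k. norm ((LINT x|lborel. U k x * partial_deriv i \<phi> x) - (LINT x|lborel. u x * partial_deriv i \<phi> x))
        \<le> (K * R powr ?\<alpha> * (LINT x|lborel. \<bar>partial_deriv i \<phi> x\<bar>)) * (1/4) ^ k) sequentially" by simp
    qed
    then have l1: "(\<lambda>k. LINT x|lborel. U k x * partial_deriv i \<phi> x) \<longlonglongrightarrow> (LINT x|lborel. u x * partial_deriv i \<phi> x)"
      by (rule LIM_zero_cancel)
    obtain c where c: "\<And>F i. Lp_field p F \<Longrightarrow> \<bar>LINT x|lborel. F x $ i * \<phi> x\<bar> \<le> c * Lp_norm p F"
      using Lp_field_test_integral_le[OF p1(1) \<phi>] by blast
    have iF: "integrable lborel (\<lambda>x. E x $ i * \<phi> x)" if "Lp_field p E" for E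
      by (intro integrable_mult_test_function Lp_field_locally_integrable[OF p1(1) that] \<phi>)
    have "(\<lambda>k. (LINT x|lborel. ?F k x $ i * \<phi> x) - (LINT x|lborel. G x $ i * \<phi> x)) \<longlonglongrightarrow> 0"
    proof (rule Lim_null_comparison)
      show "(\<lambda>k. c * Lp_norm p (\<lambda>x. ?F k x - G x)) \<longlonglongrightarrow> 0"
        using tendsto_mult[OF tendsto_const[of c] G0] by simp
      have "\<bar>(LINT x|lborel. ?F k x $ i * \<phi> x) - (LINT x|lborel. G x $ i * \<phi> x)\<bar> \<le> c * Lp_norm p (\<lambda>x. ?F k x - G x)" for k
      proof -
        have "(LINT x|lborel. ?F k x $ i * \<phi> x) - (LINT x|lborel. G x $ i * \<phi> x) = (LINT x|lborel. (?F k x - G x) $ i * \<phi> x)"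
          by (simp add: left_diff_distrib Bochner_Integration.integral_diff[OF iF[OF F(2)] iF[OF G(1)]])
        then show ?thesis using c[OF Lp_field_diff[OF F(2) G(1) p1(3)], of k i] by simp
      qed
      then show "eventually (\<lambda>k. norm ((LINT x|lborel. ?F k x $ i * \<phi> x) - (LINT x|lborel. G x $ i * \<phi> x))
          \<le> c * Lp_norm p (\<lambda>x. ?F k x - G x)) sequentially" by simp
    qed
    then have l2: "(\<lambda>k. LINT x|lborel. ?F k x $ i * \<phi> x) \<longlonglongrightarrow> (LINT x|lborel. G x $ i * \<phi> x)"
      by (rule LIM_zero_cancel)
    have "(LINT x|lborel. U k x * partial_deriv i \<phi> x) = - (LINT x|lborel. ?F k x $ i * \<phi> x)" for k
      using gU[of k] \<phi> by (simp add: has_weak_grad_def is_weak_partial_def)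
    with l1 have "(\<lambda>k. - (LINT x|lborel. ?F k x $ i * \<phi> x)) \<longlonglongrightarrow> (LINT x|lborel. u x * partial_deriv i \<phi> x)" by simp
    from LIMSEQ_unique[OF this tendsto_minus[OF l2]]
    show "(LINT x|lborel. u x * partial_deriv i \<phi> x) = - (LINT x|lborel. G x $ i * \<phi> x)" .
  qed
  have uD: "u \<in> D1p p" by (rule D1pI[OF p hol gu G(1)])
  show ?thesis
  proof (rule that[OF uD])
    fix k
    have "has_weak_grad (\<lambda>x. 1 * w k x + (-1) * u x) (\<lambda>x. 1 *\<^sub>R ?F k x + (-1) *\<^sub>R G x)"
      by (intro has_weak_grad_add F gu D1p_continuous(2)[OF p w] D1p_continuous(2)[OF p uD])
    then have "has_weak_grad (\<lambda>x. w k x - u x) (\<lambda>x. ?F k x - G x)" by simp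
    from Lp_norm_weak_grad[OF this, of p] show "Lp_norm p (weak_grad (\<lambda>x. w k x - u x)) \<le> (1/4) ^ k"
      using G(2) by simp
  next
    fix b B assume "\<And>k. Lp_norm p (weak_grad (w k)) powr p \<le> b k" "b \<longlonglongrightarrow> B"
    from Lp_fatou(2)[OF p1(3) F(2) Lp_field_measurable[OF G(1)] G(3) this]
    show "Lp_norm p (weak_grad u) powr p \<le> B" using Lp_norm_weak_grad[OF gu, of p] by simp
  qed
qed

lemma clarkson_exponent_bounds:
  assumes "1 < p" shows "clarkson_exponent p > 1" "clarkson_exponent p / p > 0"
  using assms by (auto simp: clarkson_exponent_def field_simps)

lemma D1p_clarkson:
  fixes u v :: "real^'n \<Rightarrow> real"
  assumes p: "real CARD('n) < p" and u: "u \<in> D1p p" and v: "v \<in> D1p p"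
  shows "(Lp_norm p (weak_grad (\<lambda>x. u x - v x)) / 2) powr clarkson_exponent p
       + Lp_norm p (weak_grad (\<lambda>x. (1/2) * u x + (1/2) * v x)) powr clarkson_exponent p
     \<le> ((Lp_norm p (weak_grad u) powr p + Lp_norm p (weak_grad v) powr p) / 2) powr (clarkson_exponent p / p)"
proof -
  have p0: "p > 0" using p by linarith
  have wg: "Lp_field p (weak_grad u)" "Lp_field p (weak_grad v)" using u v D1p_iff[OF p] by auto
  have 1: "Lp_norm p (\<lambda>x. (1/2) *\<^sub>R (weak_grad u x - weak_grad v x)) = Lp_norm p (weak_grad (\<lambda>x. u x - v x)) / 2"
    using Lp_norm_scaleR[OF p0, of "1/2" "\<lambda>x. weak_grad u x - weak_grad v x"] D1p_diff_norm(2)[OF p u v] by simp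
  have 2: "Lp_norm p (weak_grad (\<lambda>x. (1/2) * u x + (1/2) * v x)) = Lp_norm p (\<lambda>x. (1/2) *\<^sub>R (weak_grad u x + weak_grad v x))"
    using D1p_lin(2)[OF p u v, of "1/2" "1/2"] by (simp add: scaleR_add_right)
  show ?thesis using clarkson[OF p wg] unfolding 1 2 .
qed

text \<open>The functional \<open>l\<close> stands for the integral against \<open>\<rho>\<close>;
  its bound by the gradient norm makes it continuous along the minimizing sequence, so the
  constraint passes to the limit. The conclusion states minimality over \<open>l w = 1\<close> in
  homogeneous form.\<close>

lemma minimizer_exists:
  fixes l :: "(real^'n \<Rightarrow> real) \<Rightarrow> real"
  assumes p: "real CARD('n) < p"
    and lin: "\<And>u v a b. u \<in> D1p p \<Longrightarrow> v \<in> D1p p \<Longrightarrow> l (\<lambda>x. a * u x + b * v x) = a * l u + b * l v"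
    and bdd: "\<And>w. w \<in> D1p p \<Longrightarrow> \<bar>l w\<bar> \<le> c * Lp_norm p (weak_grad w)"
    and nz: "w0 \<in> D1p p" "l w0 \<noteq> 0"
  obtains u where "u \<in> D1p p" "l u = 1"
    "\<And>w. w \<in> D1p p \<Longrightarrow> \<bar>l w\<bar> * Lp_norm p (weak_grad u) \<le> Lp_norm p (weak_grad w)"
proof -
  let ?N = "\<lambda>w :: real^'n \<Rightarrow> real. Lp_norm p (weak_grad w)"
  let ?s = "clarkson_exponent p"
  have n1: "CARD('n) \<ge> 1" by (simp add: Suc_leI)
  then have p1: "p > 1" using p by linarith
  have s: "?s > 1" "?s / p > 0" using clarkson_exponent_bounds[OF p1] by auto
  have scale: "(\<lambda>x. a * w x) \<in> D1p p" "l (\<lambda>x. a * w x) = a * l w" "?N (\<lambda>x. a * w x) = \<bar>a\<bar> * ?N w" if "w \<in> D1p p" for a w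
    using D1p_scale[OF p that, of a] lin[OF that that, of a 0] by simp_all
  define A where "A = {w \<in> D1p p. l w = 1}"
  define I where "I = Inf (?N ` A)"
  have ne: "?N ` A \<noteq> {}"
    using scale[OF nz(1), of "1 / l w0"] nz(2) by (auto simp: A_def)
  have bb: "bdd_below (?N ` A)" by (intro bdd_belowI[of _ 0]) (auto simp: Lp_norm_nonneg)
  have Ile: "I \<le> ?N w" if "w \<in> A" for w unfolding I_def by (rule cInf_lower) (use that bb in auto)
  have I0: "I \<ge> 0" unfolding I_def by (rule cInf_greatest[OF ne]) (auto simp: Lp_norm_nonneg)
  have "\<exists>w\<in>A. ?N w < I + inverse (real (Suc n))" for n
    using cInf_lessD[OF ne, of "I + inverse (real (Suc n))"] by (auto simp: I_def)
  then obtain y where y: "\<And>n. y n \<in> A" "\<And>n. ?N (y n) < I + inverse (real (Suc n))" by metis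
  have yD: "y n \<in> D1p p" "l (y n) = 1" for n using y(1)[of n] by (auto simp: A_def)
  have cauchy: "(?N (\<lambda>x. y m x - y n x) / 2) powr ?s \<le> (I + inverse (real (Suc k))) powr ?s - I powr ?s"
    if "k \<le> m" "k \<le> n" for k m n
  proof -
    have le: "?N (y i) powr p \<le> (I + inverse (real (Suc k))) powr p" if "k \<le> i" for i
    proof (rule powr_mono2)
      have "inverse (real (Suc i)) \<le> inverse (real (Suc k))" using that by (intro le_imp_inverse_le) auto
      then show "?N (y i) \<le> I + inverse (real (Suc k))" using y(2)[of i] by linarith
    qed (use p1 Lp_norm_nonneg in auto)
    \<comment> \<open>The midpoint of two competitors is a competitor, so its norm is at least
      \<open>I\<close>. What Clarkson's inequality leaves for the difference is governed by the
      excess of the two norms over \<open>I\<close>.\<close>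
    have mid: "(\<lambda>x. (1/2) * y m x + (1/2) * y n x) \<in> A"
      using D1p_lin(1)[OF p yD(1)[of m] yD(1)[of n], of "1/2" "1/2"] lin[OF yD(1)[of m] yD(1)[of n], of "1/2" "1/2"] yD(2)
      by (simp add: A_def)
    have "(?N (\<lambda>x. y m x - y n x) / 2) powr ?s + I powr ?s
      \<le> (?N (\<lambda>x. y m x - y n x) / 2) powr ?s + ?N (\<lambda>x. (1/2) * y m x + (1/2) * y n x) powr ?s"
      using Ile[OF mid] I0 s by (intro add_left_mono powr_mono2) auto
    also have "\<dots> \<le> ((?N (y m) powr p + ?N (y n) powr p) / 2) powr (?s / p)"
      by (rule D1p_clarkson[OF p yD(1) yD(1)])
    also have "\<dots> \<le> ((I + inverse (real (Suc k))) powr p) powr (?s / p)"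
      using le[OF that(1)] le[OF that(2)] s by (intro powr_mono2) auto
    also have "\<dots> = (I + inverse (real (Suc k))) powr ?s" using p1 by (simp add: powr_powr)
    finally show ?thesis by simp
  qed
  have "(\<lambda>k. (I + inverse (real (Suc k))) powr ?s - I powr ?s) \<longlonglongrightarrow> (I + 0) powr ?s - I powr ?s"
    using s I0 by (intro tendsto_diff tendsto_powr' tendsto_add tendsto_const LIMSEQ_inverse_real_of_nat) auto
  then have lim0: "(\<lambda>k. (I + inverse (real (Suc k))) powr ?s - I powr ?s) \<longlonglongrightarrow> 0" by simp
  have exM: "\<exists>M. \<forall>m\<ge>M. \<forall>n\<ge>M. ?N (\<lambda>x. y m x - y n x) \<le> (1/4) ^ k" for k
  proof -
    have "((1/4::real) ^ k / 2) powr ?s > 0" by simp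
    from order_tendstoD(2)[OF lim0 this] obtain M where
      "\<And>i. i \<ge> M \<Longrightarrow> (I + inverse (real (Suc i))) powr ?s - I powr ?s < ((1/4) ^ k / 2) powr ?s"
      unfolding eventually_sequentially by blast
    from this[OF order_refl]
    have M: "(I + inverse (real (Suc M))) powr ?s - I powr ?s < ((1/4) ^ k / 2) powr ?s" .
    show ?thesis
    proof (intro exI allI impI, rule ccontr)
      fix m n assume mn: "M \<le> m" "M \<le> n" "\<not> ?N (\<lambda>x. y m x - y n x) \<le> (1/4) ^ k"
      then have "((1/4) ^ k / 2) powr ?s \<le> (?N (\<lambda>x. y m x - y n x) / 2) powr ?s"
        using s by (intro powr_mono2) auto
      with cauchy[OF mn(1,2)] M show False by linarith
    qed
  qed
  have "\<forall>k. \<exists>M. \<forall>m\<ge>M. \<forall>n\<ge>M. ?N (\<lambda>x. y m x - y n x) \<le> (1/4) ^ k" using exM by blast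
  from choice[OF this] obtain M
    where M: "\<And>k m n. M k \<le> m \<Longrightarrow> M k \<le> n \<Longrightarrow> ?N (\<lambda>x. y m x - y n x) \<le> (1/4) ^ k" by blast
  \<comment> \<open>Partial sums give a monotone index that dominates both \<open>M k\<close>, for
    the Cauchy rate, and \<open>k\<close>, for the convergence of the norms.\<close>
  define f where "f k = (\<Sum>j\<le>k. Suc (M j))" for k
  have fmono: "f k \<le> f m" if "k \<le> m" for k m unfolding f_def using that by (intro sum_mono2) auto
  have fM: "M k \<le> f k" for k
    using member_le_sum[of k "{..k}" "\<lambda>j. Suc (M j)"] by (simp add: f_def)
  have fk: "k \<le> f k" for k
    using sum_mono[of "{..k}" "\<lambda>_. 1" "\<lambda>j. Suc (M j)"] by (simp add: f_def)
  have "?N (\<lambda>x. y (f k) x - y (f m) x) \<le> (1/4) ^ k" if "k \<le> m" for k m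
    using fM[of k] fmono[OF that] by (intro M) auto
  from D1p_complete[OF p, of "\<lambda>k. y (f k)", OF yD(1) this]
  obtain u where u: "u \<in> D1p p" "\<And>k. ?N (\<lambda>x. y (f k) x - u x) \<le> (1/4) ^ k"
    "\<And>b B. (\<And>k. ?N (y (f k)) powr p \<le> b k) \<Longrightarrow> b \<longlonglongrightarrow> B \<Longrightarrow> ?N u powr p \<le> B" by blast
  have "?N u powr p \<le> (I + 0) powr p"
  proof (rule u(3))
    show "(\<lambda>k. (I + inverse (real (Suc k))) powr p) \<longlonglongrightarrow> (I + 0) powr p"
      using p1 I0 by (intro tendsto_powr' tendsto_add tendsto_const LIMSEQ_inverse_real_of_nat) auto
    fix k
    have "inverse (real (Suc (f k))) \<le> inverse (real (Suc k))" using fk by (intro le_imp_inverse_le) auto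
    then have "?N (y (f k)) \<le> I + inverse (real (Suc k))" using y(2)[of "f k"] by linarith
    then show "?N (y (f k)) powr p \<le> (I + inverse (real (Suc k))) powr p"
      using p1 by (intro powr_mono2) (auto simp: Lp_norm_nonneg)
  qed
  then have NI: "?N u \<le> I"
    using powr_less_mono2[of p I "?N u"] p1 I0 by (cases "?N u \<le> I") auto
  have lu: "l u = 1"
  proof -
    have "(\<lambda>k. \<bar>c\<bar> * (1/4::real) ^ k) \<longlonglongrightarrow> \<bar>c\<bar> * 0"
      by (intro tendsto_mult tendsto_const LIMSEQ_power_zero) auto
    moreover have "\<bar>1 - l u\<bar> \<le> \<bar>c\<bar> * (1/4) ^ k" for k
    proof -
      have "\<bar>1 - l u\<bar> = \<bar>l (\<lambda>x. y (f k) x - u x)\<bar>"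
        using lin[OF yD(1)[of "f k"] u(1), of 1 "-1"] yD(2) by simp
      also have "\<dots> \<le> c * ?N (\<lambda>x. y (f k) x - u x)"
        by (rule bdd) (rule D1p_diff_norm(1)[OF p yD(1) u(1)])
      also have "\<dots> \<le> \<bar>c\<bar> * ?N (\<lambda>x. y (f k) x - u x)" by (intro mult_right_mono) (auto simp: Lp_norm_nonneg)
      also have "\<dots> \<le> \<bar>c\<bar> * (1/4) ^ k" by (intro mult_left_mono u(2)) auto
      finally show ?thesis .
    qed
    ultimately have "\<bar>1 - l u\<bar> \<le> 0" by (intro LIMSEQ_le_const) auto
    then show ?thesis by simp
  qed
  show ?thesis
  proof (rule that[OF u(1) lu])
    fix w :: "real^'n \<Rightarrow> real" assume w: "w \<in> D1p p"
    show "\<bar>l w\<bar> * ?N u \<le> ?N w"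
    proof (cases "l w = 0")
      case False
      have "(\<lambda>x. (1 / l w) * w x) \<in> A" using scale[OF w, of "1 / l w"] False by (simp add: A_def)
      from Ile[OF this] NI have "?N u \<le> \<bar>1 / l w\<bar> * ?N w" unfolding scale(3)[OF w] by linarith
      then show ?thesis using False by (simp add: field_simps)
    qed (simp add: Lp_norm_nonneg)
  qed
qed

section \<open>The generalized Morrey inequality\<close>

locale morrey_problem =
  fixes p :: real and \<rho> :: "(real^'n) set \<Rightarrow> real"
  assumes p: "real CARD('n) < p" and adm: "admissible \<rho>"
begin

abbreviation grad_norm :: "(real^'n \<Rightarrow> real) \<Rightarrow> real" where "grad_norm w \<equiv> Lp_norm p (weak_grad w)"
abbreviation moment :: "real^'n" where "moment \<equiv> signed_integral \<rho> (\<lambda>y. y)"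

lemma \<rho>: "signed_borel_measure \<rho>" "compact (signed_support \<rho>)" "\<rho> UNIV = 0" "moment \<noteq> 0"
  using adm by (auto simp: admissible_def)

lemma p1: "p > 1"
proof -
  have "CARD('n) \<ge> 1" by (simp add: Suc_leI)
  then show ?thesis using p by linarith
qed

lemma signed_integral_lin:
  assumes "u \<in> D1p p" "v \<in> D1p p"
  shows "signed_integral \<rho> (\<lambda>x. a * u x + b * v x) = a * signed_integral \<rho> u + b * signed_integral \<rho> v"
proof -
  have c: "continuous_on UNIV u" "continuous_on UNIV v" using D1p_continuous(1)[OF p] assms by auto
  have "signed_integral \<rho> (\<lambda>x. a * u x + b * v x) = signed_integral \<rho> (\<lambda>x. a * u x) + signed_integral \<rho> (\<lambda>x. b * v x)"
    by (intro signed_integral_add \<rho> continuous_intros c)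
  then show ?thesis
    using signed_integral_bounded_linear[OF \<rho>(1,2) c(1) bounded_linear_mult_right[of a]]
      signed_integral_bounded_linear[OF \<rho>(1,2) c(2) bounded_linear_mult_right[of b]] by simp
qed

text \<open>The Morrey quotient for the pushforward under a similarity, with its denominator
  evaluated: the moment becomes \<open>r *\<^sub>R T moment\<close>, and the translation drops out
  because \<open>\<rho> UNIV = 0\<close>.\<close>

definition quotient :: "real \<Rightarrow> (real^'n \<Rightarrow> real^'n) \<Rightarrow> real^'n \<Rightarrow> (real^'n \<Rightarrow> real) \<Rightarrow> real" where
  "quotient r T z u = \<bar>signed_integral \<rho> (\<lambda>x. u (similarity.S r T z x))\<bar> / (r powr (1 - real CARD('n) / p) * norm moment powr (1 - real CARD('n) / p))"

lemma quotient_push_forward: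
  assumes S: "similarity r T" and u: "u \<in> D1p p"
  shows "\<bar>signed_integral (push_forward (similarity.S r T z) \<rho>) u\<bar> /
    norm (signed_integral (push_forward (similarity.S r T z) \<rho>) (\<lambda>x. x)) powr (1 - real CARD('n) / p) = quotient r T z u"
proof -
  interpret similarity r T z by (rule S)
  note push = signed_integral_push_forward[OF \<rho>(1) measurable_S measurable_R R_S S_R]
  have "u \<in> borel_measurable borel"
    by (rule borel_measurable_continuous_onI[OF D1p_continuous(1)[OF p u]])
  note 1 = push[OF this]
  have bl: "bounded_linear (\<lambda>y. r *\<^sub>R T y)"
    by (rule bounded_linear_scaleR_right[THEN bounded_linear_compose, OF bounded_linear_T])
  have "signed_integral (push_forward S \<rho>) (\<lambda>x. x) = signed_integral \<rho> S"
    using push[of "\<lambda>x. x"] by simp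
  also have "\<dots> = signed_integral \<rho> (\<lambda>y. r *\<^sub>R T y) + signed_integral \<rho> (\<lambda>_. z)"
    unfolding S_def[abs_def] using bl
    by (intro signed_integral_add \<rho> continuous_on_const linear_continuous_on)
  also have "\<dots> = r *\<^sub>R T moment"
    using signed_integral_bounded_linear[OF \<rho>(1,2) continuous_on_id bl] signed_integral_const[OF \<rho>(1), of z] \<rho>(3) by simp
  finally have "norm (signed_integral (push_forward S \<rho>) (\<lambda>x. x)) = r * norm moment"
    using r by (simp add: orthogonal_transformation_norm[OF T])
  then show ?thesis by (simp only: 1 quotient_def powr_mult)
qed

lemma similarities_eq: "(similarities :: (real^'n \<Rightarrow> real^'n) set) = {similarity.S r T z | r T z. similarity r T}"
proof (intro set_eqI iffI)
  fix S :: "real^'n \<Rightarrow> real^'n" assume "S \<in> similarities"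
  then obtain r T z where S: "S = (\<lambda>y. r *\<^sub>R T y + z)" and "r > 0" "orthogonal_transformation T"
    unfolding similarities_def by blast
  then have sim: "similarity r T" by (simp add: similarity_def)
  have "S = similarity.S r T z" by (simp add: S fun_eq_iff similarity.S_def[OF sim])
  with sim show "S \<in> {similarity.S r T z | r T z. similarity r T}" by blast
next
  fix S :: "real^'n \<Rightarrow> real^'n" assume "S \<in> {similarity.S r T z | r T z. similarity r T}"
  then obtain r T z where S: "S = similarity.S r T z" and sim: "similarity r T" by blast
  have "S = (\<lambda>y. r *\<^sub>R T y + z)" by (simp add: S fun_eq_iff similarity.S_def[OF sim])
  moreover have "r > 0" "orthogonal_transformation T" using sim by (auto simp: similarity_def)
  ultimately show "S \<in> similarities" unfolding similarities_def by blast
qed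

lemma morrey_seminorm_eq:
  assumes u: "u \<in> D1p p"
  shows "morrey_seminorm p \<rho> u = (SUP (r, T, z)\<in>{(r, T, z). similarity r T}. ereal (quotient r T z u))"
proof -
  let ?f = "\<lambda>\<mu>. ereal (\<bar>signed_integral \<mu> u\<bar> / norm (signed_integral \<mu> (\<lambda>x. x)) powr (1 - real CARD('n) / p))"
  let ?g = "\<lambda>(r, T, z). push_forward (similarity.S r T z) \<rho>"
  have eq: "{push_forward S \<rho> | S. S \<in> similarities} = ?g ` {(r, T, z). similarity r T}"
    unfolding similarities_eq by (auto simp: image_iff) blast
  have "morrey_seminorm p \<rho> u = (SUP t\<in>{(r, T, z). similarity r T}. ?f (?g t))"
    unfolding morrey_seminorm_def eq image_image ..
  also have "\<dots> = (SUP (r, T, z)\<in>{(r, T, z). similarity r T}. ereal (quotient r T z u))"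
    by (rule SUP_cong) (auto simp: quotient_push_forward[OF _ u])
  finally show ?thesis .
qed

lemma quotient_le_seminorm:
  assumes "u \<in> D1p p" "similarity r T" shows "ereal (quotient r T z u) \<le> morrey_seminorm p \<rho> u"
  unfolding morrey_seminorm_eq[OF assms(1)]
  by (rule SUP_upper2[of "(r, T, z)"]) (use assms(2) in auto)

lemma seminorm_le:
  assumes "u \<in> D1p p" "\<And>r T z. similarity r T \<Longrightarrow> quotient r T z u \<le> c"
  shows "morrey_seminorm p \<rho> u \<le> ereal c"
  unfolding morrey_seminorm_eq[OF assms(1)] by (rule SUP_least) (use assms(2) in auto)

lemma similarity_id: "similarity 1 (id :: real^'n \<Rightarrow> real^'n)"
  by (simp add: similarity_def orthogonal_transformation_def linear_id)

lemma quotient_id: "quotient 1 id 0 u = \<bar>signed_integral \<rho> u\<bar> / norm moment powr (1 - real CARD('n) / p)"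
  by (simp add: quotient_def similarity.S_def[OF similarity_id])

lemma moment_pos: "norm moment powr (1 - real CARD('n) / p) > 0"
  using \<rho>(4) by simp

lemma quotient_nonneg: "quotient r T z u \<ge> 0"
  by (simp add: quotient_def)

text \<open>The degenerate case, in which no function can be normalised to have integral 1.\<close>

lemma extremal_if_trivial:
  assumes triv: "\<And>w. w \<in> D1p p \<Longrightarrow> signed_integral \<rho> w = 0" and v: "v \<in> D1p p"
  shows "morrey_seminorm p \<rho> v = 0" "extremal p \<rho> v"
proof -
  have sem: "morrey_seminorm p \<rho> w = 0" if w: "w \<in> D1p p" for w
  proof (rule antisym)
    have "quotient r T z w \<le> 0" if "similarity r T" for r T z
      using triv[OF similarity.D1p_S(1)[OF that p w]] by (simp add: quotient_def)
    then show "morrey_seminorm p \<rho> w \<le> 0" using seminorm_le[OF w, of 0] by (simp add: zero_ereal_def)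
    show "0 \<le> morrey_seminorm p \<rho> w"
      using quotient_le_seminorm[OF w similarity_id, of 0] quotient_nonneg[of 1 id 0 w]
      by (metis ereal_less_eq(5) order_trans)
  qed
  show "morrey_seminorm p \<rho> v = 0" by (rule sem[OF v])
  \<comment> \<open>If \<open>grad_norm v\<close> is 0, the product is 0 for any constant; otherwise
    \<open>v\<close> itself excludes negative constants, and 0 is the least one.\<close>
  have "morrey_constant p \<rho> * grad_norm v = 0"
  proof (cases "grad_norm v = 0")
    case False
    then have N: "grad_norm v > 0" using Lp_norm_nonneg[of p "weak_grad v"] by simp
    have "morrey_inequality p \<rho> c \<longleftrightarrow> 0 \<le> c" for c
    proof
      assume "morrey_inequality p \<rho> c"
      then have "0 \<le> ereal (c * grad_norm v)" using v sem[OF v] by (force simp: morrey_inequality_def)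
      then show "0 \<le> c" using N by (simp add: zero_le_mult_iff)
    next
      assume "0 \<le> c"
      then show "morrey_inequality p \<rho> c"
        by (simp add: morrey_inequality_def sem Lp_norm_nonneg)
    qed
    then have "morrey_constant p \<rho> = 0" unfolding morrey_constant_def by (intro Least_equality) auto
    then show ?thesis by simp
  qed simp
  with v sem[OF v] show "extremal p \<rho> v" by (simp add: extremal_def zero_ereal_def)
qed

end

section \<open>Extremals and stability, given a minimizer\<close>

locale morrey_minimizer = morrey_problem p \<rho> for p and \<rho> :: "(real^'n) set \<Rightarrow> real" +
  fixes u0 :: "real^'n \<Rightarrow> real"
  assumes u0: "u0 \<in> D1p p" "signed_integral \<rho> u0 = 1" "grad_norm u0 > 0"
    and minimal: "\<And>w. w \<in> D1p p \<Longrightarrow> \<bar>signed_integral \<rho> w\<bar> * grad_norm u0 \<le> grad_norm w"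
begin

text \<open>The quotient of \<open>u0\<close> for the identity similarity, divided by
  \<open>grad_norm u0\<close>; the integral of \<open>u0\<close> is 1.\<close>

definition best :: real where "best = 1 / (grad_norm u0 * norm moment powr (1 - real CARD('n) / p))"

lemma best_pos: "best > 0"
  using u0(3) moment_pos by (simp add: best_def)

lemma quotient_le:
  assumes S: "similarity r T" and u: "u \<in> D1p p"
  shows "quotient r T z u \<le> best * grad_norm u"
proof -
  interpret similarity r T z by (rule S)
  have "\<bar>signed_integral \<rho> (\<lambda>x. u (S x))\<bar> * grad_norm u0 \<le> r powr (1 - real CARD('n) / p) * grad_norm u"
    using minimal[OF D1p_S(1)[OF p u]] D1p_S(2)[OF p u] by simp
  then show ?thesis
    using u0(3) moment_pos r by (simp add: quotient_def best_def field_simps)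
qed

lemma seminorm_le_best: "u \<in> D1p p \<Longrightarrow> morrey_seminorm p \<rho> u \<le> ereal (best * grad_norm u)"
  by (intro seminorm_le quotient_le)

text \<open>The function \<open>u0\<close> with the identity similarity excludes every constant
  smaller than \<open>best\<close>.\<close>

lemma best_le:
  assumes "\<forall>w\<in>D1p p. morrey_seminorm p \<rho> w \<le> ereal (c * grad_norm w)"
  shows "best \<le> c"
proof -
  have "ereal (quotient 1 id 0 u0) \<le> ereal (c * grad_norm u0)"
    using quotient_le_seminorm[OF u0(1) similarity_id] assms u0(1) order_trans by blast
  then show ?thesis using u0 moment_pos by (simp add: quotient_id best_def field_simps)
qed

lemma morrey_constant_eq: "morrey_constant p \<rho> = best"
  unfolding morrey_constant_def morrey_inequality_def
  by (rule Least_equality) (use seminorm_le_best best_le in auto)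

lemma matching_extremal:
  assumes S: "similarity r T" and v: "v \<in> D1p p"
  obtains u where "extremal p \<rho> u" "u \<in> D1p p" "best * grad_norm u = quotient r T z v"
    "grad_norm u \<le> grad_norm (\<lambda>x. (1/2) * u x + (1/2) * v x)"
proof -
  interpret similarity r T z by (rule S)
  define t where "t = signed_integral \<rho> (\<lambda>x. v (S x))"
  \<comment> \<open>Chosen so that composing with \<open>S\<close> gives \<open>t * u0\<close>, a
    multiple of the minimizer whose integral is the one \<open>v\<close> has after composition with
    \<open>S\<close>. For \<open>t = 0\<close> it is the zero function, also an extremal.\<close>
  define u where "u y = t * u0 (R y)" for y
  have R1: "(\<lambda>y. u0 (R y)) \<in> D1p p" "grad_norm (\<lambda>y. u0 (R y)) = (1 / r) powr (1 - real CARD('n) / p) * grad_norm u0"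
    unfolding R_eq by (rule similarity.D1p_S[OF similarity_inverse p u0(1)])+
  have uD: "u \<in> D1p p" and Nu: "grad_norm u = \<bar>t\<bar> * ((1 / r) powr (1 - real CARD('n) / p) * grad_norm u0)"
    using D1p_scale[OF p R1(1), of t] R1(2) by (simp_all add: u_def[abs_def])
  have Nu': "grad_norm u * r powr (1 - real CARD('n) / p) = \<bar>t\<bar> * grad_norm u0"
    using r by (simp add: Nu powr_divide)
  have uS: "(\<lambda>x. u (S x)) = (\<lambda>x. t * u0 x)" by (simp add: u_def R_S)
  have lu: "signed_integral \<rho> (\<lambda>x. u (S x)) = t"
    unfolding uS using signed_integral_lin[OF u0(1) u0(1), of t 0] u0(2) by simp
  have qu: "quotient r T z u = quotient r T z v" by (simp add: quotient_def lu t_def)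
  have qv: "best * grad_norm u = quotient r T z v"
    using u0(3) moment_pos r Nu' by (simp add: quotient_def best_def t_def field_simps)
  have "morrey_seminorm p \<rho> u = ereal (best * grad_norm u)"
    using seminorm_le_best[OF uD] quotient_le_seminorm[OF uD S, of z] qu qv by (intro antisym) auto
  then have ext: "extremal p \<rho> u" using uD by (simp add: extremal_def morrey_constant_eq)
  let ?m = "\<lambda>x. (1/2) * u x + (1/2) * v x"
  have mD: "?m \<in> D1p p" by (rule D1p_lin(1)[OF p uD v])
  have "signed_integral \<rho> (\<lambda>x. ?m (S x)) = t"
    using signed_integral_lin[OF D1p_S(1)[OF p uD] D1p_S(1)[OF p v], of "1/2" "1/2"] lu by (simp add: t_def)
  then have "\<bar>t\<bar> * grad_norm u0 \<le> r powr (1 - real CARD('n) / p) * grad_norm ?m"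
    using minimal[OF D1p_S(1)[OF p mD]] D1p_S(2)[OF p mD] by simp
  then have "r powr (1 - real CARD('n) / p) * grad_norm u \<le> r powr (1 - real CARD('n) / p) * grad_norm ?m" using Nu' by (simp add: mult.commute)
  then have "grad_norm u \<le> grad_norm ?m" using r by simp
  with that[OF ext uD qv] show ?thesis by simp
qed

text \<open>
  The supremum defining the seminorm need not be attained at \<open>v\<close>. If it is smaller than
  \<open>best * grad_norm v\<close>, the strict convexity gap of the right-hand side in Clarkson's inequality
  absorbs the error made by a similarity that almost attains it.
\<close>

lemma stability:
  assumes v: "v \<in> D1p p" and C: "best \<le> C"
  obtains u where "extremal p \<rho> u"
    "(C / 2) powr clarkson_exponent p * Lp_norm p (\<lambda>x. weak_grad u x - weak_grad v x) powr clarkson_exponent p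
      + real_of_ereal (morrey_seminorm p \<rho> v) powr clarkson_exponent p
      \<le> C powr clarkson_exponent p * grad_norm v powr clarkson_exponent p"
proof -
  let ?s = "clarkson_exponent p"
  have s: "?s > 1" "?s / p > 0" using clarkson_exponent_bounds[OF p1] by auto
  define d where "d = grad_norm v"
  have d0: "d \<ge> 0" by (simp add: d_def Lp_norm_nonneg)
  define A where "A = real_of_ereal (morrey_seminorm p \<rho> v)"
  have sem0: "0 \<le> morrey_seminorm p \<rho> v"
    using quotient_le_seminorm[OF v similarity_id, of 0] quotient_nonneg[of 1 id 0 v]
    by (metis ereal_less_eq(5) order_trans)
  have semA: "morrey_seminorm p \<rho> v = ereal A"
    using sem0 seminorm_le_best[OF v] unfolding A_def by (cases "morrey_seminorm p \<rho> v") auto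
  have A: "0 \<le> A" "A \<le> best * d" using sem0 seminorm_le_best[OF v] by (auto simp: semA d_def)
  \<comment> \<open>The gradient norm of an extremal whose seminorm is \<open>A\<close>.\<close>
  define a where "a = A / best"
  have Aa: "A = best * a" and a: "0 \<le> a" "a \<le> d"
    using A best_pos by (auto simp: a_def field_simps)
  have C0: "C > 0" using best_pos C by simp
  \<comment> \<open>Since \<open>A = best * a\<close> and \<open>best \<le> C\<close>, it is enough
    to prove the inequality with \<open>a\<close> for \<open>A\<close> and without \<open>C\<close>,
    and to multiply by \<open>C powr ?s\<close> at the end.\<close>
  have AC: "A powr ?s \<le> C powr ?s * a powr ?s"
  proof -
    have "A \<le> C * a" using Aa a C by (simp add: mult_right_mono)
    then have "A powr ?s \<le> (C * a) powr ?s" using A s by (intro powr_mono2) auto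
    then show ?thesis by (simp only: powr_mult)
  qed
  show ?thesis
  proof (cases "a = d")
    \<comment> \<open>Equality in Morrey's inequality: \<open>v\<close> is itself an extremal and
      serves as \<open>u\<close>.\<close>
    case True
    have "extremal p \<rho> v"
      using v semA Aa True by (simp add: extremal_def morrey_constant_eq d_def)
    moreover have "Lp_norm p (\<lambda>x. weak_grad v x - weak_grad v x) = 0"
      using p1 by (simp add: Lp_norm_def)
    ultimately show ?thesis using that[of v] AC True by (simp add: A_def d_def)
  next
    case False
    then have ad: "a < d" using a by simp
    have "\<exists>r T z. similarity r T \<and> best * (a - inverse (real (Suc n))) < quotient r T z v" for n
    proof -
      have "best * (a - inverse (real (Suc n))) < A" using best_pos Aa by simp
      then have "ereal (best * (a - inverse (real (Suc n)))) < morrey_seminorm p \<rho> v" by (simp add: semA)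
      then show ?thesis unfolding morrey_seminorm_eq[OF v] less_SUP_iff by auto
    qed
    then have "\<forall>n. \<exists>b. (\<exists>r T z. similarity r T \<and> best * b = quotient r T z v) \<and> a - inverse (real (Suc n)) < b"
    proof (intro allI)
      fix n
      obtain r T z where q: "similarity r T" "best * (a - inverse (real (Suc n))) < quotient r T z v"
        using \<open>\<And>n. \<exists>r T z. similarity r T \<and> best * (a - inverse (real (Suc n))) < quotient r T z v\<close> by blast
      have "best * (quotient r T z v / best) = quotient r T z v" using best_pos by simp
      moreover have "a - inverse (real (Suc n)) < quotient r T z v / best"
        using q(2) best_pos by (simp add: pos_less_divide_eq mult.commute)
      ultimately show "\<exists>b. (\<exists>r T z. similarity r T \<and> best * b = quotient r T z v) \<and> a - inverse (real (Suc n)) < b"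
        using q(1) by blast
    qed
    \<comment> \<open>\<open>b n\<close> is the gradient norm of an extremal that matches
      \<open>v\<close> under the n-th almost optimal similarity.\<close>
    from choice[OF this] obtain b where b: "\<And>n. \<exists>r T z. similarity r T \<and> best * b n = quotient r T z v"
      "\<And>n. a - inverse (real (Suc n)) < b n" by blast
    have ba: "0 \<le> b n" "b n \<le> a" for n
    proof -
      obtain r T z where q: "similarity r T" "best * b n = quotient r T z v" using b(1) by blast
      have "0 \<le> best * b n" using q(2) quotient_nonneg by simp
      then show "0 \<le> b n" using best_pos by (simp add: zero_le_mult_iff)
      have "ereal (best * b n) \<le> ereal A" using quotient_le_seminorm[OF v q(1), of z] q(2) semA by simp
      then show "b n \<le> a" using best_pos Aa by simp
    qed
    have blim: "b \<longlonglongrightarrow> a"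
    proof (rule tendsto_sandwich)
      have "(\<lambda>n. a - inverse (real (Suc n))) \<longlonglongrightarrow> a - 0"
        by (intro tendsto_diff tendsto_const LIMSEQ_inverse_real_of_nat)
      then show "(\<lambda>n. a - inverse (real (Suc n))) \<longlonglongrightarrow> a" by simp
      show "\<forall>\<^sub>F n in sequentially. a - inverse (real (Suc n)) \<le> b n" using b(2) by (simp add: less_imp_le)
      show "\<forall>\<^sub>F n in sequentially. b n \<le> a" using ba by simp
      show "(\<lambda>_. a) \<longlonglongrightarrow> a" by (rule tendsto_const)
    qed
    \<comment> \<open>If the matching extremal has gradient norm \<open>b\<close>, Clarkson's
      inequality bounds \<open>(?D / 2) powr ?s + a powr ?s\<close> by \<open>?X b\<close>. At
      \<open>b = a\<close> the last two powers cancel, and what remains is the power of a mean of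
      \<open>a\<close> and \<open>d\<close>, strictly less than \<open>d powr ?s\<close>. By
      continuity the strict inequality persists for \<open>b\<close> close to
      \<open>a\<close>.\<close>
    let ?X = "\<lambda>b. ((b powr p + d powr p) / 2) powr (?s / p) - b powr ?s + a powr ?s"
    have bp: "(\<lambda>n. b n powr c) \<longlonglongrightarrow> a powr c" if "c > 0" for c
      using blim ba that by (intro tendsto_powr' tendsto_const) auto
    have "(\<lambda>n. (b n powr p + d powr p) / 2) \<longlonglongrightarrow> (a powr p + d powr p) / 2"
      by (intro tendsto_divide tendsto_add bp tendsto_const) (use p1 in auto)
    then have "(\<lambda>n. ((b n powr p + d powr p) / 2) powr (?s / p)) \<longlonglongrightarrow> ((a powr p + d powr p) / 2) powr (?s / p)"
      by (rule tendsto_powr'[OF _ tendsto_const]) (use s in simp)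
    then have "(\<lambda>n. ?X (b n)) \<longlonglongrightarrow> ?X a"
      by (intro tendsto_add tendsto_diff bp tendsto_const) (use s in auto)
    moreover have "?X a < d powr ?s"
    proof -
      have "a powr p < d powr p" using ad a p1 by (intro powr_less_mono2) auto
      then have "((a powr p + d powr p) / 2) powr (?s / p) < (d powr p) powr (?s / p)"
        using s by (intro powr_less_mono2) auto
      then show ?thesis using p1 by (simp add: powr_powr)
    qed
    ultimately have "\<forall>\<^sub>F n in sequentially. ?X (b n) < d powr ?s" by (rule order_tendstoD(2))
    then obtain n where n: "?X (b n) < d powr ?s" unfolding eventually_sequentially by blast
    obtain r T z where q: "similarity r T" "best * b n = quotient r T z v" using b(1) by blast
    obtain u where u: "extremal p \<rho> u" "u \<in> D1p p" "best * grad_norm u = quotient r T z v"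
      "grad_norm u \<le> grad_norm (\<lambda>x. (1/2) * u x + (1/2) * v x)"
      using matching_extremal[OF q(1) v] by blast
    have "best * grad_norm u = best * b n" by (simp only: u(3) q(2))
    then have Nu: "grad_norm u = b n" using best_pos by (subst (asm) mult_cancel_left) simp
    let ?D = "Lp_norm p (\<lambda>x. weak_grad u x - weak_grad v x)"
    have "(?D / 2) powr ?s + b n powr ?s \<le> (?D / 2) powr ?s + grad_norm (\<lambda>x. (1/2) * u x + (1/2) * v x) powr ?s"
      using u(4) ba s unfolding Nu by (intro add_left_mono powr_mono2) auto
    also have "\<dots> \<le> ((b n powr p + d powr p) / 2) powr (?s / p)"
      using D1p_clarkson[OF p u(2) v] D1p_diff_norm(2)[OF p u(2) v] by (simp add: Nu d_def)
    finally have "(?D / 2) powr ?s + a powr ?s \<le> d powr ?s" using n by simp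
    then have "C powr ?s * ((?D / 2) powr ?s + a powr ?s) \<le> C powr ?s * d powr ?s"
      by (rule mult_left_mono) simp
    then have "C powr ?s * (?D / 2) powr ?s + A powr ?s \<le> C powr ?s * d powr ?s"
      using AC by (simp add: distrib_left)
    moreover have "C powr ?s * (?D / 2) powr ?s = (C / 2) powr ?s * ?D powr ?s"
      by (simp flip: powr_mult)
    ultimately show ?thesis using that[OF u(1)] by (simp add: A_def d_def)
  qed
qed

end

theorem theorem1p2:
  fixes p C :: real
    and \<rho> :: "(real^'n) set \<Rightarrow> real"
    and v :: "real^'n \<Rightarrow> real"
  assumes "real CARD('n) < p"
    and "admissible \<rho>"
    and "v \<in> D1p p"
    and "\<forall>w \<in> D1p p. morrey_seminorm p \<rho> w \<le> ereal (C * Lp_norm p (weak_grad w))"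
  shows "\<exists>u. extremal p \<rho> u \<and>
    (2 < p \<longrightarrow>
      (C / 2) powr p * Lp_norm p (\<lambda>x. weak_grad u x - weak_grad v x) powr p
        + real_of_ereal (morrey_seminorm p \<rho> v) powr p
      \<le> C powr p * Lp_norm p (weak_grad v) powr p) \<and>
    (1 < p \<and> p \<le> 2 \<longrightarrow>
      CARD('n) = 1 \<and>
      (C / 2) powr (p / (p - 1))
          * Lp_norm p (\<lambda>x. weak_grad u x - weak_grad v x) powr (p / (p - 1))
        + real_of_ereal (morrey_seminorm p \<rho> v) powr (p / (p - 1))
      \<le> C powr (p / (p - 1)) * Lp_norm p (weak_grad v) powr (p / (p - 1)))"
proof -
  interpret morrey_problem p \<rho> using assms by unfold_locales
  let ?s = "clarkson_exponent p"
  have "\<exists>u. extremal p \<rho> u \<and>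
    (C / 2) powr ?s * Lp_norm p (\<lambda>x. weak_grad u x - weak_grad v x) powr ?s
      + real_of_ereal (morrey_seminorm p \<rho> v) powr ?s \<le> C powr ?s * grad_norm v powr ?s"
  proof (cases "\<forall>w\<in>D1p p. signed_integral \<rho> w = 0")
    \<comment> \<open>With \<open>v\<close> as its own extremal, the seminorm and the gradient
      difference both vanish, and the right-hand side is nonnegative whatever the sign of
      \<open>C\<close>.\<close>
    case True
    then show ?thesis
      using extremal_if_trivial[OF _ assms(3)] p1 by (intro exI[of _ v]) (simp add: Lp_norm_def)
  next
    case False
    then obtain w0 where w0: "w0 \<in> D1p p" "signed_integral \<rho> w0 \<noteq> 0" by blast
    have bdd: "\<bar>signed_integral \<rho> w\<bar> \<le> (C * norm moment powr (1 - real CARD('n) / p)) * grad_norm w" if w: "w \<in> D1p p" for w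
    proof -
      have "ereal (quotient 1 id 0 w) \<le> ereal (C * grad_norm w)"
        using quotient_le_seminorm[OF w similarity_id] assms(4) w order_trans by blast
      then show ?thesis using moment_pos by (simp add: quotient_id field_simps)
    qed
    obtain u0 where u0: "u0 \<in> D1p p" "signed_integral \<rho> u0 = 1"
      "\<And>w. w \<in> D1p p \<Longrightarrow> \<bar>signed_integral \<rho> w\<bar> * grad_norm u0 \<le> grad_norm w"
      using minimizer_exists[OF p signed_integral_lin bdd w0] by blast
    have "grad_norm u0 \<noteq> 0" using bdd[OF u0(1)] u0(2) by auto
    then have "grad_norm u0 > 0" using Lp_norm_nonneg[of p "weak_grad u0"] by simp
    then interpret morrey_minimizer p \<rho> u0 using u0 by unfold_locales
    show ?thesis using stability[OF assms(3) best_le[OF assms(4)]] by blast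
  qed
  then obtain u where u: "extremal p \<rho> u" "(C / 2) powr ?s * Lp_norm p (\<lambda>x. weak_grad u x - weak_grad v x) powr ?s
      + real_of_ereal (morrey_seminorm p \<rho> v) powr ?s \<le> C powr ?s * grad_norm v powr ?s" by blast
  have "CARD('n) = 1" if "p \<le> 2"
  proof -
    have "CARD('n) \<ge> 1" by (simp add: Suc_leI)
    then show ?thesis using p that by linarith
  qed
  with u show ?thesis by (intro exI[of _ u]) (auto simp: clarkson_exponent_def)
qed

end
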